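(* Let $p$ be a prime. Suppose that $\mathbb{Q}\subseteq F\subseteq \mathbb{Q}_n$ is a field, where $n$ is the conductor of $F$. Write $n=p^a m$, where $m$ is not divisible by $p$. If $|\mathbb{Q}_n:\langle F,\mathbb{Q}_m\rangle|$ is not divisible by $p$, then there is a finite solvable group $G$ and $\chi\in\mathrm{Irr}(G)$ of $p$-height zero such that $\mathbb{Q}(\chi)=F$.
   Context: $\mathrm{Irr}(G)$ is the set of complex irreducible characters of $G$. For a positive integer $n$, $\mathbb{Q}_n=\mathbb{Q}(e^{2\pi i/n})$. The conductor of a subfield $F$ of a cyclotomic field is the smallest positive integer $n$ with $F\subseteq\mathbb{Q}_n$. $\langle K,L\rangle$ is the field generated by $K$ and $L$. For a character $\chi$, $\mathbb{Q}(\chi)$ is the smallest extension of $\mathbb{Q}$ containing all values of $\chi$. If $\chi\in\mathrm{Irr}(G)$ lies in the (Brauer) $p$-block $B$ of $G$ with defect group $D$, the $p$-height of $\chi$ is the integer $h\geq 0$ with $\chi(1)_p=|G:D|_p\,p^{h}$, where $k_p$ is the largest power of $p$ dividing $k$; $\chi$ has $p$-height zero if $h=0$. *)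

theory Defs
  imports
    "HOL-Algebra.Generated_Fields"
    "HOL-Algebra.Embedded_Algebras"
    "HOL-Algebra.Solvable_Groups"
    "HOL-Algebra.Ideal"
    "Jordan_Normal_Form.VS_Connect"
    "Jordan_Normal_Form.Char_Poly"
    Complex_Main
begin

section \<open>Subfields of the complex numbers\<close>

text \<open>The complex numbers as a ring record are \<^term>\<open>class_ring :: complex ring\<close>.\<close>

definition generated_subfield :: "complex set \<Rightarrow> complex set" where
  "generated_subfield S = generate_field class_ring S"

definition cyclotomic_field :: "nat \<Rightarrow> complex set" where
  "cyclotomic_field n = generated_subfield {exp (2 * of_real pi * \<i> / of_nat n)}"

definition conductor :: "complex set \<Rightarrow> nat" where
  "conductor F = (LEAST n. 0 < n \<and> F \<subseteq> cyclotomic_field n)"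

definition extension_degree :: "complex set \<Rightarrow> complex set \<Rightarrow> nat" where
  "extension_degree E K = ring.dim (class_ring :: complex ring) K E"


section \<open>Irreducible complex characters\<close>

definition matrix_representation ::
  "('a, 'b) monoid_scheme \<Rightarrow> nat \<Rightarrow> ('a \<Rightarrow> complex mat) \<Rightarrow> bool" where
  "matrix_representation G n \<rho> \<longleftrightarrow>
     (\<forall>g\<in>carrier G. \<rho> g \<in> carrier_mat n n) \<and>
     \<rho> \<one>\<^bsub>G\<^esub> = 1\<^sub>m n \<and>
     (\<forall>g\<in>carrier G. \<forall>h\<in>carrier G. \<rho> (g \<otimes>\<^bsub>G\<^esub> h) = \<rho> g * \<rho> h)"

definition irreducible_representation ::
  "('a, 'b) monoid_scheme \<Rightarrow> nat \<Rightarrow> ('a \<Rightarrow> complex mat) \<Rightarrow> bool" where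
  "irreducible_representation G n \<rho> \<longleftrightarrow>
     matrix_representation G n \<rho> \<and> 0 < n \<and>
     (\<forall>W. VectorSpace.subspace class_ring W (module_vec TYPE(complex) n) \<and>
          (\<forall>g\<in>carrier G. \<forall>w\<in>W. \<rho> g *\<^sub>v w \<in> W) \<longrightarrow>
          W = {0\<^sub>v n} \<or> W = carrier_vec n)"

definition mat_trace :: "complex mat \<Rightarrow> complex" where
  "mat_trace A = sum_list (diag_mat A)"

text \<open>Characters are taken to be \<^term>\<open>undefined\<close> outside the carrier, so that equality of
  characters is equality of functions on the group; in particular \<open>Irr G\<close> is a finite set for
  finite \<open>G\<close>, which the sums over \<open>Irr G\<close> below rely on.\<close>

definition Irr :: "('a, 'b) monoid_scheme \<Rightarrow> ('a \<Rightarrow> complex) set" where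
  "Irr G = {restrict (\<lambda>g. mat_trace (\<rho> g)) (carrier G) | n \<rho>. irreducible_representation G n \<rho>}"

definition field_of_values :: "('a, 'b) monoid_scheme \<Rightarrow> ('a \<Rightarrow> complex) \<Rightarrow> complex set" where
  "field_of_values G \<chi> = generated_subfield (\<chi> ` carrier G)"


section \<open>The ring of algebraic integers and a maximal ideal over \<open>p\<close>\<close>

definition algebraic_integers :: "complex ring" where
  "algebraic_integers = class_ring\<lparr>carrier := {z. algebraic_int z}\<rparr>"

text \<open>As usual in block theory, one maximal ideal \<open>M\<close> of the ring of algebraic integers with
  \<open>p \<in> M\<close> is fixed once and for all; the lemma \<open>max_ideal_over\<close> below shows that it exists.
  The residue field of \<open>M\<close> is the algebraic closure of the prime field of characteristic \<open>p\<close>.\<close>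

definition max_ideal_over :: "nat \<Rightarrow> complex set" where
  "max_ideal_over p = (SOME M. maximalideal M algebraic_integers \<and> of_nat p \<in> M)"

text \<open>The localisation of the algebraic integers at \<open>M\<close> is a local ring with the same residue
  field; the following is its maximal ideal, the kernel of reduction modulo \<open>M\<close>.\<close>

definition local_max_ideal :: "nat \<Rightarrow> complex set" where
  "local_max_ideal p =
     {r / s | r s. r \<in> max_ideal_over p \<and> algebraic_int s \<and> s \<notin> max_ideal_over p}"


subsection \<open>Existence of the maximal ideal\<close>

definition int_span :: "complex set \<Rightarrow> complex set" where
  "int_span S = {\<Sum>s\<in>S. of_int (c s) * s | c. True}"

lemma int_span_add: "a \<in> int_span S \<Longrightarrow> b \<in> int_span S \<Longrightarrow> a + b \<in> int_span S"
proof -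
  assume "a \<in> int_span S" "b \<in> int_span S"
  then obtain c d where "a = (\<Sum>s\<in>S. of_int (c s) * s)" "b = (\<Sum>s\<in>S. of_int (d s) * s)"
    by (auto simp: int_span_def)
  then have "a + b = (\<Sum>s\<in>S. of_int (c s + d s) * s)"
    by (simp add: sum.distrib algebra_simps)
  then show ?thesis unfolding int_span_def
    by (intro CollectI exI[of _ "\<lambda>s. c s + d s"]) simp
qed

lemma int_span_scale: "a \<in> int_span S \<Longrightarrow> of_int k * a \<in> int_span S"
proof -
  assume "a \<in> int_span S"
  then obtain c where "a = (\<Sum>s\<in>S. of_int (c s) * s)"
    by (auto simp: int_span_def)
  then have "of_int k * a = (\<Sum>s\<in>S. of_int (k * c s) * s)"
    by (simp add: sum_distrib_left algebra_simps)
  then show ?thesis unfolding int_span_def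
    by (intro CollectI exI[of _ "\<lambda>s. k * c s"]) simp
qed

lemma int_span_0: "0 \<in> int_span S"
  unfolding int_span_def by (intro CollectI exI[of _ "\<lambda>s. 0"]) simp

lemma int_span_sum: "(\<And>i. i \<in> I \<Longrightarrow> f i \<in> int_span S) \<Longrightarrow> sum f I \<in> int_span S"
  by (induction I rule: infinite_finite_induct) (auto simp: int_span_0 int_span_add)

lemma int_span_base:
  assumes "finite S" "s \<in> S" shows "s \<in> int_span S"
proof -
  have "(\<Sum>t\<in>S. of_int (if t = s then 1 else 0) * t) = (\<Sum>t\<in>S. if t = s then t else 0)"
    by (intro sum.cong) auto
  also have "\<dots> = s" using assms by simp
  finally show ?thesis unfolding int_span_def
    by (intro CollectI exI[of _ "\<lambda>t. if t = s then 1 else 0"]) simp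
qed

lemma int_span_mult:
  assumes S: "\<And>s. s \<in> S \<Longrightarrow> z * s \<in> int_span S" and a: "a \<in> int_span S"
  shows "z * a \<in> int_span S"
proof -
  from a obtain c where "a = (\<Sum>s\<in>S. of_int (c s) * s)"
    by (auto simp: int_span_def)
  then have "z * a = (\<Sum>s\<in>S. of_int (c s) * (z * s))"
    by (simp add: sum_distrib_left algebra_simps)
  then show ?thesis using S by (auto intro!: int_span_sum int_span_scale)
qed

lemma algebraic_int_if_stable:
  assumes fin: "finite S" and one: "1 \<in> S" and S: "\<And>s. s \<in> S \<Longrightarrow> z * s \<in> int_span S"
  shows "algebraic_int z"
proof -
  obtain xs where xs: "set xs = S" "distinct xs"
    using finite_distinct_list[OF fin] by blast
  define N where "N = length xs"
  have "\<forall>s\<in>S. \<exists>c. z * s = (\<Sum>t\<in>S. of_int (c t) * t)"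
    using S unfolding int_span_def by blast
  then obtain c where c: "\<And>s. s \<in> S \<Longrightarrow> z * s = (\<Sum>t\<in>S. of_int (c s t) * t)"
    by metis
  define A :: "int mat" where "A = mat N N (\<lambda>(i, j). c (xs ! i) (xs ! j))"
  define B :: "complex mat" where "B = map_mat of_int A"
  define v where "v = vec N (\<lambda>i. xs ! i)"
  have A: "A \<in> carrier_mat N N" and B: "B \<in> carrier_mat N N"
    by (auto simp: A_def B_def)
  have v0: "v \<noteq> 0\<^sub>v N"
  proof
    assume v: "v = 0\<^sub>v N"
    obtain i where i: "i < N" "xs ! i = 1"
      using one xs(1) unfolding N_def by (metis in_set_conv_nth)
    then have "v $ i = 1" by (simp add: v_def)
    then show False using i v by simp
  qed
  have "B *\<^sub>v v = z \<cdot>\<^sub>v v"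
  proof (rule eq_vecI)
    show "dim_vec (B *\<^sub>v v) = dim_vec (z \<cdot>\<^sub>v v)" using B by (simp add: v_def)
    fix i assume "i < dim_vec (z \<cdot>\<^sub>v v)"
    then have i: "i < N" by (simp add: v_def)
    have "(B *\<^sub>v v) $ i = (\<Sum>j<N. of_int (c (xs ! i) (xs ! j)) * (xs ! j))"
      using i by (simp add: B_def A_def v_def scalar_prod_def lessThan_atLeast0)
    also have "\<dots> = (\<Sum>t\<in>S. of_int (c (xs ! i) t) * t)"
      by (rule sum.reindex_bij_betw[OF bij_betw_nth]) (use xs N_def in auto)
    also have "\<dots> = z * (xs ! i)"
      using c[of "xs ! i"] i xs N_def by auto
    finally show "(B *\<^sub>v v) $ i = (z \<cdot>\<^sub>v v) $ i" using i by (simp add: v_def)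
  qed
  then have "eigenvalue B z"
    using B v0 unfolding eigenvalue_def eigenvector_def by (auto intro!: exI[of _ v] simp: v_def)
  then have "poly (char_poly B) z = 0"
    using eigenvalue_root_char_poly[OF B] by simp
  moreover have "char_poly B = map_poly of_int (char_poly A)"
    unfolding B_def by (rule of_int_hom.char_poly_hom[OF A])
  moreover have "lead_coeff (char_poly A) = 1"
    using degree_monic_char_poly[OF A] by simp
  ultimately show ?thesis
    unfolding algebraic_int_altdef_ipoly by auto
qed

lemma algebraic_int_power_reduce:
  assumes "algebraic_int (x :: complex)"
  obtains n c where "0 < n" "x ^ n = (\<Sum>i<n. of_int (c i) * x ^ i)"
proof -
  from assms obtain p :: "int poly" where p: "poly (map_poly of_int p) x = 0" "lead_coeff p = 1"
    unfolding algebraic_int_altdef_ipoly by blast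
  define n where "n = Polynomial.degree p"
  have dn: "Polynomial.degree (map_poly of_int p :: complex poly) = n"
    unfolding n_def by simp
  have "0 = (\<Sum>i\<le>n. of_int (Polynomial.coeff p i) * x ^ i)"
    using p(1) dn by (simp add: poly_altdef)
  also have "\<dots> = (\<Sum>i<n. of_int (Polynomial.coeff p i) * x ^ i) + x ^ n"
    using p(2) n_def by (simp flip: lessThan_Suc_atMost)
  finally have eq: "x ^ n = (\<Sum>i<n. of_int (- Polynomial.coeff p i) * x ^ i)"
    by (simp add: sum_negf eq_neg_iff_add_eq_0 add.commute)
  have "n \<noteq> 0"
  proof
    assume "n = 0"
    then show False using eq by simp
  qed
  then show ?thesis by (intro that[OF _ eq]) simp
qed

lemma algebraic_int_add_mult:
  assumes "algebraic_int (x :: complex)" "algebraic_int (y :: complex)"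
  shows "algebraic_int (x + y)" "algebraic_int (x * y)"
proof -
  obtain m c where m: "0 < m" "x ^ m = (\<Sum>i<m. of_int (c i) * x ^ i)"
    using algebraic_int_power_reduce[OF assms(1)] .
  obtain n d where n: "0 < n" "y ^ n = (\<Sum>i<n. of_int (d i) * y ^ i)"
    using algebraic_int_power_reduce[OF assms(2)] .
  define S where "S = (\<lambda>(i, j). x ^ i * y ^ j) ` ({..<m} \<times> {..<n})"
  have fin: "finite S" by (simp add: S_def)
  have S: "x ^ i * y ^ j \<in> int_span S" if "i < m" "j < n" for i j
    using that by (intro int_span_base[OF fin]) (auto simp: S_def)
  have one: "1 \<in> S"
    unfolding S_def using m(1) n(1) by (intro image_eqI[of _ _ "(0, 0)"]) auto
  have x: "x * s \<in> int_span S" if "s \<in> S" for s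
  proof -
    from that obtain i j where ij: "i < m" "j < n" "s = x ^ i * y ^ j" by (auto simp: S_def)
    show ?thesis
    proof (cases "Suc i < m")
      case True
      then show ?thesis using S[of "Suc i" j] ij by (simp add: mult.assoc)
    next
      case False
      then have "m = Suc i" using ij by simp
      then have "x * s = x ^ m * y ^ j" using ij by simp
      also have "\<dots> = (\<Sum>i<m. of_int (c i) * (x ^ i * y ^ j))"
        by (simp add: m(2) sum_distrib_right mult.assoc)
      also have "\<dots> \<in> int_span S"
        using S ij by (intro int_span_sum int_span_scale) auto
      finally show ?thesis .
    qed
  qed
  have y: "y * s \<in> int_span S" if "s \<in> S" for s
  proof -
    from that obtain i j where ij: "i < m" "j < n" "s = x ^ i * y ^ j" by (auto simp: S_def)
    show ?thesis
    proof (cases "Suc j < n")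
      case True
      then show ?thesis using S[of i "Suc j"] ij by (simp add: mult_ac)
    next
      case False
      then have "n = Suc j" using ij by simp
      then have "y * s = x ^ i * y ^ n" using ij by simp
      also have "\<dots> = (\<Sum>j<n. of_int (d j) * (x ^ i * y ^ j))"
        by (simp add: n(2) sum_distrib_left mult_ac)
      also have "\<dots> \<in> int_span S"
        using S ij by (intro int_span_sum int_span_scale) auto
      finally show ?thesis .
    qed
  qed
  show "algebraic_int (x + y)"
    using x y by (intro algebraic_int_if_stable[OF fin one]) (simp add: distrib_right int_span_add)
  show "algebraic_int (x * y)"
  proof (rule algebraic_int_if_stable[OF fin one])
    fix s assume "s \<in> S"
    then show "x * y * s \<in> int_span S"
      using int_span_mult[of S x, OF x y] by (simp add: mult.assoc)
  qed
qed

lemma cring_algebraic_integers: "cring algebraic_integers"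
proof (rule cringI)
  show "abelian_group algebraic_integers"
  proof (rule abelian_groupI)
    fix x assume "x \<in> carrier algebraic_integers"
    then show "\<exists>y\<in>carrier algebraic_integers. y \<oplus>\<^bsub>algebraic_integers\<^esub> x = \<zero>\<^bsub>algebraic_integers\<^esub>"
      by (intro bexI[of _ "- x"]) (simp_all add: algebraic_integers_def)
  qed (simp_all add: algebraic_integers_def algebraic_int_add_mult(1) add.assoc add.commute)
  show "comm_monoid algebraic_integers"
    by (rule comm_monoidI)
      (simp_all add: algebraic_integers_def algebraic_int_add_mult(2) mult.assoc mult.commute)
qed (simp add: algebraic_integers_def distrib_right)

lemma ideal_algebraic_integers_iff:
  "ideal I algebraic_integers \<longleftrightarrow>
     I \<subseteq> {z. algebraic_int z} \<and> 0 \<in> I \<and> (\<forall>a\<in>I. \<forall>b\<in>I. a + b \<in> I) \<and>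
     (\<forall>a\<in>I. \<forall>z. algebraic_int z \<longrightarrow> z * a \<in> I)" (is "?L \<longleftrightarrow> ?R")
proof
  assume L: ?L
  have add: "additive_subgroup I algebraic_integers"
    using L by (simp add: ideal_def)
  show ?R
  proof (intro conjI ballI allI impI)
    show "I \<subseteq> {z. algebraic_int z}"
      using additive_subgroup.a_subset[OF add] by (simp add: algebraic_integers_def)
    show "0 \<in> I"
      using additive_subgroup.zero_closed[OF add] by (simp add: algebraic_integers_def)
    show "a + b \<in> I" if "a \<in> I" "b \<in> I" for a b
      using additive_subgroup.a_closed[OF add that] by (simp add: algebraic_integers_def)
    show "z * a \<in> I" if "a \<in> I" "algebraic_int z" for a z
      using ideal.I_l_closed[OF L that(1), of z] that(2) by (simp add: algebraic_integers_def)
  qed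
next
  assume R: ?R
  have ring: "ring algebraic_integers"
    using cring_algebraic_integers by (rule cring.axioms(1))
  have grp: "group (add_monoid algebraic_integers)"
    using abelian_group.a_group[OF ring.is_abelian_group[OF ring]] .
  have sub: "I \<subseteq> {z. algebraic_int z}" and zero: "0 \<in> I"
    and add: "\<And>a b. a \<in> I \<Longrightarrow> b \<in> I \<Longrightarrow> a + b \<in> I"
    and mult: "\<And>a z. a \<in> I \<Longrightarrow> algebraic_int z \<Longrightarrow> z * a \<in> I"
    using R by blast+
  show ?L
  proof (rule idealI[OF ring])
    show "subgroup I (add_monoid algebraic_integers)"
    proof (rule group.subgroupI[OF grp])
      show "I \<subseteq> carrier (add_monoid algebraic_integers)"
        using sub by (simp add: algebraic_integers_def)
      show "I \<noteq> {}" using zero by blast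
      fix a assume a: "a \<in> I"
      have m: "- a \<in> I"
        using mult[OF a, of "- 1"] by simp
      have "a \<in> {z. algebraic_int z}" "- a \<in> {z. algebraic_int z}" using a m sub by blast+
      then have "inv\<^bsub>add_monoid algebraic_integers\<^esub> a = - a"
        by (intro group.inv_equality[OF grp]) (simp_all add: algebraic_integers_def)
      then show "inv\<^bsub>add_monoid algebraic_integers\<^esub> a \<in> I" using m by simp
      fix b assume "b \<in> I"
      then show "a \<otimes>\<^bsub>add_monoid algebraic_integers\<^esub> b \<in> I"
        using add a by (simp add: algebraic_integers_def)
    qed
    fix a x assume "a \<in> I" "x \<in> carrier algebraic_integers"
    then have "x * a \<in> I" using mult by (simp add: algebraic_integers_def)
    then show "x \<otimes>\<^bsub>algebraic_integers\<^esub> a \<in> I" "a \<otimes>\<^bsub>algebraic_integers\<^esub> x \<in> I"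
      by (simp_all add: algebraic_integers_def mult.commute)
  qed
qed

lemma max_ideal_over:
  assumes "prime p"
  shows "maximalideal (max_ideal_over p) algebraic_integers" "of_nat p \<in> max_ideal_over p"
proof -
  define I0 :: "complex set" where "I0 = {of_nat p * z | z. algebraic_int z}"
  define C where "C = {I. ideal I algebraic_integers \<and> I0 \<subseteq> I \<and> 1 \<notin> I}"
  have p0: "p \<noteq> 0" "p \<noteq> 1" using assms by (auto simp: prime_gt_0_nat)
  have I0: "I0 \<in> C"
  proof -
    have "1 \<notin> I0"
    proof
      assume "1 \<in> I0"
      then obtain z where z: "algebraic_int z" "1 = of_nat p * (z :: complex)"
        by (auto simp: I0_def)
      then have zz: "z = 1 / of_nat p" using p0 by (simp add: field_simps)
      then have "z \<in> \<rat>" by simp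
      then have "z \<in> \<int>" using z rational_algebraic_int_is_int by blast
      then obtain k where "z = of_int k" by (auto elim: Ints_cases)
      then have "(of_int (int p * k) :: complex) = of_int 1" using z(2) by simp
      then have "int p * k = 1" by (simp only: of_int_eq_iff)
      then show False using p0 by (simp add: zmult_eq_1_iff)
    qed
    moreover have "algebraic_int z" if "z \<in> I0" for z
      using that algebraic_int_add_mult(2) int_imp_algebraic_int[of "of_nat p :: complex"]
      by (auto simp: I0_def)
    moreover have "0 \<in> I0" unfolding I0_def by (auto intro!: exI[of _ 0])
    moreover have "a + b \<in> I0" if "a \<in> I0" "b \<in> I0" for a b
    proof -
      from that obtain z w where "algebraic_int z" "a = of_nat p * z"
          "algebraic_int w" "b = of_nat p * w"
        by (auto simp: I0_def)
      then show ?thesis unfolding I0_def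
        by (intro CollectI exI[of _ "z + w"]) (simp add: algebraic_int_add_mult(1) distrib_left)
    qed
    moreover have "z * a \<in> I0" if "a \<in> I0" "algebraic_int z" for a z
    proof -
      from that obtain w where "algebraic_int w" "a = of_nat p * w" by (auto simp: I0_def)
      then show ?thesis unfolding I0_def using that(2)
        by (intro CollectI exI[of _ "z * w"]) (simp add: algebraic_int_add_mult(2))
    qed
    ultimately show ?thesis by (auto simp: C_def ideal_algebraic_integers_iff)
  qed
  have "\<exists>M\<in>C. \<forall>X\<in>C. M \<subseteq> X \<longrightarrow> X = M"
  proof (rule subset_Zorn_nonempty)
    show "C \<noteq> {}" using I0 by blast
    fix D assume D: "D \<noteq> {}" "subset.chain C D"
    have DC: "D \<subseteq> C" and lin: "\<And>X Y. X \<in> D \<Longrightarrow> Y \<in> D \<Longrightarrow> X \<subseteq> Y \<or> Y \<subseteq> X"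
      using D(2) by (auto simp: subset_chain_def)
    have id: "X \<subseteq> {z. algebraic_int z}" "0 \<in> X" "I0 \<subseteq> X" "1 \<notin> X"
        "\<And>a b. a \<in> X \<Longrightarrow> b \<in> X \<Longrightarrow> a + b \<in> X" 
        "\<And>a z. a \<in> X \<Longrightarrow> algebraic_int z \<Longrightarrow> z * a \<in> X" if "X \<in> D" for X
      using DC that by (auto simp: C_def ideal_algebraic_integers_iff)
    have add: "a + b \<in> \<Union>D" if ab: "a \<in> \<Union>D" "b \<in> \<Union>D" for a b
    proof -
      from ab obtain X Y where "X \<in> D" "Y \<in> D" "a \<in> X" "b \<in> Y" by blast
      then show ?thesis using lin[of X Y] id(5)[of X] id(5)[of Y] by blast
    qed
    have "ideal (\<Union>D) algebraic_integers"
      unfolding ideal_algebraic_integers_iff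
    proof (intro conjI ballI allI impI)
      show "\<Union>D \<subseteq> {z. algebraic_int z}" using id(1) by (rule Union_least)
      show "0 \<in> \<Union>D" using id(2) D(1) by auto
      show "a + b \<in> \<Union>D" if "a \<in> \<Union>D" "b \<in> \<Union>D" for a b
        using that by (rule add)
      fix a z :: complex assume "a \<in> \<Union>D" "algebraic_int z"
      then obtain X where X: "X \<in> D" "a \<in> X" by (elim UnionE)
      show "z * a \<in> \<Union>D" by (rule UnionI[OF X(1) id(6)[OF X \<open>algebraic_int z\<close>]])
    qed
    moreover have "I0 \<subseteq> \<Union>D"
    proof -
      obtain X where "X \<in> D" using D(1) by auto
      then show ?thesis using id(3)[of X] by blast
    qed
    moreover have "1 \<notin> \<Union>D" using id(4) by auto
    ultimately show "\<Union>D \<in> C" by (simp add: C_def)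
  qed
  then obtain M where M: "M \<in> C" "\<And>X. X \<in> C \<Longrightarrow> M \<subseteq> X \<Longrightarrow> X = M" by blast
  have "maximalideal M algebraic_integers"
  proof (rule maximalidealI)
    show "ideal M algebraic_integers" using M(1) by (simp add: C_def)
    show "carrier algebraic_integers \<noteq> M"
      using M(1) by (auto simp: C_def algebraic_integers_def)
    fix J assume J: "ideal J algebraic_integers" "M \<subseteq> J" "J \<subseteq> carrier algebraic_integers"
    show "J = M \<or> J = carrier algebraic_integers"
    proof (cases "1 \<in> J")
      case True
      have "z \<in> J" if "algebraic_int z" for z
        using J(1) True that unfolding ideal_algebraic_integers_iff by (metis mult.right_neutral)
      then show ?thesis using J(3) by (auto simp: algebraic_integers_def)
    next
      case False
      then have "J \<in> C" using J M(1) by (auto simp: C_def)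
      then show ?thesis using M(2) J(2) by blast
    qed
  qed
  moreover have "of_nat p \<in> I0" unfolding I0_def by (auto intro!: exI[of _ 1])
  then have "of_nat p \<in> M" using M(1) by (auto simp: C_def)
  ultimately have "\<exists>M. maximalideal M algebraic_integers \<and> of_nat p \<in> M" by blast
  then have "maximalideal (max_ideal_over p) algebraic_integers \<and> of_nat p \<in> max_ideal_over p"
    unfolding max_ideal_over_def by (rule someI_ex)
  then show "maximalideal (max_ideal_over p) algebraic_integers" "of_nat p \<in> max_ideal_over p"
    by blast+
qed


section \<open>Blocks, defect groups and heights\<close>

definition conj_class :: "('a, 'b) monoid_scheme \<Rightarrow> 'a \<Rightarrow> 'a set" where
  "conj_class G x = {g \<otimes>\<^bsub>G\<^esub> x \<otimes>\<^bsub>G\<^esub> inv\<^bsub>G\<^esub> g | g. g \<in> carrier G}"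

definition centralizer :: "('a, 'b) monoid_scheme \<Rightarrow> 'a \<Rightarrow> 'a set" where
  "centralizer G x = {g \<in> carrier G. g \<otimes>\<^bsub>G\<^esub> x = x \<otimes>\<^bsub>G\<^esub> g}"

text \<open>\<open>central_character G \<chi> x\<close> is the value of the central character of \<open>\<chi>\<close> at the sum of the
  conjugacy class of \<open>x\<close> in the group algebra. It is an algebraic integer.\<close>

definition central_character ::
  "('a, 'b) monoid_scheme \<Rightarrow> ('a \<Rightarrow> complex) \<Rightarrow> 'a \<Rightarrow> complex" where
  "central_character G \<chi> x = of_nat (card (conj_class G x)) * \<chi> x / \<chi> \<one>\<^bsub>G\<^esub>"

text \<open>Blocks are identified with their sets of irreducible ordinary characters: two characters are
  in the same block iff their central characters agree modulo the chosen maximal ideal.\<close>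

definition same_block ::
  "nat \<Rightarrow> ('a, 'b) monoid_scheme \<Rightarrow> ('a \<Rightarrow> complex) \<Rightarrow> ('a \<Rightarrow> complex) \<Rightarrow> bool" where
  "same_block p G \<chi> \<psi> \<longleftrightarrow>
     (\<forall>x\<in>carrier G. central_character G \<chi> x - central_character G \<psi> x \<in> max_ideal_over p)"

definition blocks :: "nat \<Rightarrow> ('a, 'b) monoid_scheme \<Rightarrow> ('a \<Rightarrow> complex) set set" where
  "blocks p G = {{\<psi> \<in> Irr G. same_block p G \<chi> \<psi>} | \<chi>. \<chi> \<in> Irr G}"

text \<open>The coefficient at \<open>x\<close> of the sum over \<open>\<chi> \<in> B\<close> of the primitive central idempotents
  \<open>(\<chi>(1) / |G|) \<Sum>\<^sub>g \<chi>(g\<^sup>-\<^sup>1) g\<close> of the complex group algebra. For a block \<open>B\<close> it lies in the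
  localisation of the algebraic integers at \<open>M\<close>, and its reduction modulo the maximal ideal is
  the coefficient of the block idempotent in characteristic \<open>p\<close>.\<close>

definition block_idempotent_coeff ::
  "('a, 'b) monoid_scheme \<Rightarrow> ('a \<Rightarrow> complex) set \<Rightarrow> 'a \<Rightarrow> complex" where
  "block_idempotent_coeff G B x =
     (\<Sum>\<chi>\<in>B. \<chi> \<one>\<^bsub>G\<^esub> * \<chi> (inv\<^bsub>G\<^esub> x)) / of_nat (card (carrier G))"

text \<open>The class of \<open>x\<close> is a defect class of \<open>B\<close> if neither the central character of \<open>B\<close> at the class
  sum nor the coefficient of the block idempotent at \<open>x\<close> vanishes in characteristic \<open>p\<close>.
  The central character of \<open>B\<close> is the common reduction of those of all \<open>\<chi> \<in> B\<close>.\<close>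

definition in_defect_class ::
  "nat \<Rightarrow> ('a, 'b) monoid_scheme \<Rightarrow> ('a \<Rightarrow> complex) set \<Rightarrow> 'a \<Rightarrow> bool" where
  "in_defect_class p G B x \<longleftrightarrow> x \<in> carrier G \<and>
     (\<exists>\<chi>\<in>B. central_character G \<chi> x \<notin> max_ideal_over p) \<and>
     block_idempotent_coeff G B x \<notin> local_max_ideal p"

definition p_part :: "nat \<Rightarrow> nat \<Rightarrow> nat" where
  "p_part p k = p ^ multiplicity p k"

definition sylow_subgroup :: "nat \<Rightarrow> ('a, 'b) monoid_scheme \<Rightarrow> 'a set \<Rightarrow> 'a set \<Rightarrow> bool" where
  "sylow_subgroup p G H P \<longleftrightarrow> subgroup P G \<and> P \<subseteq> H \<and> card P = p_part p (card H)"

text \<open>Brauer's definition; the defect groups of a block form a single conjugacy class of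
  \<open>p\<close>-subgroups.\<close>

definition defect_groups ::
  "nat \<Rightarrow> ('a, 'b) monoid_scheme \<Rightarrow> ('a \<Rightarrow> complex) set \<Rightarrow> 'a set set" where
  "defect_groups p G B =
     {D. \<exists>x. in_defect_class p G B x \<and> sylow_subgroup p G (centralizer G x) D}"

definition has_p_height ::
  "nat \<Rightarrow> ('a, 'b) monoid_scheme \<Rightarrow> ('a \<Rightarrow> complex) \<Rightarrow> nat \<Rightarrow> bool" where
  "has_p_height p G \<chi> h \<longleftrightarrow>
     (\<exists>B\<in>blocks p G. \<chi> \<in> B \<and>
       (\<exists>D\<in>defect_groups p G B. \<exists>d. \<chi> \<one>\<^bsub>G\<^esub> = of_nat d \<and>
          p_part p d = p_part p (card (rcosets\<^bsub>G\<^esub> D)) * p ^ h))"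

end

theory Submission
  imports Defs
    "HOL-Number_Theory.Number_Theory"
    "HOL-Library.Nat_Bijection"
    "Jordan_Normal_Form.Spectral_Radius"
begin

text \<open>
  Identify the Galois group of \<open>\<rat>\<^sub>n\<close> over \<open>F\<close> with a group \<open>H\<close> of units modulo \<open>n\<close>, and let
  \<open>G = C \<rtimes> H\<close> be the group of affine maps \<open>x \<mapsto> h x + k\<close> of the integers modulo \<open>n\<close> with \<open>h \<in> H\<close>,
  where \<open>C\<close> is the cyclic group of the \<open>n\<close> translations. The group \<open>G\<close> is metabelian, hence solvable.
  Only the trivial element of \<open>H\<close> fixes a faithful linear character \<open>\<lambda>\<close> of \<open>C\<close>, so
  \<open>\<chi> = \<lambda>\<^sup>G\<close> is irreducible of degree \<open>|H|\<close>. It vanishes outside \<open>C\<close>, and its values on \<open>C\<close> are the traces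
  \<open>\<Sum>h\<in>H. \<zeta>\<^bsup>hk\<^esup>\<close> from \<open>\<rat>\<^sub>n\<close> to \<open>F\<close> of the powers of \<open>\<zeta> = e\<^bsup>2\<pi>i/n\<^esup>\<close>. As the powers of \<open>\<zeta>\<close> span
  \<open>\<rat>\<^sub>n\<close> over \<open>\<rat>\<close>, these traces span \<open>F\<close> (\<open>galois_traces_generate\<close>), and \<open>\<rat>(\<chi>) = F\<close>.

  It remains to show that \<open>\<chi>\<close> has height zero. Let \<open>A\<close> be the subgroup of all \<open>h \<in> H\<close> with \<open>h \<equiv> 1\<close> modulo
  \<open>m\<close>. It is the Galois group over \<open>\<langle>F, \<rat>\<^sub>m\<rangle>\<close>, so the hypothesis says that \<open>p\<close> does not divide \<open>|A|\<close>
  (\<open>galois_exponents_compositum\<close>, \<open>extension_degree_cyclotomic\<close>). The units modulo \<open>p\<^sup>a\<close> that are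
  congruent to one modulo \<open>p\<close> form a \<open>p\<close>-group, hence \<open>A\<close> embeds into the units modulo \<open>p\<close>: it is
  cyclic, and \<open>h - 1\<close> is a unit modulo \<open>p\<^sup>a\<close> for every nontrivial \<open>h \<in> A\<close> (\<open>A_minus_one\<close>). Thus the
  stabilizer in \<open>H\<close> of a linear character \<open>\<lambda>\<^sub>j\<close> of \<open>C\<close> with \<open>j \<equiv> 1\<close> modulo \<open>m\<close> is trivial, except that it is
  \<open>A\<close> if \<open>p\<^sup>a\<close> divides \<open>j\<close>; in the latter case \<open>\<lambda>\<^sub>j\<close> has exactly \<open>|A|\<close> extensions to \<open>C \<rtimes> A\<close>.

  The block \<open>B\<close> of \<open>\<chi>\<close> can now be written down (\<open>block_eq\<close>): it consists of the \<open>\<lambda>\<^sub>j\<^sup>G\<close> with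
  \<open>j \<equiv> 1\<close> modulo \<open>m\<close> and \<open>p\<^sup>a\<close> not dividing \<open>j\<close>, and of the characters induced from the \<open>|A|\<close>
  extensions. One of the latter, \<open>\<psi>\<^sub>0\<close>, is induced from the extension that is trivial on the complement
  \<open>A\<close>. Adding up the degrees shows that the coefficient of the block idempotent at a
  \<open>p'\<close>-element \<open>x\<close> of \<open>C\<close> is \<open>\<psi>\<^sub>0(x\<^bsup>-1\<^esup>) / m\<close> (\<open>block_sum\<close>). On the other hand, the sum of
  \<open>\<psi>\<^sub>0(x\<^bsup>-1\<^esup>) \<lambda>(x)\<close> over all these \<open>x\<close> equals \<open>m\<close>, which is nonzero in characteristic \<open>p\<close>. Splitting the
  sum into conjugacy classes yields an \<open>x\<close> with \<open>\<psi>\<^sub>0(x\<^bsup>-1\<^esup>)\<close> and the central character of \<open>\<chi>\<close> at \<open>x\<close> both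
  nonzero modulo the maximal ideal, that is, a defect class (\<open>defect_element_exists\<close>). As
  \<open>|A| \<psi>\<^sub>0(x\<^bsup>-1\<^esup>)\<close> is divisible by the order of the stabilizer of \<open>x\<close> in \<open>H\<close>, that order is
  prime to \<open>p\<close>. Therefore the Sylow \<open>p\<close>-subgroup of the centralizer of \<open>x\<close>, the defect group of \<open>B\<close>, is the
  Sylow \<open>p\<close>-subgroup of \<open>C\<close>. Its index in \<open>G\<close> is \<open>m |H|\<close>, whose \<open>p\<close>-part is that of \<open>\<chi>(1) = |H|\<close>.
\<close>

section \<open>Subfields of the complex numbers and polynomials over them\<close>

abbreviation is_subfield :: "complex set \<Rightarrow> bool" where
  "is_subfield K \<equiv> subfield K class_ring"

lemma complex_field: "field (class_ring :: complex ring)"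
  by (rule class_field.field_axioms)

lemma subfield_closed:
  assumes "is_subfield K"
  shows "0 \<in> K" "1 \<in> K" "x \<in> K \<Longrightarrow> - x \<in> K" "x \<in> K \<Longrightarrow> y \<in> K \<Longrightarrow> x + y \<in> K"
    "x \<in> K \<Longrightarrow> y \<in> K \<Longrightarrow> x - y \<in> K" "x \<in> K \<Longrightarrow> y \<in> K \<Longrightarrow> x * y \<in> K"
    "x \<in> K \<Longrightarrow> inverse x \<in> K"
proof -
  have S: "subring K class_ring" using subfieldE(1)[OF assms] .
  show z: "0 \<in> K" and "1 \<in> K" using subringE(2,3)[OF S] by simp_all
  show m: "- x \<in> K" if "x \<in> K" for x
    using subringE(5)[OF S that] by (simp add: class_ring_simps)
  show a: "x + y \<in> K" if "x \<in> K" "y \<in> K" for x y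
    using subringE(7)[OF S that] by simp
  show "x - y \<in> K" if "x \<in> K" "y \<in> K" using a[OF that(1) m[OF that(2)]] by simp
  show "x * y \<in> K" if "x \<in> K" "y \<in> K" using subringE(6)[OF S that] by simp
  show "inverse x \<in> K" if x: "x \<in> K"
  proof (cases "x = 0")
    case False
    have R: "ring (class_ring :: complex ring)" by (rule class_ring.ring_axioms)
    have "inv\<^bsub>class_ring\<^esub> x \<in> K" "x * (inv\<^bsub>class_ring\<^esub> x) = 1"
      using ring.subfield_m_inv[OF R assms, of x] x False by simp_all
    then show ?thesis using inverse_unique by metis
  qed (simp add: z)
qed

lemma subfield_sum:
  assumes "is_subfield K" "\<And>i. i \<in> I \<Longrightarrow> g i \<in> K"
  shows "sum g I \<in> K"
  using assms(2) by (induction I rule: infinite_finite_induct) (auto intro: subfield_closed[OF assms(1)])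

lemma subfield_power: "is_subfield K \<Longrightarrow> x \<in> K \<Longrightarrow> x ^ k \<in> K"
  by (induction k) (auto intro: subfield_closed)

lemma Rats_subset_subfield:
  assumes K: "is_subfield K"
  shows "\<rat> \<subseteq> K"
proof
  fix x :: complex assume "x \<in> \<rat>"
  then obtain a b where x: "x = of_int a / of_int b"
    by (metis Rats_cases')
  have n: "of_nat k \<in> K" for k
    by (induction k) (auto intro: subfield_closed[OF K])
  have i: "of_int k \<in> K" for k
    by (cases k) (use n subfield_closed(3)[OF K, OF n] in \<open>auto simp del: of_nat_Suc\<close>)
  show "x \<in> K" unfolding x divide_inverse by (intro subfield_closed(6,7)[OF K] i)
qed

text \<open>Inverses in the ring record of the complex numbers agree with
  \<^const>\<open>inverse\<close>, so a set with these closure properties equals the field that it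
  generates.\<close>

lemma is_subfieldI:
  assumes "1 \<in> K" "\<And>x. x \<in> K \<Longrightarrow> - x \<in> K" "\<And>x y. x \<in> K \<Longrightarrow> y \<in> K \<Longrightarrow> x + y \<in> K"
    "\<And>x y. x \<in> K \<Longrightarrow> y \<in> K \<Longrightarrow> x * y \<in> K" "\<And>x. x \<in> K \<Longrightarrow> x \<noteq> 0 \<Longrightarrow> inverse x \<in> K"
  shows "is_subfield K"
proof -
  have "generate_field class_ring K \<subseteq> K"
  proof
    fix x assume "x \<in> generate_field class_ring K"
    then show "x \<in> K"
    proof (induction rule: generate_field.induct)
      case (m_inv h)
      have "inv\<^bsub>class_ring\<^esub> h = inverse h"
      proof -
        have "h \<in> Units (class_ring :: complex ring)"
          using m_inv(2) by (auto simp: Units_def intro: exI[of _ "inverse h"])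
        then have "h * (inv\<^bsub>class_ring\<^esub> h) = 1"
          using monoid.Units_r_inv[OF ring.is_monoid[OF class_ring.ring_axioms], of h] by simp
        then show ?thesis using inverse_unique by metis
      qed
      then show ?case using m_inv assms(5) by simp
    qed (use assms in \<open>auto simp: class_ring_simps\<close>)
  qed
  then have "generate_field class_ring K = K" by (auto intro: generate_field.incl)
  then show ?thesis using field.generate_field_is_subfield[OF complex_field, of K] by simp
qed

lemma generated_subfield_is_subfield: "is_subfield (generated_subfield S)"
  unfolding generated_subfield_def using field.generate_field_is_subfield[OF complex_field, of S] by simp

lemma generated_subfield_incl: "S \<subseteq> generated_subfield S"
  unfolding generated_subfield_def by (auto intro: generate_field.incl)

lemma generated_subfield_least: "is_subfield K \<Longrightarrow> S \<subseteq> K \<Longrightarrow> generated_subfield S \<subseteq> K"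
  unfolding generated_subfield_def
  using field.generate_field_min_subfield1[OF complex_field, of S K] by simp

definition poly_over :: "complex set \<Rightarrow> complex poly set" where
  "poly_over K = {f. \<forall>i. Polynomial.coeff f i \<in> K}"

lemma poly_over_mono: "K \<subseteq> L \<Longrightarrow> poly_over K \<subseteq> poly_over L"
  by (auto simp: poly_over_def)

lemma poly_over_closed:
  assumes K: "is_subfield K"
  shows "0 \<in> poly_over K" "1 \<in> poly_over K" "f \<in> poly_over K \<Longrightarrow> g \<in> poly_over K \<Longrightarrow> f + g \<in> poly_over K"
    "f \<in> poly_over K \<Longrightarrow> g \<in> poly_over K \<Longrightarrow> f - g \<in> poly_over K"
    "f \<in> poly_over K \<Longrightarrow> g \<in> poly_over K \<Longrightarrow> f * g \<in> poly_over K"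
    "c \<in> K \<Longrightarrow> f \<in> poly_over K \<Longrightarrow> Polynomial.smult c f \<in> poly_over K"
    "c \<in> K \<Longrightarrow> Polynomial.monom c k \<in> poly_over K"
    "pCons c f \<in> poly_over K \<longleftrightarrow> c \<in> K \<and> f \<in> poly_over K"
  using subfield_closed[OF K]
  by (auto simp: poly_over_def coeff_pCons coeff_mult coeff_monom intro!: subfield_sum[OF K] split: nat.splits)

lemma poly_over_sum:
  assumes "is_subfield K" "\<And>i. i \<in> I \<Longrightarrow> g i \<in> poly_over K"
  shows "sum g I \<in> poly_over K"
  using assms(2) by (induction I rule: infinite_finite_induct) (auto intro: poly_over_closed[OF assms(1)])

lemma poly_over_pcompose:
  assumes K: "is_subfield K" and "f \<in> poly_over K" and g: "g \<in> poly_over K"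
  shows "pcompose f g \<in> poly_over K"
  using assms(2) by (induction f) (auto simp: pcompose_pCons poly_over_closed[OF K] intro!: poly_over_closed(3,5)[OF K] g)

lemma poly_in_subfield:
  assumes K: "is_subfield K" and "f \<in> poly_over K" "x \<in> K"
  shows "poly f x \<in> K"
  using assms(2) by (induction f) (auto simp: poly_over_closed[OF K] intro!: subfield_closed[OF K] assms(3))

text \<open>Both quotient and remainder are computed by long division, which only ever divides by the
  leading coefficient of the divisor.\<close>

lemma poly_over_div_mod:
  assumes K: "is_subfield K" and f: "f \<in> poly_over K" and g: "g \<in> poly_over K"
  shows "g div f \<in> poly_over K \<and> g mod f \<in> poly_over K"
  using g
proof (induction "Polynomial.degree g" arbitrary: g rule: less_induct)
  case less
  show ?case
  proof (cases "f = 0 \<or> g = 0 \<or> Polynomial.degree g < Polynomial.degree f")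
    case True
    then show ?thesis using less.prems poly_over_closed(1)[OF K] by (auto simp: mod_poly_less div_poly_less)
  next
    case False
    then have f0: "f \<noteq> 0" and g0: "g \<noteq> 0" and deg: "Polynomial.degree f \<le> Polynomial.degree g" by auto
    define q where "q = Polynomial.monom (Polynomial.lead_coeff g * inverse (Polynomial.lead_coeff f)) (Polynomial.degree g - Polynomial.degree f)"
    have lc: "Polynomial.lead_coeff g \<in> K" "Polynomial.lead_coeff f \<in> K" using f less.prems by (auto simp: poly_over_def)
    have q: "q \<in> poly_over K" unfolding q_def by (intro poly_over_closed(7)[OF K] subfield_closed(6,7)[OF K] lc)
    have c0: "Polynomial.lead_coeff g * inverse (Polynomial.lead_coeff f) \<noteq> 0" using f0 g0 by simp
    have dq: "Polynomial.degree q = Polynomial.degree g - Polynomial.degree f" "q \<noteq> 0"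
      unfolding q_def using c0 by (simp_all add: degree_monom_eq monom_eq_0_iff)
    have eqdeg: "Polynomial.degree (q * f) = Polynomial.degree g"
      using dq deg f0 by (simp add: degree_mult_eq)
    have "Polynomial.lead_coeff (q * f) = Polynomial.lead_coeff g"
      unfolding lead_coeff_mult dq(1) using f0 by (simp add: q_def)
    then have z: "Polynomial.coeff (g - q * f) (Polynomial.degree g) = 0" by (simp add: eqdeg)
    have le: "Polynomial.degree (g - q * f) \<le> Polynomial.degree g"
      using eqdeg degree_diff_le[of g "Polynomial.degree g" "q * f"] by simp
    have rest: "(g - q * f) div f \<in> poly_over K \<and> (g - q * f) mod f \<in> poly_over K"
    proof (cases "g - q * f = 0")
      case True
      show ?thesis unfolding True using poly_over_closed(1)[OF K] by simp
    next
      case False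
      have "Polynomial.degree (g - q * f) \<noteq> Polynomial.degree g"
      proof
        assume e: "Polynomial.degree (g - q * f) = Polynomial.degree g"
        then have "g - q * f = 0" using z by (simp only: leading_coeff_0_iff flip: e)
        then show False using False by simp
      qed
      then have "Polynomial.degree (g - q * f) < Polynomial.degree g" using le by simp
      then show ?thesis by (intro less.hyps poly_over_closed(4,5)[OF K] less.prems q f)
    qed
    have "g = (g - q * f) + q * f" by simp
    then have "g div f = q + (g - q * f) div f" "g mod f = (g - q * f) mod f"
      using div_mult_self1[OF f0, of "g - q * f" q] mod_mult_self1[of "g - q * f" q f] by simp_all
    then show ?thesis using rest poly_over_closed(3)[OF K q] by simp
  qed
qed

lemmas poly_over_div = poly_over_div_mod[THEN conjunct1]
lemmas poly_over_mod = poly_over_div_mod[THEN conjunct2]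

lemma poly_mod_at_root: "poly f z = 0 \<Longrightarrow> poly (g mod f) z = poly g z"
  for f g :: "complex poly"
proof -
  assume f: "poly f z = 0"
  have "poly (g div f * f + g mod f) z = poly g z" by (simp only: div_mult_mod_eq)
  then show ?thesis by (simp only: f poly_add poly_mult mult_zero_right add_0)
qed

lemma minimal_polynomial_exists:
  assumes K: "is_subfield K" and p: "p \<in> poly_over K" "p \<noteq> 0" "poly p z = 0"
  obtains f where "f \<in> poly_over K" "Polynomial.lead_coeff f = 1" "poly f z = 0"
    "\<And>g. g \<in> poly_over K \<Longrightarrow> poly g z = 0 \<Longrightarrow> f dvd g"
proof -
  let ?P = "\<lambda>g. g \<in> poly_over K \<and> g \<noteq> 0 \<and> poly g z = 0"
  obtain f0 where f0: "?P f0" "\<And>g. ?P g \<Longrightarrow> Polynomial.degree f0 \<le> Polynomial.degree g"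
    using ex_has_least_nat[of ?P p Polynomial.degree] p by blast
  define f where "f = Polynomial.smult (inverse (Polynomial.lead_coeff f0)) f0"
  have "Polynomial.lead_coeff f0 \<in> K" using f0 by (auto simp: poly_over_def)
  then have f: "f \<in> poly_over K" "Polynomial.lead_coeff f = 1" "poly f z = 0" "Polynomial.degree f = Polynomial.degree f0"
    using f0 subfield_closed(7)[OF K] poly_over_closed(6)[OF K] by (auto simp: f_def)
  show ?thesis
  proof (rule that[OF f(1-3)])
    fix g assume g: "g \<in> poly_over K" "poly g z = 0"
    have f0': "f \<noteq> 0" using f(2) by auto
    have "g mod f \<in> poly_over K" by (rule poly_over_mod[OF K f(1) g(1)])
    moreover have "poly (g mod f) z = 0"
      by (simp only: poly_mod_at_root[OF f(3)] g(2))
    moreover have "g mod f = 0 \<or> Polynomial.degree (g mod f) < Polynomial.degree f"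
      by (rule degree_mod_less[OF f0'])
    ultimately have "g mod f = 0" using f0(2)[of "g mod f"] f(4) by linarith
    then show "f dvd g" by (simp add: dvd_eq_mod_eq_0)
  qed
qed

lemma unity_poly_over:
  assumes K: "is_subfield K"
  shows "Polynomial.monom 1 n - 1 \<in> poly_over K"
  by (intro poly_over_closed(2,4,7)[OF K] subfield_closed(2)[OF K])

text \<open>Only closure under inverses needs an idea: among the polynomials \<open>r\<close> over
  \<open>K\<close> with \<open>r(z)\<close> a nonzero multiple of a given \<open>y\<close>, one of least
  degree must be constant, since otherwise dividing the minimal polynomial of \<open>z\<close> by
  \<open>r\<close> leaves a smaller one.\<close>

lemma subfield_of_unity_values:
  assumes K: "is_subfield K" and n: "0 < n" and z: "z ^ n = 1"
  shows "is_subfield {poly f z | f. f \<in> poly_over K}"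
proof -
  let ?S = "{poly f z | f. f \<in> poly_over K}"
  have mem: "poly f z \<in> ?S" if "f \<in> poly_over K" for f using that by blast
  have u0: "Polynomial.monom 1 n - 1 \<noteq> (0 :: complex poly)"
  proof
    assume "Polynomial.monom 1 n - 1 = (0 :: complex poly)"
    then have "poly (Polynomial.monom 1 n - 1) (0 :: complex) = 0" by simp
    then show False using n by (simp add: poly_monom zero_power)
  qed
  have uz: "poly (Polynomial.monom 1 n - 1) z = 0" using z by (simp add: poly_monom)
  obtain f where f: "f \<in> poly_over K" "Polynomial.lead_coeff f = 1" "poly f z = 0"
      and min: "\<And>g. g \<in> poly_over K \<Longrightarrow> poly g z = 0 \<Longrightarrow> f dvd g"
    using minimal_polynomial_exists[OF K unity_poly_over[OF K] u0 uz] by blast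
  have f0: "f \<noteq> 0" using f(2) by auto
  show ?thesis
  proof (rule is_subfieldI)
    show "1 \<in> ?S" using mem[OF poly_over_closed(2)[OF K]] by simp
    show "- x \<in> ?S" if x: "x \<in> ?S" for x
    proof -
      obtain u where "u \<in> poly_over K" "x = poly u z" using x by blast
      then show ?thesis using mem[OF poly_over_closed(4)[OF K poly_over_closed(1)[OF K], of u]] by simp
    qed
    show "x + y \<in> ?S" "x * y \<in> ?S" if x: "x \<in> ?S" and y: "y \<in> ?S" for x y
    proof -
      obtain u v where uv: "u \<in> poly_over K" "x = poly u z" "v \<in> poly_over K" "y = poly v z" using x y by blast
      show "x + y \<in> ?S" using mem[OF poly_over_closed(3)[OF K uv(1,3)]] uv by simp
      show "x * y \<in> ?S" using mem[OF poly_over_closed(5)[OF K uv(1,3)]] uv by simp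
    qed
    fix y assume y: "y \<in> ?S" "y \<noteq> 0"
    then obtain u where u: "u \<in> poly_over K" "y = poly u z" by blast
    let ?R = "\<lambda>r. r \<in> poly_over K \<and> poly r z \<noteq> 0 \<and> (\<exists>t\<in>poly_over K. poly r z = poly t z * y)"
    have "?R u" using u y(2) poly_over_closed(2)[OF K] by (auto intro!: bexI[of _ 1])
    then obtain r where r: "?R r" and least: "\<And>s. ?R s \<Longrightarrow> Polynomial.degree r \<le> Polynomial.degree s"
      using ex_has_least_nat[of ?R u Polynomial.degree] by blast
    obtain t where t: "t \<in> poly_over K" "poly r z = poly t z * y" using r by blast
    have r0: "r \<noteq> 0" using r by auto
    have "?R (r mod f)"
      using r t poly_over_mod[OF K f(1)] poly_mod_at_root[OF f(3), of r] by auto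
    then have "r mod f \<noteq> 0" "Polynomial.degree r \<le> Polynomial.degree (r mod f)" using least by auto
    then have deg: "Polynomial.degree r < Polynomial.degree f" using degree_mod_less[OF f0, of r] by auto
    have q: "f div r \<in> poly_over K" and s: "f mod r \<in> poly_over K"
      using r by (auto intro: poly_over_div[OF K _ f(1)] poly_over_mod[OF K _ f(1)])
    have "poly (f div r * r + f mod r) z = 0" using f(3) by (simp only: div_mult_mod_eq)
    then have "poly (f div r) z * poly r z + poly (f mod r) z = 0" by (simp only: poly_add poly_mult)
    then have sz: "poly (f mod r) z = poly (0 - f div r * t) z * y" using t(2) by (simp add: algebra_simps eq_neg_iff_add_eq_0)
    have "Polynomial.degree r = 0"
    proof (rule ccontr)
      assume d: "Polynomial.degree r \<noteq> 0"
      then have smaller: "f mod r = 0 \<or> Polynomial.degree (f mod r) < Polynomial.degree r"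
        using degree_mod_less[OF r0, of f] by blast
      have "poly (f mod r) z = 0"
      proof (rule ccontr)
        assume nz: "poly (f mod r) z \<noteq> 0"
        moreover have "0 - f div r * t \<in> poly_over K"
          by (intro poly_over_closed(1,4,5)[OF K] q t(1))
        ultimately have "?R (f mod r)" using s sz by blast
        then have "Polynomial.degree r \<le> Polynomial.degree (f mod r)" by (rule least)
        then show False using smaller nz by auto
      qed
      then have "f dvd f mod r" by (rule min[OF s])
      then have dv: "f dvd f mod r" .
      have m0: "f mod r = 0"
      proof (rule ccontr)
        assume nz: "f mod r \<noteq> 0"
        then have "Polynomial.degree (f mod r) < Polynomial.degree r" using smaller by simp
        moreover have "Polynomial.degree f \<le> Polynomial.degree (f mod r)" by (rule dvd_imp_degree_le[OF dv nz])
        ultimately show False using deg by linarith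
      qed
      have fq: "f div r * r = f" using div_mult_mod_eq[of f r] by (simp only: m0 add_0_right)
      have "poly (f div r) z * poly r z = 0"
        by (simp only: fq f(3) flip: poly_mult)
      then have "poly (f div r) z = 0" using r by simp
      then have "f dvd f div r" by (rule min[OF q])
      moreover have q0: "f div r \<noteq> 0" using fq f0 by (metis mult_zero_left)
      ultimately have "Polynomial.degree f \<le> Polynomial.degree (f div r)" by (rule dvd_imp_degree_le)
      moreover have "Polynomial.degree f = Polynomial.degree (f div r) + Polynomial.degree r"
        using degree_mult_eq[OF q0 r0] by (simp only: fq)
      ultimately show False using d by simp
    qed
    then obtain c where c: "r = [:c:]" by (elim degree_eq_zeroE)
    have c0: "c \<noteq> 0" "c \<in> K" using r poly_over_closed(8)[OF K] by (auto simp: c)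
    have "Polynomial.smult (inverse c) t \<in> poly_over K"
      by (rule poly_over_closed(6)[OF K subfield_closed(7)[OF K c0(2)] t(1)])
    moreover have "inverse y = poly (Polynomial.smult (inverse c) t) z"
    proof -
      have "c = poly t z * y" using t(2) by (simp add: c)
      then show ?thesis using c0(1) y(2) by (simp add: field_simps)
    qed
    ultimately show "inverse y \<in> ?S" by (simp only: mem)
  qed
qed

section \<open>Roots of unity and cyclotomic fields\<close>

definition zeta :: "nat \<Rightarrow> int \<Rightarrow> complex" where
  "zeta n k = cis (2 * pi * of_int k / of_nat n)"

lemma zeta_0 [simp]: "zeta n 0 = 1"
  by (simp add: zeta_def)

lemma zeta_nonzero [simp]: "zeta n k \<noteq> 0"
  by (simp add: zeta_def)

lemma zeta_add: "zeta n (k + l) = zeta n k * zeta n l"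
  by (simp add: zeta_def cis_mult add_divide_distrib distrib_left)

lemma zeta_power: "zeta n k ^ j = zeta n (k * int j)"
  by (induction j) (simp_all add: zeta_add ring_distribs)

lemma zeta_minus: "zeta n (- k) = inverse (zeta n k)"
  by (rule inverse_unique[symmetric]) (simp flip: zeta_add)

lemma zeta_diff: "zeta n (k - l) = zeta n k / zeta n l"
  using zeta_add[of n k "- l"] by (simp add: zeta_minus divide_inverse)

lemma zeta_1: "zeta n 1 = exp (2 * of_real pi * \<i> / of_nat n)"
  by (simp add: zeta_def cis_conv_exp mult_ac)

lemma zeta_eq_1_iff:
  assumes "0 < n"
  shows "zeta n k = 1 \<longleftrightarrow> int n dvd k"
proof
  assume "zeta n k = 1"
  then have "cos (2 * pi * of_int k / of_nat n) = 1" by (simp add: zeta_def complex_eq_iff)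
  then obtain l :: int where "2 * pi * of_int k / of_nat n = of_int l * 2 * pi"
    unfolding cos_one_2pi_int by blast
  then have "real_of_int k = real_of_int (l * int n)"
    using assms by (simp add: field_simps)
  then have "k = l * int n" by (simp only: of_int_eq_iff)
  then show "int n dvd k" by simp
next
  assume "int n dvd k"
  then obtain l where k: "k = int n * l" ..
  have "2 * pi * of_int k / of_nat n = 2 * pi * of_int l" using assms by (simp add: k)
  then show "zeta n k = 1" unfolding zeta_def by (simp only: cis_multiple_2pi[OF Ints_of_int])
qed

lemma zeta_eq_iff:
  assumes "0 < n"
  shows "zeta n k = zeta n l \<longleftrightarrow> [k = l] (mod int n)"
  using zeta_eq_1_iff[OF assms, of "k - l"] by (simp add: zeta_diff cong_iff_dvd_diff)

lemma zeta_cong: "0 < n \<Longrightarrow> [k = l] (mod int n) \<Longrightarrow> zeta n k = zeta n l"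
  by (simp add: zeta_eq_iff)

lemma zeta_unity: "0 < n \<Longrightarrow> zeta n k ^ n = 1"
  by (simp add: zeta_power zeta_eq_1_iff)

lemma zeta_cancel: "0 < d \<Longrightarrow> zeta (d * n) (int d * k) = zeta n k"
  by (simp add: zeta_def field_simps)

lemma zeta_algebraic_int: "0 < n \<Longrightarrow> algebraic_int (zeta n k)"
  by (rule algebraic_int_root[of 1 "Polynomial.monom 1 n"])
    (simp_all add: poly_monom degree_monom_eq zeta_unity)

lemma unity_root_eq_zeta:
  assumes n: "0 < n" and z: "z ^ n = 1"
  obtains j where "j \<in> {0..<int n}" "z = zeta n j"
proof -
  have "z \<in> {z. z ^ n = 1}" using z by simp
  also have "\<dots> = (\<lambda>k. cis (2 * pi * real k / real n)) ` {..<n}"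
    using bij_betw_roots_unity[OF n] by (simp add: bij_betw_def)
  finally obtain k where "k < n" "z = cis (2 * pi * real k / real n)" by auto
  then show ?thesis using that[of "int k"] by (simp add: zeta_def)
qed

lemma sum_zeta:
  assumes n: "0 < n"
  shows "(\<Sum>k\<in>{0..<int n}. zeta n (j * k)) = (if int n dvd j then of_nat n else 0)"
proof -
  have "(\<Sum>k\<in>{0..<int n}. zeta n (j * k)) = (\<Sum>k<n. zeta n j ^ k)"
    by (rule sum.reindex_bij_witness[of _ int nat]) (auto simp: zeta_power)
  also have "\<dots> = (if int n dvd j then of_nat n else 0)"
  proof (cases "int n dvd j")
    case True
    then show ?thesis using zeta_eq_1_iff[OF n, of j] by simp
  next
    case False
    then have "zeta n j \<noteq> 1" using zeta_eq_1_iff[OF n] by simp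
    then show ?thesis using False zeta_unity[OF n, of j] by (simp add: sum_gp_strict)
  qed
  finally show ?thesis .
qed

lemma cyclotomic_field_zeta: "cyclotomic_field n = generated_subfield {zeta n 1}"
  by (simp add: cyclotomic_field_def zeta_1)

lemma cyclotomic_field_subfield: "is_subfield (cyclotomic_field n)"
  unfolding cyclotomic_field_zeta by (rule generated_subfield_is_subfield)

lemma zeta_in_cyclotomic_field: "0 < n \<Longrightarrow> zeta n k \<in> cyclotomic_field n"
proof -
  assume n: "0 < n"
  have "zeta n k = zeta n 1 ^ nat (k mod int n)"
    using n by (simp add: zeta_power zeta_eq_iff)
  moreover have "zeta n 1 \<in> cyclotomic_field n"
    unfolding cyclotomic_field_zeta by (rule subsetD[OF generated_subfield_incl]) simp
  ultimately show ?thesis using subfield_power[OF cyclotomic_field_subfield] by simp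
qed

text \<open>Adjoining \<open>\<zeta>\<close> to any intermediate field gives the whole cyclotomic field,
  so its elements are the polynomial expressions in \<open>\<zeta>\<close> over that field.\<close>

lemma cyclotomic_field_eq_poly_values:
  assumes n: "0 < n" and K: "is_subfield K" "K \<subseteq> cyclotomic_field n"
  shows "cyclotomic_field n = {poly f (zeta n 1) | f. f \<in> poly_over K}" (is "_ = ?S")
proof
  have "zeta n 1 \<in> ?S"
    by (intro CollectI exI[of _ "Polynomial.monom 1 1"] conjI poly_over_closed(7)[OF K(1)] subfield_closed[OF K(1)])
      (simp add: poly_monom)
  then show "cyclotomic_field n \<subseteq> ?S"
    unfolding cyclotomic_field_zeta using n
    by (intro generated_subfield_least subfield_of_unity_values[OF K(1) n] zeta_unity) auto
  show "?S \<subseteq> cyclotomic_field n"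
  proof
    fix x assume "x \<in> ?S"
    then obtain f where "x = poly f (zeta n 1)" "f \<in> poly_over K" by blast
    then show "x \<in> cyclotomic_field n"
      using poly_in_subfield[OF cyclotomic_field_subfield _ zeta_in_cyclotomic_field[OF n], of f 1]
        poly_over_mono[OF K(2)] by auto
  qed
qed

section \<open>The Galois group of a cyclotomic field over a subfield\<close>

text \<open>The exponents \<open>h\<close> for which \<open>\<zeta> \<mapsto> \<zeta>\<^sup>h\<close>
  extends to an automorphism over \<open>K\<close>: those for which \<open>\<zeta>\<^sup>h\<close> is
  again a root of the minimal polynomial of \<open>\<zeta>\<close> over \<open>K\<close>. The set is a
  union of residue classes modulo \<open>n\<close>.\<close>

definition galois_exponents :: "nat \<Rightarrow> complex set \<Rightarrow> int set" where
  "galois_exponents n K =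
     {h. \<forall>g\<in>poly_over K. poly g (zeta n 1) = 0 \<longrightarrow> poly g (zeta n h) = 0}"

lemma galois_exponents_poly:
  assumes K: "is_subfield K" and h: "h \<in> galois_exponents n K" and f: "f \<in> poly_over K" and g: "g \<in> poly_over K"
    and eq: "poly f (zeta n 1) = poly g (zeta n 1)"
  shows "poly f (zeta n h) = poly g (zeta n h)"
proof -
  have "f - g \<in> poly_over K" "poly (f - g) (zeta n 1) = 0"
    using poly_over_closed(4)[OF K f g] eq by simp_all
  then have "poly (f - g) (zeta n h) = 0" using h unfolding galois_exponents_def by blast
  then show ?thesis by simp
qed

lemma galois_exponents_fix:
  assumes K: "is_subfield K" and h: "h \<in> galois_exponents n K" and f: "f \<in> poly_over K" 
    and x: "poly f (zeta n 1) \<in> K"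
  shows "poly f (zeta n h) = poly f (zeta n 1)"
  using galois_exponents_poly[OF K h f, of "[:poly f (zeta n 1):]"] x poly_over_closed[OF K] by simp

lemma galois_exponents_mono: "K \<subseteq> L \<Longrightarrow> galois_exponents n L \<subseteq> galois_exponents n K"
  using poly_over_mono unfolding galois_exponents_def by blast

lemma galois_exponents_one: "1 \<in> galois_exponents n K"
  by (simp add: galois_exponents_def)

lemma galois_exponents_cong:
  "0 < n \<Longrightarrow> [h = k] (mod int n) \<Longrightarrow> h \<in> galois_exponents n K \<longleftrightarrow> k \<in> galois_exponents n K"
  by (simp add: galois_exponents_def zeta_cong[of n h k])

text \<open>If \<open>g\<close> vanishes at \<open>\<zeta>\<close>, then so does
  \<open>g(X\<^sup>k)\<close>; apply \<open>h\<close> to the latter.\<close>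

lemma galois_exponents_mult:
  assumes n: "0 < n" and K: "is_subfield K"
    and h: "h \<in> galois_exponents n K" and k: "k \<in> galois_exponents n K"
  shows "h * k \<in> galois_exponents n K"
  unfolding galois_exponents_def
proof (intro CollectI ballI impI)
  fix g assume g: "g \<in> poly_over K" "poly g (zeta n 1) = 0"
  define j where "j = nat (k mod int n)"
  have j: "zeta n i ^ j = zeta n (i * k)" for i
    using n by (auto simp: zeta_power j_def zeta_eq_iff cong_def mod_mult_right_eq)
  let ?g = "pcompose g (Polynomial.monom 1 j)"
  have "?g \<in> poly_over K"
    by (intro poly_over_pcompose[OF K g(1)] poly_over_closed(7)[OF K] subfield_closed[OF K])
  moreover have "poly ?g (zeta n 1) = 0"
    using k g j[of 1] by (simp add: poly_pcompose poly_monom galois_exponents_def)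
  ultimately have "poly ?g (zeta n h) = 0" using h by (simp add: galois_exponents_def)
  then show "poly g (zeta n (h * k)) = 0" using j[of h] by (simp add: poly_pcompose poly_monom)
qed

text \<open>A conjugate of a primitive root of unity is primitive: for \<open>n = d k\<close>, the
  polynomial \<open>\<Sum>i<d. X\<^bsup>ki\<^esup>\<close> vanishes at \<open>\<zeta>\<close> but not at
  roots of unity of order dividing \<open>k\<close>.\<close>

lemma galois_exponents_coprime:
  assumes n: "0 < n" and K: "is_subfield K" and h: "h \<in> galois_exponents n K"
  shows "coprime h (int n)"
proof (rule ccontr)
  assume nc: "\<not> coprime h (int n)"
  define d where "d = nat (gcd h (int n))"
  have d: "int d = gcd h (int n)" by (simp add: d_def)
  then have "d dvd n" "int d dvd h" by (metis gcd_dvd2 int_dvd_int_iff, metis gcd_dvd1)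
  then obtain k l where k: "n = d * k" and l: "h = int d * l" by (elim dvdE)
  have d0: "0 < d" "0 < k" using n k by simp_all
  have d1: "d \<noteq> 1" using nc d by (auto simp: coprime_iff_gcd_eq_1)
  have kn: "k < n" using k d0 d1 by auto
  define g :: "complex poly" where "g = (\<Sum>i<d. Polynomial.monom 1 (k * i))"
  have ev: "poly g z = (\<Sum>i<d. (z ^ k) ^ i)" for z by (simp add: g_def poly_sum poly_monom power_mult)
  have "zeta n 1 ^ k \<noteq> 1" using zeta_eq_1_iff[OF n, of "int k"] kn d0 by (auto simp: zeta_power zdvd_not_zless)
  moreover have "(zeta n 1 ^ k) ^ d = 1" using zeta_unity[OF n, of 1] k by (simp flip: power_mult add: mult.commute)
  ultimately have "poly g (zeta n 1) = 0" unfolding ev by (simp add: sum_gp_strict)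
  moreover have "g \<in> poly_over K" unfolding g_def
    by (intro poly_over_sum[OF K] poly_over_closed(7)[OF K] subfield_closed[OF K])
  ultimately have "poly g (zeta n h) = 0" using h by (simp add: galois_exponents_def)
  moreover have "zeta n h ^ k = 1" using n k l by (simp add: zeta_power zeta_eq_1_iff)
  ultimately show False using d0 unfolding ev by simp
qed

lemma galois_exponents_inverse:
  assumes n: "0 < n" and K: "is_subfield K" and h: "h \<in> galois_exponents n K"
  obtains k where "k \<in> galois_exponents n K" "[h * k = 1] (mod int n)"
proof -
  have pow: "h ^ i \<in> galois_exponents n K" for i
    by (induction i) (auto simp: galois_exponents_one intro: galois_exponents_mult[OF n K h])
  define h' where "h' = nat (h mod int n)"
  have h': "[int h' = h] (mod int n)" using n by (simp add: h'_def cong_def)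
  have "coprime h' n"
    using galois_exponents_coprime[OF n K h] cong_imp_coprime[OF cong_sym[OF h']] by simp
  then have "[h' ^ totient n = 1] (mod n)" by (rule euler_theorem)
  then have "[int (h' ^ totient n) = int 1] (mod int n)" by (simp only: cong_int_iff)
  then have "[int h' ^ totient n = 1] (mod int n)" by simp
  then have "[h ^ totient n = 1] (mod int n)" using cong_pow[OF h', of "totient n"] cong_sym cong_trans by blast
  moreover have "totient n = Suc (totient n - 1)" using n by simp
  ultimately have "[h * h ^ (totient n - 1) = 1] (mod int n)" by (metis power_Suc)
  then show ?thesis using that pow by blast
qed

lemma poly_zero_if_dvd: "f dvd g \<Longrightarrow> poly f z = 0 \<Longrightarrow> poly g z = 0"
  for f g :: "complex poly"
  by (auto elim!: dvdE)

text \<open>The minimal polynomial divides \<open>X\<^sup>n - 1\<close>, so it is squarefree and its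
  roots are powers of \<open>\<zeta>\<close>; the exponents are the Galois ones by their definition.
  Counting roots gives the degree.\<close>

lemma minimal_polynomial_zeta:
  assumes n: "0 < n" and K: "is_subfield K"
  obtains f where "f \<in> poly_over K" "Polynomial.lead_coeff f = 1"
    "\<And>g. g \<in> poly_over K \<Longrightarrow> poly g (zeta n 1) = 0 \<Longrightarrow> f dvd g"
    "{z. poly f z = 0} = zeta n ` (galois_exponents n K \<inter> {0..<int n})"
    "Polynomial.degree f = card (galois_exponents n K \<inter> {0..<int n})"
proof -
  let ?u = "Polynomial.monom 1 n - 1 :: complex poly" and ?H = "galois_exponents n K \<inter> {0..<int n}"
  have u: "poly ?u (zeta n k) = 0" for k by (simp add: poly_monom zeta_unity[OF n])
  have u0: "?u \<noteq> 0"
  proof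
    assume "?u = 0"
    then have "poly ?u 0 = 0" by simp
    then show False using n by (simp add: poly_monom zero_power)
  qed
  obtain f where f: "f \<in> poly_over K" "Polynomial.lead_coeff f = 1" "poly f (zeta n 1) = 0"
      and min: "\<And>g. g \<in> poly_over K \<Longrightarrow> poly g (zeta n 1) = 0 \<Longrightarrow> f dvd g"
    using minimal_polynomial_exists[OF K unity_poly_over[OF K] u0 u] by blast
  have fu: "f dvd ?u" by (rule min[OF unity_poly_over[OF K] u])
  have f0: "f \<noteq> 0" using f(2) by auto
  have inj: "inj_on (zeta n) {0..<int n}"
    by (rule inj_onI) (auto simp: zeta_eq_iff[OF n] cong_def)
  have roots: "{z. poly f z = 0} = zeta n ` ?H"
  proof (intro equalityI subsetI)
    fix z assume "z \<in> {z. poly f z = 0}"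
    then have z: "poly f z = 0" by simp
    then have "poly ?u z = 0" by (rule poly_zero_if_dvd[OF fu])
    then have zn: "z ^ n = 1" by (simp add: poly_monom)
    obtain h where h: "h \<in> {0..<int n}" "z = zeta n h" by (rule unity_root_eq_zeta[OF n zn])
    have "h \<in> galois_exponents n K"
      unfolding galois_exponents_def using z h poly_zero_if_dvd[OF min] by blast
    then show "z \<in> zeta n ` ?H" using h by blast
  next
    fix z assume "z \<in> zeta n ` ?H"
    then show "z \<in> {z. poly f z = 0}" using f(1,3) by (auto simp: galois_exponents_def)
  qed
  have "rsquarefree f"
    unfolding rsquarefree_roots
  proof (intro allI notI)
    fix z assume z: "poly f z = 0 \<and> poly (pderiv f) z = 0"
    obtain q where q: "?u = f * q" using fu by (elim dvdE)
    have "poly (pderiv ?u) z = 0" unfolding q using z by (simp add: pderiv_mult)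
    then have "of_nat n * z ^ (n - 1) = 0" by (simp add: pderiv_diff pderiv_monom poly_monom)
    then have "z ^ (n - 1) = 0" using n by simp
    then have "z = 0" by (rule power_eq_0_iff[THEN iffD1, THEN conjunct1])
    moreover have "poly ?u z = 0" using poly_zero_if_dvd[OF fu] z by blast
    ultimately show False using n by (simp add: poly_monom zero_power)
  qed
  then have "f = Polynomial.smult (Polynomial.lead_coeff f) (\<Prod>z|poly f z = 0. [:- z, 1:])"
    using complex_poly_decompose_rsquarefree by metis
  then have "f = (\<Prod>z\<in>zeta n ` ?H. [:- z, 1:])" using f(2) roots by simp
  then have "Polynomial.degree f = card (zeta n ` ?H)"
    by (simp add: degree_prod_eq_sum_degree)
  also have "\<dots> = card ?H" by (intro card_image inj_on_subset[OF inj]) auto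
  finally show ?thesis using that[OF f(1,2) min roots] by blast
qed

lemma bij_betw_mult_residues:
  fixes H :: "int set"
  assumes n: "0 < n" and closed: "\<And>k l. k \<in> H \<Longrightarrow> l \<in> H \<Longrightarrow> k * l \<in> H"
    and cong: "\<And>k l. [k = l] (mod int n) \<Longrightarrow> k \<in> H \<longleftrightarrow> l \<in> H"
    and h: "h \<in> H" and cop: "coprime h (int n)"
  shows "bij_betw (\<lambda>k. (h * k) mod int n) (H \<inter> {0..<int n}) (H \<inter> {0..<int n})"
proof -
  have "inj_on (\<lambda>k. (h * k) mod int n) (H \<inter> {0..<int n})"
  proof (rule inj_onI)
    fix k l assume kl: "k \<in> H \<inter> {0..<int n}" "l \<in> H \<inter> {0..<int n}" and "(h * k) mod int n = (h * l) mod int n"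
    then have "[h * k = h * l] (mod int n)" by (simp add: cong_def)
    then have "[k = l] (mod int n)" using cop by (simp add: cong_mult_lcancel)
    then show "k = l" using kl by (simp add: cong_def)
  qed
  moreover have "(\<lambda>k. (h * k) mod int n) ` (H \<inter> {0..<int n}) \<subseteq> H \<inter> {0..<int n}"
    using n closed[OF h] cong[of "h * _ mod int n" "h * _"] by (auto simp: cong_def)
  ultimately show ?thesis
    using endo_inj_surj[of "H \<inter> {0..<int n}"] by (auto simp: bij_betw_def)
qed

lemma galois_exponents_residues_nonempty:
  assumes "0 < n"
  shows "1 mod int n \<in> galois_exponents n K \<inter> {0..<int n}"
  using assms galois_exponents_one[of n K] galois_exponents_cong[OF assms, of 1 "1 mod int n" K]
  by (simp add: cong_def)

text \<open>Let \<open>u\<close> be the polynomial over \<open>K\<close> that takes the trace as its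
  value at \<open>\<zeta>\<close>. Permuting the summands shows that \<open>u\<close> takes the same
  value at every conjugate of \<open>\<zeta>\<close>, so \<open>u\<close> modulo the minimal polynomial
  minus that value has more roots than its degree allows. Hence the value is a coefficient of a
  polynomial over \<open>K\<close>.\<close>

lemma galois_trace_in_subfield:
  assumes n: "0 < n" and K: "is_subfield K"
  shows "(\<Sum>h\<in>galois_exponents n K \<inter> {0..<int n}. zeta n (h * k)) \<in> K" (is "?T \<in> K")
proof -
  let ?H = "galois_exponents n K \<inter> {0..<int n}"
  obtain f where f: "f \<in> poly_over K" "Polynomial.lead_coeff f = 1" "{z. poly f z = 0} = zeta n ` ?H"
      "Polynomial.degree f = card ?H"
    using minimal_polynomial_zeta[OF n K] by metis
  have f0: "f \<noteq> 0" using f(2) by auto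
  define u :: "complex poly" where "u = (\<Sum>h\<in>?H. Polynomial.monom 1 (nat (h * k mod int n)))"
  have u: "u \<in> poly_over K" unfolding u_def
    by (intro poly_over_sum[OF K] poly_over_closed(7)[OF K] subfield_closed[OF K])
  have uT: "poly u (zeta n h) = ?T" if h: "h \<in> ?H" for h
  proof -
    have "poly u (zeta n h) = (\<Sum>l\<in>?H. zeta n ((h * l mod int n) * k))"
      unfolding u_def poly_sum
      by (intro sum.cong refl) (use n in \<open>auto simp: poly_monom zeta_power zeta_eq_iff cong_def mod_mult_left_eq mod_mult_right_eq mult_ac\<close>)
    also have "\<dots> = ?T"
      by (rule sum.reindex_bij_betw[OF bij_betw_mult_residues[OF n]])
        (use h galois_exponents_mult[OF n K] galois_exponents_cong[OF n] galois_exponents_coprime[OF n K] in auto)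
    finally show ?thesis .
  qed
  define r where "r = u mod f - [:?T:]"
  have rz: "poly r z = 0" if "poly f z = 0" for z
  proof -
    from that have "z \<in> zeta n ` ?H" using f(3) by auto
    then have "poly u z = ?T" using uT by auto
    then show ?thesis using poly_mod_at_root[OF that] by (simp add: r_def)
  qed
  have one: "1 \<le> card ?H"
    using galois_exponents_residues_nonempty[OF n, of K] by (auto simp: Suc_le_eq card_gt_0_iff)
  have "r = 0"
  proof (rule ccontr)
    assume r0: "r \<noteq> 0"
    have "card ?H = card {z. poly f z = 0}" unfolding f(3)
      by (rule card_image[symmetric], rule inj_onI) (auto simp: zeta_eq_iff[OF n] cong_def)
    also have "\<dots> \<le> card {z. poly r z = 0}" using rz poly_roots_finite[OF r0] by (intro card_mono) auto
    also have "\<dots> \<le> Polynomial.degree r" by (rule card_poly_roots_bound[OF r0])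
    also have "\<dots> < card ?H"
    proof -
      have "u mod f = 0 \<or> Polynomial.degree (u mod f) < card ?H" using degree_mod_less[OF f0, of u] f(4) by simp
      then have "Polynomial.degree (u mod f) < card ?H" using one by auto
      then show ?thesis unfolding r_def using one by (intro degree_diff_less) auto
    qed
    finally show False by simp
  qed
  then have "[:?T:] \<in> poly_over K" using poly_over_mod[OF K f(1) u] by (simp add: r_def)
  then show ?thesis using poly_over_closed(8)[OF K] by blast
qed

text \<open>The powers of \<open>\<zeta>\<close> below the degree of the minimal polynomial form a
  basis: they span by division with remainder, and a linear relation would be a multiple of the minimal
  polynomial of too small a degree.\<close>

lemma extension_degree_cyclotomic:
  assumes n: "0 < n" and K: "is_subfield K" "K \<subseteq> cyclotomic_field n"
  shows "extension_degree (cyclotomic_field n) K = card (galois_exponents n K \<inter> {0..<int n})"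
proof -
  let ?H = "galois_exponents n K \<inter> {0..<int n}" and ?z = "zeta n 1"
  have R: "ring (class_ring :: complex ring)" by (rule class_ring.ring_axioms)
  obtain f where f: "f \<in> poly_over K" "Polynomial.lead_coeff f = 1" "\<And>g. g \<in> poly_over K \<Longrightarrow> poly g ?z = 0 \<Longrightarrow> f dvd g"
      "{z. poly f z = 0} = zeta n ` ?H" "Polynomial.degree f = card ?H"
    using minimal_polynomial_zeta[OF n K(1)] by metis
  have f0: "f \<noteq> 0" using f(2) by auto
  have fz: "poly f ?z = 0"
  proof -
    have "1 mod int n \<in> ?H" by (rule galois_exponents_residues_nonempty[OF n])
    moreover have "zeta n (1 mod int n) = ?z" by (simp add: zeta_eq_iff[OF n])
    ultimately have "?z \<in> zeta n ` ?H" by (metis imageI)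
    then show ?thesis using f(4) by blast
  qed
  define us where "us = map (\<lambda>i. ?z ^ i) [0..<card ?H]"
  have comb: "ring.combine class_ring ks (map (\<lambda>i. x ^ i) [j..<j + length ks]) = poly (Poly ks) x * x ^ j"
    for ks and x :: complex and j
  proof (induction ks arbitrary: j)
    case (Cons k ks)
    have "[j..<j + length (k # ks)] = j # [Suc j..<Suc j + length ks]"
      by (simp add: upt_conv_Cons del: upt_Suc)
    then have "ring.combine class_ring (k # ks) (map (\<lambda>i. x ^ i) [j..<j + length (k # ks)])
        = k * x ^ j + ring.combine class_ring ks (map (\<lambda>i. x ^ i) [Suc j..<Suc j + length ks])"
      by (simp add: ring.combine.simps[OF R] del: upt_Suc)
    also have "\<dots> = k * x ^ j + poly (Poly ks) x * x ^ Suc j"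
      by (simp only: Cons.IH)
    finally show ?case by (simp add: algebra_simps)
  qed (simp add: ring.combine.simps[OF R])
  have comb1: "ring.combine class_ring ks us = poly (Poly ks) ?z" if "length ks = card ?H" for ks
    using comb[of ks ?z 0] that by (simp add: us_def)
  have Pk: "Poly ks \<in> poly_over K" if "set ks \<subseteq> K" for ks
    using that by (induction ks) (auto simp: poly_over_closed[OF K(1)])
  have span: "ring.Span class_ring K us = cyclotomic_field n"
  proof -
    have "ring.Span class_ring K us = {poly (Poly ks) ?z | ks. length ks = card ?H \<and> set ks \<subseteq> K}"
      using ring.Span_eq_combine_set_length_version[OF R K(1), of us] comb1 by (auto simp: us_def)
    also have "\<dots> = {poly f ?z | f. f \<in> poly_over K}"
    proof (intro equalityI subsetI)
      fix y assume "y \<in> {poly g ?z | g. g \<in> poly_over K}"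
      then obtain g where g: "g \<in> poly_over K" "y = poly g ?z" by blast
      have r: "g mod f \<in> poly_over K" by (rule poly_over_mod[OF K(1) f(1) g(1)])
      have deg: "g mod f = 0 \<or> Polynomial.degree (g mod f) < card ?H" using degree_mod_less[OF f0, of g] f(5) by simp
      define ks where "ks = map (Polynomial.coeff (g mod f)) [0..<card ?H]"
      have "Poly ks = g mod f"
      proof (rule poly_eqI)
        fix i
        show "Polynomial.coeff (Poly ks) i = Polynomial.coeff (g mod f) i"
          using deg by (auto simp: ks_def nth_default_def coeff_eq_0)
      qed
      moreover have "poly g ?z = poly (g mod f) ?z"
        by (simp only: poly_mod_at_root[OF fz])
      moreover have "length ks = card ?H" "set ks \<subseteq> K" using r by (auto simp: ks_def poly_over_def)
      ultimately show "y \<in> {poly (Poly ks) ?z | ks. length ks = card ?H \<and> set ks \<subseteq> K}"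
        unfolding g(2) by (intro CollectI exI[of _ ks] conjI) simp_all
    qed (use Pk in blast)
    finally show ?thesis using cyclotomic_field_eq_poly_values[OF n K] by simp
  qed
  have indep: "ring.independent class_ring K us"
  proof (rule ring.trivial_combine_imp_independent[OF R K(1)])
    fix ks assume ks: "set ks \<subseteq> K" "ring.combine class_ring ks us = \<zero>\<^bsub>class_ring\<^esub>"
    define ks' where "ks' = take (card ?H) (ks @ replicate (card ?H) 0)"
    have len: "length ks' = card ?H" and sk: "set ks' \<subseteq> K"
      using ks(1) subfield_closed(1)[OF K(1)] set_take_subset[of "card ?H" "ks @ replicate (card ?H) 0"]
      by (auto simp: ks'_def)
    have "ring.combine class_ring ks' us = ring.combine class_ring (ks @ replicate (card ?H) 0) us"
      using ring.combine_take[OF R, of us "ks @ replicate (card ?H) 0"] by (simp add: ks'_def us_def)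
    also have "\<dots> = ring.combine class_ring ks us"
      using ring.combine_append_replicate[OF R, of us ks "card ?H"] by simp
    finally have "poly (Poly ks') ?z = 0" using ks(2) comb1[OF len] by simp
    then have "f dvd Poly ks'" by (intro f(3) Pk sk)
    moreover have "Poly ks' = 0 \<or> Polynomial.degree (Poly ks') < card ?H"
    proof (cases "Poly ks' = 0")
      case False
      have "Polynomial.coeff (Poly ks') i = 0" if "card ?H \<le> i" for i
        using that len by (simp add: nth_default_def)
      then show ?thesis using False by (meson leI leading_coeff_0_iff)
    qed simp
    ultimately have "Poly ks' = 0" using f(5) dvd_imp_degree_le[of f "Poly ks'"] by fastforce
    then have "\<forall>i<length ks'. ks' ! i = 0"
      by (metis Polynomial.coeff_0 coeff_Poly nth_default_nth)
    then have "set ks' \<subseteq> {0}" by (auto simp: in_set_conv_nth)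
    moreover have "take (length us) ks = take (length ks) ks'"
      by (cases "length ks \<le> card ?H") (simp_all add: ks'_def us_def)
    ultimately show "set (take (length us) ks) \<subseteq> {\<zero>\<^bsub>class_ring\<^esub>}"
      using set_take_subset[of "length ks" ks'] by auto
  qed simp
  have dim: "ring.dimension class_ring (card ?H) K (cyclotomic_field n)"
    using ring.dimensionI[OF R K(1) indep span] by (simp add: us_def)
  show ?thesis
    unfolding extension_degree_def ring.dim_def[OF R]
  proof (rule the_equality)
    show "ring.dimension class_ring (card ?H) K (cyclotomic_field n)" by (rule dim)
    show "k = card ?H" if "ring.dimension class_ring k K (cyclotomic_field n)" for k
      by (rule ring.dimension_is_inj[OF R K(1) that dim])
  qed
qed

lemma is_subfield_Rats: "is_subfield \<rat>"
  by (rule is_subfieldI) (auto intro: Rats_inverse)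

text \<open>Write \<open>x \<in> F\<close> as a rational polynomial in \<open>\<zeta>\<close>. The
  Galois group fixes \<open>x\<close>, so averaging the expression over the group expresses
  \<open>x\<close> rationally through the traces of the powers of \<open>\<zeta>\<close>.\<close>

lemma galois_traces_generate:
  assumes n: "0 < n" and F: "is_subfield F" "F \<subseteq> cyclotomic_field n"
  shows "generated_subfield (range (\<lambda>k. \<Sum>h\<in>galois_exponents n F \<inter> {0..<int n}. zeta n (h * k))) = F"
    (is "generated_subfield ?S = F")
proof
  show "generated_subfield ?S \<subseteq> F"
    using galois_trace_in_subfield[OF n F(1)] by (intro generated_subfield_least[OF F(1)]) blast
  show "F \<subseteq> generated_subfield ?S"
  proof
    fix x assume x: "x \<in> F"
    let ?H = "galois_exponents n F \<inter> {0..<int n}" and ?E = "generated_subfield ?S"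
    have E: "is_subfield ?E" by (rule generated_subfield_is_subfield)
    obtain q where q: "q \<in> poly_over \<rat>" "x = poly q (zeta n 1)"
      using cyclotomic_field_eq_poly_values[OF n is_subfield_Rats Rats_subset_subfield[OF cyclotomic_field_subfield]]
        x F(2) by blast
    have qF: "q \<in> poly_over F" using q(1) poly_over_mono[OF Rats_subset_subfield[OF F(1)]] by blast
    have "of_nat (card ?H) * x = (\<Sum>h\<in>?H. poly q (zeta n h))"
      using galois_exponents_fix[OF F(1) _ qF] x q(2) by simp
    also have "\<dots> = (\<Sum>i\<le>Polynomial.degree q. Polynomial.coeff q i * (\<Sum>h\<in>?H. zeta n (h * int i)))"
      by (simp add: poly_altdef zeta_power sum_distrib_left sum.swap[of _ ?H])
    also have "\<dots> \<in> ?E"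
    proof (rule subfield_sum[OF E], rule subfield_closed(6)[OF E])
      fix i
      show "Polynomial.coeff q i \<in> ?E" using q(1) Rats_subset_subfield[OF E] by (auto simp: poly_over_def)
      show "(\<Sum>h\<in>?H. zeta n (h * int i)) \<in> ?E"
        by (rule subsetD[OF generated_subfield_incl]) (rule rangeI)
    qed
    finally have c: "of_nat (card ?H) * x \<in> ?E" .
    have "of_nat (card ?H) \<in> \<rat>" by simp
    then have "inverse (of_nat (card ?H)) * (of_nat (card ?H) * x) \<in> ?E"
      using Rats_subset_subfield[OF E] by (intro subfield_closed(6,7)[OF E] c) blast
    moreover have "card ?H \<noteq> 0" using galois_exponents_residues_nonempty[OF n, of F] by (auto simp: card_eq_0_iff)
    ultimately show "x \<in> ?E" by (simp flip: mult.assoc)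
  qed
qed

text \<open>The fixed field of \<open>h\<close>, with the automorphism evaluated on rational polynomials
  in \<open>\<zeta>\<close>. It is used to show that \<open>h\<close> fixes a compositum as soon as it
  fixes generators.\<close>

lemma galois_exponents_fixed_subfield:
  assumes n: "0 < n" and F: "is_subfield F" and h: "h \<in> galois_exponents n F"
  shows "is_subfield {poly u (zeta n 1) | u. u \<in> poly_over \<rat> \<and> poly u (zeta n h) = poly u (zeta n 1)}"
    (is "is_subfield ?L")
proof -
  note Q = is_subfield_Rats
  have mem: "poly u (zeta n 1) \<in> ?L" if "u \<in> poly_over \<rat>" "poly u (zeta n h) = poly u (zeta n 1)" for u
    using that by blast
  show ?thesis
  proof (rule is_subfieldI)
    show "1 \<in> ?L" using mem[of 1] poly_over_closed(2)[OF Q] by simp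
    show "- x \<in> ?L" if x: "x \<in> ?L" for x
    proof -
      obtain u where u: "u \<in> poly_over \<rat>" "poly u (zeta n h) = poly u (zeta n 1)" "x = poly u (zeta n 1)"
        using x by blast
      show ?thesis using mem[of "0 - u"] poly_over_closed(4)[OF Q poly_over_closed(1)[OF Q] u(1)] u(2,3) by simp
    qed
    fix x y assume x: "x \<in> ?L" and y: "y \<in> ?L"
    obtain u where u: "u \<in> poly_over \<rat>" "poly u (zeta n h) = poly u (zeta n 1)" "x = poly u (zeta n 1)"
      using x by blast
    obtain v where v: "v \<in> poly_over \<rat>" "poly v (zeta n h) = poly v (zeta n 1)" "y = poly v (zeta n 1)"
      using y by blast
    show "x + y \<in> ?L" using mem[OF poly_over_closed(3)[OF Q u(1) v(1)]] u v by simp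
    show "x * y \<in> ?L" using mem[OF poly_over_closed(5)[OF Q u(1) v(1)]] u v by simp
  next
    fix x assume x: "x \<in> ?L" "x \<noteq> 0"
    then obtain u where u: "u \<in> poly_over \<rat>" "poly u (zeta n h) = poly u (zeta n 1)" "x = poly u (zeta n 1)"
      by blast
    have vals: "cyclotomic_field n = {poly f (zeta n 1) | f. f \<in> poly_over \<rat>}"
      by (rule cyclotomic_field_eq_poly_values[OF n Q Rats_subset_subfield[OF cyclotomic_field_subfield]])
    then have "x \<in> cyclotomic_field n" using u by blast
    then have "inverse x \<in> cyclotomic_field n" by (rule subfield_closed(7)[OF cyclotomic_field_subfield])
    then obtain w where w: "w \<in> poly_over \<rat>" "inverse x = poly w (zeta n 1)" using vals by blast
    have sub: "poly_over \<rat> \<subseteq> poly_over F" by (rule poly_over_mono[OF Rats_subset_subfield[OF F]])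
    have "poly (u * w) (zeta n h) = poly 1 (zeta n h)"
    proof (rule galois_exponents_poly[OF F h])
      show "u * w \<in> poly_over F" using poly_over_closed(5)[OF Q u(1) w(1)] sub by blast
      show "1 \<in> poly_over F" by (rule poly_over_closed(2)[OF F])
      show "poly (u * w) (zeta n 1) = poly 1 (zeta n 1)" using x(2) by (simp flip: u(3) w(2))
    qed
    then have "x * poly w (zeta n h) = 1" using u(2,3) by simp
    then have "poly w (zeta n h) = inverse x" using inverse_unique by metis
    then show "inverse x \<in> ?L" using mem[OF w(1)] w(2) by simp
  qed
qed

text \<open>Since \<open>\<zeta>\<^bsup>n/m\<^esup>\<close> generates \<open>\<rat>\<^sub>m\<close>, an
  automorphism fixes \<open>\<rat>\<^sub>m\<close> iff its exponent is one modulo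
  \<open>m\<close>.\<close>

lemma galois_exponents_compositum:
  assumes n: "0 < n" and F: "is_subfield F" "F \<subseteq> cyclotomic_field n" and dm: "n = d * m"
  shows "galois_exponents n (generated_subfield (F \<union> cyclotomic_field m))
    = {h \<in> galois_exponents n F. [h = 1] (mod int m)}" (is "galois_exponents n ?K = ?A")
proof
  have d: "0 < d" "0 < m" using n dm by simp_all
  have K: "is_subfield ?K" by (rule generated_subfield_is_subfield)
  have FK: "F \<subseteq> ?K" "cyclotomic_field m \<subseteq> ?K" using generated_subfield_incl[of "F \<union> cyclotomic_field m"] by auto
  have zm: "zeta m k = zeta n (int d * k)" for k using zeta_cancel[OF d(1), of m k] dm by simp
  show "galois_exponents n ?K \<subseteq> ?A"
  proof
    fix h assume h: "h \<in> galois_exponents n ?K"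
    have "poly (Polynomial.monom 1 d) (zeta n h) = poly (Polynomial.monom 1 d) (zeta n 1)"
    proof (rule galois_exponents_fix[OF K h])
      show "Polynomial.monom 1 d \<in> poly_over ?K" by (intro poly_over_closed(7)[OF K] subfield_closed(2)[OF K])
      have "poly (Polynomial.monom 1 d) (zeta n 1) = zeta m 1" by (simp add: poly_monom zeta_power zm)
      then show "poly (Polynomial.monom 1 d) (zeta n 1) \<in> ?K" using FK(2) zeta_in_cyclotomic_field[OF d(2)] by auto
    qed
    then have "zeta m h = zeta m 1" by (simp add: poly_monom zeta_power zm mult.commute)
    then show "h \<in> ?A" using zeta_eq_iff[OF d(2)] h galois_exponents_mono[OF FK(1)] by auto
  qed
  show "?A \<subseteq> galois_exponents n ?K"
  proof
    fix h assume h: "h \<in> ?A"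
    then have hF: "h \<in> galois_exponents n F" and hm: "[h = 1] (mod int m)" by auto
    let ?L = "{poly u (zeta n 1) | u. u \<in> poly_over \<rat> \<and> poly u (zeta n h) = poly u (zeta n 1)}"
    have vals: "cyclotomic_field n = {poly f (zeta n 1) | f. f \<in> poly_over \<rat>}"
      by (rule cyclotomic_field_eq_poly_values[OF n is_subfield_Rats Rats_subset_subfield[OF cyclotomic_field_subfield]])
    have sub: "poly_over \<rat> \<subseteq> poly_over F" by (rule poly_over_mono[OF Rats_subset_subfield[OF F(1)]])
    have L: "is_subfield ?L" by (rule galois_exponents_fixed_subfield[OF n F(1) hF])
    have FL: "F \<subseteq> ?L"
    proof (rule subsetI)
      fix x assume x: "x \<in> F"
      then obtain u where u: "u \<in> poly_over \<rat>" "x = poly u (zeta n 1)" using F(2) vals by blast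
      then have "poly u (zeta n h) = poly u (zeta n 1)"
        using x sub by (intro galois_exponents_fix[OF F(1) hF]) auto
      then show "x \<in> ?L" using u by blast
    qed
    have "zeta m 1 \<in> ?L"
    proof (intro CollectI exI[of _ "Polynomial.monom 1 d"] conjI)
      show "zeta m 1 = poly (Polynomial.monom 1 d) (zeta n 1)" by (simp add: poly_monom zeta_power zm)
      show "Polynomial.monom 1 d \<in> poly_over \<rat>"
        by (intro poly_over_closed(7)[OF is_subfield_Rats] Rats_1)
      have "zeta m h = zeta m 1" by (rule zeta_cong[OF d(2) hm])
      then show "poly (Polynomial.monom 1 d) (zeta n h) = poly (Polynomial.monom 1 d) (zeta n 1)"
        by (simp add: poly_monom zeta_power zm mult.commute)
    qed
    then have "cyclotomic_field m \<subseteq> ?L" unfolding cyclotomic_field_zeta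
      by (intro generated_subfield_least[OF L]) simp
    then have KL: "?K \<subseteq> ?L" using FL by (intro generated_subfield_least[OF L]) simp
    show "h \<in> galois_exponents n ?K"
      unfolding galois_exponents_def
    proof (intro CollectI ballI impI)
      fix f assume f: "f \<in> poly_over ?K" "poly f (zeta n 1) = 0"
      have "\<forall>i. \<exists>u. u \<in> poly_over \<rat> \<and> poly u (zeta n h) = Polynomial.coeff f i \<and> poly u (zeta n 1) = Polynomial.coeff f i"
      proof (rule allI)
        fix i
        have "Polynomial.coeff f i \<in> ?K" using f(1) by (simp add: poly_over_def)
        then have "Polynomial.coeff f i \<in> ?L" by (rule subsetD[OF KL])
        then obtain u where "Polynomial.coeff f i = poly u (zeta n 1)" "u \<in> poly_over \<rat>"
          "poly u (zeta n h) = poly u (zeta n 1)" by blast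
        then show "\<exists>u. u \<in> poly_over \<rat> \<and> poly u (zeta n h) = Polynomial.coeff f i \<and> poly u (zeta n 1) = Polynomial.coeff f i"
          by (intro exI[of _ u]) simp
      qed
      then obtain u where u: "\<And>i. u i \<in> poly_over \<rat>" "\<And>i. poly (u i) (zeta n h) = Polynomial.coeff f i"
          "\<And>i. poly (u i) (zeta n 1) = Polynomial.coeff f i" by metis
      \<comment> \<open>Replacing each coefficient of f by a rational polynomial with the same value at \<open>\<zeta>\<close> and
        at \<open>\<zeta>\<^sup>h\<close> moves the relation from the compositum down to \<open>\<rat>\<close>, where h is known to respect it.\<close>
      define g where "g = (\<Sum>i\<le>Polynomial.degree f. u i * Polynomial.monom 1 i)"
      have "g \<in> poly_over \<rat>" unfolding g_def
        by (intro poly_over_sum[OF is_subfield_Rats] poly_over_closed(5,7)[OF is_subfield_Rats] u(1) Rats_1)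
      then have "g \<in> poly_over F" using sub by blast
      moreover have "poly g (zeta n 1) = poly f (zeta n 1)" by (simp add: g_def poly_sum u poly_monom poly_altdef[of f])
      ultimately have "poly g (zeta n h) = 0" using hF f(2) by (simp add: galois_exponents_def)
      moreover have "poly g (zeta n h) = poly f (zeta n h)" by (simp add: g_def poly_sum u poly_monom poly_altdef[of f])
      ultimately show "poly f (zeta n h) = 0" by simp
    qed
  qed
qed

lemma compositum_subset_cyclotomic:
  assumes "0 < n" "F \<subseteq> cyclotomic_field n" "n = d * m"
  shows "generated_subfield (F \<union> cyclotomic_field m) \<subseteq> cyclotomic_field n"
proof -
  have d: "0 < d" "0 < m" using assms by simp_all
  have "zeta m 1 = zeta n (int d)" using zeta_cancel[OF d(1), of m 1] assms(3) by simp
  then have "zeta m 1 \<in> cyclotomic_field n" using zeta_in_cyclotomic_field[OF assms(1)] by simp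
  then have "cyclotomic_field m \<subseteq> cyclotomic_field n"
    unfolding cyclotomic_field_zeta[of m] by (intro generated_subfield_least[OF cyclotomic_field_subfield]) simp
  then show ?thesis using assms(2) by (intro generated_subfield_least[OF cyclotomic_field_subfield]) simp
qed

section \<open>Irreducible representations and Schur's lemma\<close>

lemma subspace_module_vec_iff:
  "VectorSpace.subspace class_ring W (module_vec TYPE(complex) d) \<longleftrightarrow>
     W \<subseteq> carrier_vec d \<and> 0\<^sub>v d \<in> W \<and> (\<forall>v\<in>W. \<forall>w\<in>W. v + w \<in> W) \<and> (\<forall>c. \<forall>v\<in>W. c \<cdot>\<^sub>v v \<in> W)"
proof -
  interpret vec_space "TYPE(complex)" d .
  have "vectorspace class_ring (module_vec TYPE(complex) d)" "module class_ring (module_vec TYPE(complex) d)"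
    by (rule vectorspace_axioms, rule module_axioms)
  then show ?thesis
    unfolding VectorSpace.subspace_def submodule_def by (simp add: module_vec_simps) blast
qed

lemma subspace_sum_vec:
  assumes W: "VectorSpace.subspace class_ring W (module_vec TYPE(complex) d)" and S: "finite S"
    and f: "\<And>y. y \<in> S \<Longrightarrow> f y \<in> W"
  shows "vec d (\<lambda>i. \<Sum>y\<in>S. c y * f y $ i) \<in> W"
  using S f
proof (induction S rule: finite_induct)
  case empty
  have "vec d (\<lambda>i. \<Sum>y\<in>{}. c y * f y $ i) = 0\<^sub>v d" by auto
  then show ?case using W by (simp add: subspace_module_vec_iff)
next
  case (insert x S)
  have fx: "f x \<in> W" "f x \<in> carrier_vec d" using insert.prems W by (auto simp: subspace_module_vec_iff)
  have "vec d (\<lambda>i. \<Sum>y\<in>insert x S. c y * f y $ i) = c x \<cdot>\<^sub>v f x + vec d (\<lambda>i. \<Sum>y\<in>S. c y * f y $ i)"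
    using insert.hyps fx(2) by (intro eq_vecI) auto
  then show ?case using insert fx(1) W by (simp add: subspace_module_vec_iff)
qed

lemma irreducible_subspace:
  assumes "irreducible_representation G d \<rho>"
    and "W \<subseteq> carrier_vec d" "0\<^sub>v d \<in> W" "\<And>v w. v \<in> W \<Longrightarrow> w \<in> W \<Longrightarrow> v + w \<in> W" "\<And>c v. v \<in> W \<Longrightarrow> c \<cdot>\<^sub>v v \<in> W"
    and "\<And>g w. g \<in> carrier G \<Longrightarrow> w \<in> W \<Longrightarrow> \<rho> g *\<^sub>v w \<in> W"
  shows "W = {0\<^sub>v d} \<or> W = carrier_vec d"
proof -
  have S: "VectorSpace.subspace class_ring W (module_vec TYPE(complex) d)"
    unfolding subspace_module_vec_iff using assms(2-5) by simp
  have "\<forall>W. VectorSpace.subspace class_ring W (module_vec TYPE(complex) d) \<and>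
      (\<forall>g\<in>carrier G. \<forall>w\<in>W. \<rho> g *\<^sub>v w \<in> W) \<longrightarrow> W = {0\<^sub>v d} \<or> W = carrier_vec d"
    by (rule assms(1)[unfolded irreducible_representation_def, THEN conjunct2, THEN conjunct2])
  from this[rule_format, of W] S assms(6) show ?thesis by simp
qed

lemma mat_trace_sum: "A \<in> carrier_mat d d \<Longrightarrow> mat_trace A = (\<Sum>i<d. A $$ (i, i))"
  by (simp add: mat_trace_def diag_mat_def sum_list_sum_nth lessThan_atLeast0)

lemma mat_trace_mult_comm:
  assumes "A \<in> carrier_mat d r" "B \<in> carrier_mat r d"
  shows "mat_trace (A * B) = mat_trace (B * A)"
proof -
  have "mat_trace (A * B) = (\<Sum>i<d. \<Sum>j<r. A $$ (i, j) * B $$ (j, i))"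
    using assms by (subst mat_trace_sum[of _ d]) (auto simp: scalar_prod_def lessThan_atLeast0)
  also have "\<dots> = (\<Sum>j<r. \<Sum>i<d. B $$ (j, i) * A $$ (i, j))"
    by (subst sum.swap) (simp add: mult.commute)
  also have "\<dots> = mat_trace (B * A)"
    using assms by (subst mat_trace_sum[of _ r]) (auto simp: scalar_prod_def lessThan_atLeast0)
  finally show ?thesis .
qed

lemma mat_trace_one: "mat_trace (1\<^sub>m d) = of_nat d"
  by (simp add: mat_trace_sum[of _ d])

lemma mult_mat_vec_zero: "A \<in> carrier_mat d r \<Longrightarrow> A *\<^sub>v 0\<^sub>v r = (0\<^sub>v d :: complex vec)"
  by (intro eq_vecI) (auto simp: scalar_prod_def)

text \<open>Schur's lemma: kernel and image of a nonzero intertwiner are invariant subspaces, so it is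
  invertible, and the two representations have the same trace.\<close>

lemma schur_trace_eq:
  assumes \<sigma>: "irreducible_representation G r \<sigma>" and \<rho>: "irreducible_representation G d \<rho>"
    and T: "T \<in> carrier_mat d r" "T \<noteq> 0\<^sub>m d r"
    and comm: "\<And>g. g \<in> carrier G \<Longrightarrow> \<rho> g * T = T * \<sigma> g"
    and g: "g \<in> carrier G"
  shows "mat_trace (\<rho> g) = mat_trace (\<sigma> g)"
proof -
  have c\<sigma>: "\<sigma> h \<in> carrier_mat r r" and c\<rho>: "\<rho> h \<in> carrier_mat d d" if "h \<in> carrier G" for h
    using \<sigma> \<rho> that by (auto simp: irreducible_representation_def matrix_representation_def)
  have comm': "\<rho> h *\<^sub>v (T *\<^sub>v u) = T *\<^sub>v (\<sigma> h *\<^sub>v u)" if "h \<in> carrier G" "u \<in> carrier_vec r" for h u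
    using comm[OF that(1)] c\<sigma>[OF that(1)] c\<rho>[OF that(1)] T(1) that(2)
    by (metis assoc_mult_mat_vec)
  obtain i j where ij: "i < d" "j < r" "T $$ (i, j) \<noteq> 0"
    using T by (metis carrier_matD eq_matI index_zero_mat)
  have Tj: "T *\<^sub>v unit_vec r j \<noteq> 0\<^sub>v d"
  proof
    assume "T *\<^sub>v unit_vec r j = 0\<^sub>v d"
    then have "(T *\<^sub>v unit_vec r j) $ i = 0" using ij by simp
    then show False using ij T(1) by (simp add: scalar_prod_right_unit)
  qed
  let ?Ker = "{u \<in> carrier_vec r. T *\<^sub>v u = 0\<^sub>v d}"
  have ker: "?Ker = {0\<^sub>v r}"
  proof -
    have "?Ker = {0\<^sub>v r} \<or> ?Ker = carrier_vec r"
    proof (rule irreducible_subspace[OF \<sigma>])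
      show "v + w \<in> ?Ker" if "v \<in> ?Ker" "w \<in> ?Ker" for v w
        using that T(1) by (auto simp: mult_add_distrib_mat_vec)
      show "c \<cdot>\<^sub>v v \<in> ?Ker" if "v \<in> ?Ker" for c v
        using that T(1) by (auto simp: mult_mat_vec)
      show "\<sigma> h *\<^sub>v v \<in> ?Ker" if "h \<in> carrier G" "v \<in> ?Ker" for h v
      proof -
        have v: "v \<in> carrier_vec r" "T *\<^sub>v v = 0\<^sub>v d" using that by simp_all
        then have "T *\<^sub>v (\<sigma> h *\<^sub>v v) = 0\<^sub>v d"
          using comm'[OF that(1) v(1)] mult_mat_vec_zero[OF c\<rho>[OF that(1)]] by simp
        then show ?thesis using c\<sigma>[OF that(1)] v(1) by simp
      qed
      show "0\<^sub>v r \<in> ?Ker" using mult_mat_vec_zero[OF T(1)] by simp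
    qed simp
    moreover have "?Ker \<noteq> carrier_vec r"
    proof
      assume "?Ker = carrier_vec r"
      then have "unit_vec r j \<in> ?Ker" by (simp only: unit_vec_carrier)
      then show False using Tj by simp
    qed
    ultimately show ?thesis by simp
  qed
  let ?Im = "{T *\<^sub>v u | u. u \<in> carrier_vec r}"
  have im: "?Im = carrier_vec d"
  proof -
    have "?Im = {0\<^sub>v d} \<or> ?Im = carrier_vec d"
    proof (rule irreducible_subspace[OF \<rho>])
      show "?Im \<subseteq> carrier_vec d" using T(1) by auto
      show "0\<^sub>v d \<in> ?Im" using T(1) by (auto intro!: exI[of _ "0\<^sub>v r"] simp: mult_mat_vec_zero)
      show "v + w \<in> ?Im" if vw: "v \<in> ?Im" "w \<in> ?Im" for v w
      proof -
        obtain x y where "x \<in> carrier_vec r" "y \<in> carrier_vec r" "v = T *\<^sub>v x" "w = T *\<^sub>v y" using vw by blast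
        then show ?thesis using T(1) by (intro CollectI exI[of _ "x + y"]) (simp add: mult_add_distrib_mat_vec)
      qed
      show "c \<cdot>\<^sub>v v \<in> ?Im" if v: "v \<in> ?Im" for c v
      proof -
        obtain x where "x \<in> carrier_vec r" "v = T *\<^sub>v x" using v by blast
        then show ?thesis using T(1) by (intro CollectI exI[of _ "c \<cdot>\<^sub>v x"]) (simp add: mult_mat_vec)
      qed
      show "\<rho> h *\<^sub>v v \<in> ?Im" if h: "h \<in> carrier G" and v: "v \<in> ?Im" for h v
      proof -
        obtain x where "x \<in> carrier_vec r" "v = T *\<^sub>v x" using v by blast
        then show ?thesis using comm'[OF h] c\<sigma>[OF h] by (intro CollectI exI[of _ "\<sigma> h *\<^sub>v x"]) simp
      qed
    qed
    moreover have "?Im \<noteq> {0\<^sub>v d}"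
    proof
      assume "?Im = {0\<^sub>v d}"
      moreover have "T *\<^sub>v unit_vec r j \<in> ?Im" by (intro CollectI exI[of _ "unit_vec r j"]) simp
      ultimately show False using Tj by (simp only: singleton_iff)
    qed
    ultimately show ?thesis by simp
  qed
  have "\<forall>i. \<exists>u. u \<in> carrier_vec r \<and> T *\<^sub>v u = unit_vec d i"
  proof
    fix i
    have "unit_vec d i \<in> ?Im" unfolding im by simp
    then obtain u where "unit_vec d i = T *\<^sub>v u" "u \<in> carrier_vec r" by blast
    then show "\<exists>u. u \<in> carrier_vec r \<and> T *\<^sub>v u = unit_vec d i" by (intro exI[of _ u]) simp
  qed
  then obtain s where s: "\<And>i. s i \<in> carrier_vec r" "\<And>i. T *\<^sub>v s i = unit_vec d i" by metis
  define S where "S = mat r d (\<lambda>(i, j). s j $ i)"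
  have Sc: "S \<in> carrier_mat r d" by (simp add: S_def)
  have colS: "col S j = s j" if "j < d" for j
    using that s(1)[of j] by (intro eq_vecI) (auto simp: S_def)
  have TS: "T * S = 1\<^sub>m d"
  proof (rule eq_matI)
    fix i j assume ij: "i < dim_row (1\<^sub>m d :: complex mat)" "j < dim_col (1\<^sub>m d :: complex mat)"
    then have "(T * S) $$ (i, j) = (T *\<^sub>v s j) $ i" using T(1) Sc colS by simp
    then show "(T * S) $$ (i, j) = 1\<^sub>m d $$ (i, j)" using ij by (simp add: s(2) unit_vec_def)
  qed (use T(1) Sc in auto)
  have STu: "S *\<^sub>v (T *\<^sub>v u) = u" if u: "u \<in> carrier_vec r" for u
  proof -
    have "T *\<^sub>v (S *\<^sub>v (T *\<^sub>v u)) = (T * S) *\<^sub>v (T *\<^sub>v u)"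
      using T(1) Sc u by (simp add: assoc_mult_mat_vec[of _ d r])
    then have "T *\<^sub>v (S *\<^sub>v (T *\<^sub>v u) - u) = 0\<^sub>v d"
      using TS T(1) Sc u by (simp add: mult_minus_distrib_mat_vec[of T d r])
    moreover have "S *\<^sub>v (T *\<^sub>v u) - u \<in> carrier_vec r" using Sc T(1) u by auto
    ultimately have z: "S *\<^sub>v (T *\<^sub>v u) - u = 0\<^sub>v r" using ker by blast
    show ?thesis
    proof (rule eq_vecI)
      show "dim_vec (S *\<^sub>v (T *\<^sub>v u)) = dim_vec u" using Sc u by auto
      fix i assume i: "i < dim_vec u"
      then have "(S *\<^sub>v (T *\<^sub>v u) - u) $ i = 0" using u z by simp
      then show "(S *\<^sub>v (T *\<^sub>v u)) $ i = u $ i" using i by simp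
    qed
  qed
  have "mat_trace (\<rho> g) = mat_trace (\<rho> g * (T * S))" using c\<rho>[OF g] TS by simp
  also have "\<dots> = mat_trace (T * (\<sigma> g * S))"
    by (simp only: assoc_mult_mat[OF c\<rho>[OF g] T(1) Sc, symmetric] comm[OF g] assoc_mult_mat[OF T(1) c\<sigma>[OF g] Sc])
  also have "\<dots> = mat_trace (\<sigma> g * S * T)"
    using c\<sigma>[OF g] T(1) Sc by (subst mat_trace_mult_comm[of _ d r]) auto
  also have "\<sigma> g * S * T = \<sigma> g"
  proof -
    have "S * T = 1\<^sub>m r"
    proof (rule eq_matI)
      fix i j assume ij: "i < dim_row (1\<^sub>m r :: complex mat)" "j < dim_col (1\<^sub>m r :: complex mat)"
      have colT: "T *\<^sub>v unit_vec r j = col T j"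
        using ij T(1) by (intro eq_vecI) (auto simp: scalar_prod_right_unit)
      have "(S * T) $$ (i, j) = (S *\<^sub>v col T j) $ i" using ij T(1) Sc by simp
      then show "(S * T) $$ (i, j) = 1\<^sub>m r $$ (i, j)"
        using STu[OF unit_vec_carrier[of r j]] ij by (simp add: colT)
    qed (use T(1) Sc in auto)
    then show ?thesis using c\<sigma>[OF g] T(1) Sc by (simp add: assoc_mult_mat[of _ r r _ d])
  qed
  finally show ?thesis .
qed

text \<open>Linear combinations of representing matrices, the images of elements of the group algebra.
  The dimension is passed explicitly so that an empty sum is a square matrix of the right size.\<close>

definition mat_sum :: "nat \<Rightarrow> 'i set \<Rightarrow> ('i \<Rightarrow> complex) \<Rightarrow> ('i \<Rightarrow> complex mat) \<Rightarrow> complex mat" where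
  "mat_sum d S c A = mat d d (\<lambda>(i, j). \<Sum>y\<in>S. c y * A y $$ (i, j))"

lemma mat_sum_carrier [simp]: "mat_sum d S c A \<in> carrier_mat d d"
  by (simp add: mat_sum_def)

lemma mat_sum_mult_vec:
  assumes "\<And>y. y \<in> S \<Longrightarrow> A y \<in> carrier_mat d d" "v \<in> carrier_vec d"
  shows "mat_sum d S c A *\<^sub>v v = vec d (\<lambda>i. \<Sum>y\<in>S. c y * (A y *\<^sub>v v) $ i)"
proof (rule eq_vecI)
  fix i assume "i < dim_vec (vec d (\<lambda>i. \<Sum>y\<in>S. c y * (A y *\<^sub>v v) $ i))"
  then have i: "i < d" by simp
  have "(mat_sum d S c A *\<^sub>v v) $ i = (\<Sum>j<d. \<Sum>y\<in>S. c y * A y $$ (i, j) * v $ j)"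
    using i assms(2) by (auto simp: mat_sum_def scalar_prod_def lessThan_atLeast0 sum_distrib_right)
  also have "\<dots> = (\<Sum>y\<in>S. c y * (\<Sum>j<d. A y $$ (i, j) * v $ j))"
    by (subst sum.swap) (simp add: sum_distrib_left mult.assoc)
  also have "\<dots> = (\<Sum>y\<in>S. c y * (A y *\<^sub>v v) $ i)"
  proof (rule sum.cong[OF refl])
    fix y assume "y \<in> S"
    then have "A y \<in> carrier_mat d d" by (rule assms(1))
    then show "c y * (\<Sum>j<d. A y $$ (i, j) * v $ j) = c y * (A y *\<^sub>v v) $ i"
      using i assms(2) by (simp add: scalar_prod_def lessThan_atLeast0)
  qed
  finally show "(mat_sum d S c A *\<^sub>v v) $ i = vec d (\<lambda>i. \<Sum>y\<in>S. c y * (A y *\<^sub>v v) $ i) $ i" using i by simp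
qed (simp add: mat_sum_def)

lemma mat_sum_left_mult:
  assumes A: "\<And>y. y \<in> S \<Longrightarrow> A y \<in> carrier_mat d d" and B: "B \<in> carrier_mat d d"
  shows "B * mat_sum d S c A = mat_sum d S c (\<lambda>y. B * A y)"
proof (rule eq_matI)
  fix i j assume "i < dim_row (mat_sum d S c (\<lambda>y. B * A y))" "j < dim_col (mat_sum d S c (\<lambda>y. B * A y))"
  then have ij: "i < d" "j < d" by (auto simp: mat_sum_def)
  have "(B * mat_sum d S c A) $$ (i, j) = (\<Sum>k<d. \<Sum>y\<in>S. c y * (B $$ (i, k) * A y $$ (k, j)))"
    using ij B by (auto simp: mat_sum_def scalar_prod_def lessThan_atLeast0 sum_distrib_left mult_ac intro!: sum.cong)
  also have "\<dots> = (\<Sum>y\<in>S. c y * (\<Sum>k<d. B $$ (i, k) * A y $$ (k, j)))"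
    by (subst sum.swap) (simp add: sum_distrib_left)
  also have "\<dots> = (\<Sum>y\<in>S. c y * (B * A y) $$ (i, j))"
  proof (rule sum.cong[OF refl])
    fix y assume "y \<in> S"
    then have "A y \<in> carrier_mat d d" by (rule A)
    then show "c y * (\<Sum>k<d. B $$ (i, k) * A y $$ (k, j)) = c y * (B * A y) $$ (i, j)"
      using ij B by (simp add: scalar_prod_def lessThan_atLeast0)
  qed
  finally show "(B * mat_sum d S c A) $$ (i, j) = mat_sum d S c (\<lambda>y. B * A y) $$ (i, j)" using ij by (simp add: mat_sum_def)
qed (use B in \<open>auto simp: mat_sum_def\<close>)

lemma mat_sum_right_mult:
  assumes A: "\<And>y. y \<in> S \<Longrightarrow> A y \<in> carrier_mat d d" and B: "B \<in> carrier_mat d d"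
  shows "mat_sum d S c A * B = mat_sum d S c (\<lambda>y. A y * B)"
proof (rule eq_matI)
  fix i j assume "i < dim_row (mat_sum d S c (\<lambda>y. A y * B))" "j < dim_col (mat_sum d S c (\<lambda>y. A y * B))"
  then have ij: "i < d" "j < d" by (auto simp: mat_sum_def)
  have "(mat_sum d S c A * B) $$ (i, j) = (\<Sum>k<d. \<Sum>y\<in>S. c y * (A y $$ (i, k) * B $$ (k, j)))"
    using ij B by (auto simp: mat_sum_def scalar_prod_def lessThan_atLeast0 sum_distrib_right mult.assoc intro!: sum.cong)
  also have "\<dots> = (\<Sum>y\<in>S. c y * (\<Sum>k<d. A y $$ (i, k) * B $$ (k, j)))"
    by (subst sum.swap) (simp add: sum_distrib_left)
  also have "\<dots> = (\<Sum>y\<in>S. c y * (A y * B) $$ (i, j))"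
  proof (rule sum.cong[OF refl])
    fix y assume "y \<in> S"
    then have "A y \<in> carrier_mat d d" by (rule A)
    then show "c y * (\<Sum>k<d. A y $$ (i, k) * B $$ (k, j)) = c y * (A y * B) $$ (i, j)"
      using ij B by (simp add: scalar_prod_def lessThan_atLeast0)
  qed
  finally show "(mat_sum d S c A * B) $$ (i, j) = mat_sum d S c (\<lambda>y. A y * B) $$ (i, j)" using ij by (simp add: mat_sum_def)
qed (use B in \<open>auto simp: mat_sum_def\<close>)

lemma mat_trace_mat_sum:
  assumes "\<And>y. y \<in> S \<Longrightarrow> A y \<in> carrier_mat d d"
  shows "mat_trace (mat_sum d S c A) = (\<Sum>y\<in>S. c y * mat_trace (A y))"
proof -
  have "mat_trace (mat_sum d S c A) = (\<Sum>i<d. \<Sum>y\<in>S. c y * A y $$ (i, i))"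
    by (subst mat_trace_sum[of _ d]) (auto simp: mat_sum_def)
  also have "\<dots> = (\<Sum>y\<in>S. c y * (\<Sum>i<d. A y $$ (i, i)))"
    by (subst sum.swap) (simp add: sum_distrib_left)
  also have "\<dots> = (\<Sum>y\<in>S. c y * mat_trace (A y))"
    by (intro sum.cong refl) (simp add: mat_trace_sum[OF assms])
  finally show ?thesis .
qed

lemma mat_sum_reindex:
  assumes "bij_betw \<pi> S S"
  shows "mat_sum d S (\<lambda>_. 1) (\<lambda>y. A (\<pi> y)) = mat_sum d S (\<lambda>_. 1) A"
  unfolding mat_sum_def using sum.reindex_bij_betw[OF assms, of "\<lambda>y. A y $$ (_, _)"] by simp

section \<open>Class sums and central characters\<close>

locale finite_group = group G for G (structure) +
  assumes finite_carrier: "finite (carrier G)"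
begin

lemma representation_carrier:
  "irreducible_representation G d \<rho> \<Longrightarrow> g \<in> carrier G \<Longrightarrow> \<rho> g \<in> carrier_mat d d"
  by (simp add: irreducible_representation_def matrix_representation_def)

lemma representation_mult:
  "irreducible_representation G d \<rho> \<Longrightarrow> g \<in> carrier G \<Longrightarrow> h \<in> carrier G \<Longrightarrow> \<rho> (g \<otimes> h) = \<rho> g * \<rho> h"
  by (simp add: irreducible_representation_def matrix_representation_def)

lemma representation_one: "irreducible_representation G d \<rho> \<Longrightarrow> \<rho> \<one> = 1\<^sub>m d"
  by (simp add: irreducible_representation_def matrix_representation_def)

lemma conj_class_subset: "x \<in> carrier G \<Longrightarrow> conj_class G x \<subseteq> carrier G"
  by (auto simp: conj_class_def)

lemma conj_class_self: "x \<in> carrier G \<Longrightarrow> x \<in> conj_class G x"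
  by (auto simp: conj_class_def intro!: exI[of _ \<one>])

lemma finite_conj_class: "x \<in> carrier G \<Longrightarrow> finite (conj_class G x)"
  using conj_class_subset finite_carrier finite_subset by blast

lemma conj_conj:
  assumes "g \<in> carrier G" "h \<in> carrier G" "x \<in> carrier G"
  shows "g \<otimes> (h \<otimes> x \<otimes> inv h) \<otimes> inv g = (g \<otimes> h) \<otimes> x \<otimes> inv (g \<otimes> h)"
  using assms by (simp add: inv_mult_group m_assoc)

lemma conj_inv_cancel:
  assumes "g \<in> carrier G" "x \<in> carrier G"
  shows "g \<otimes> (inv g \<otimes> x \<otimes> g) \<otimes> inv g = x" "inv g \<otimes> (g \<otimes> x \<otimes> inv g) \<otimes> g = x"
  using assms by (simp_all add: m_assoc) (simp_all flip: m_assoc)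

lemma bij_betw_conj_class:
  assumes g: "g \<in> carrier G" and x: "x \<in> carrier G"
  shows "bij_betw (\<lambda>y. g \<otimes> y \<otimes> inv g) (conj_class G x) (conj_class G x)"
proof (rule bij_betw_byWitness[where f' = "\<lambda>y. inv g \<otimes> y \<otimes> g"])
  show "\<forall>y\<in>conj_class G x. inv g \<otimes> (g \<otimes> y \<otimes> inv g) \<otimes> g = y"
       "\<forall>y\<in>conj_class G x. g \<otimes> (inv g \<otimes> y \<otimes> g) \<otimes> inv g = y"
    using conj_inv_cancel[OF g] conj_class_subset[OF x] by auto
  have im: "(\<lambda>y. k \<otimes> y \<otimes> inv k) ` conj_class G x \<subseteq> conj_class G x" if k: "k \<in> carrier G" for k
  proof (rule image_subsetI)
    fix y assume "y \<in> conj_class G x"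
    then obtain h where h: "h \<in> carrier G" "y = h \<otimes> x \<otimes> inv h" by (auto simp: conj_class_def)
    then have "k \<otimes> y \<otimes> inv k = (k \<otimes> h) \<otimes> x \<otimes> inv (k \<otimes> h)" using conj_conj[OF k h(1) x] by simp
    then show "k \<otimes> y \<otimes> inv k \<in> conj_class G x"
      unfolding conj_class_def using k h(1) by (intro CollectI exI[of _ "k \<otimes> h"] conjI) simp_all
  qed
  show "(\<lambda>y. g \<otimes> y \<otimes> inv g) ` conj_class G x \<subseteq> conj_class G x" by (rule im[OF g])
  show "(\<lambda>y. inv g \<otimes> y \<otimes> g) ` conj_class G x \<subseteq> conj_class G x" using im[of "inv g"] g by simp
qed

lemma conj_class_eq:
  assumes "x \<in> carrier G" "y \<in> conj_class G x"
  shows "conj_class G y = conj_class G x"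
proof -
  obtain g where g: "g \<in> carrier G" "y = g \<otimes> x \<otimes> inv g" using assms(2) by (auto simp: conj_class_def)
  have sub: "conj_class G (k \<otimes> z \<otimes> inv k) \<subseteq> conj_class G z" if k: "k \<in> carrier G" and z: "z \<in> carrier G" for k z
  proof
    fix w assume "w \<in> conj_class G (k \<otimes> z \<otimes> inv k)"
    then obtain h where h: "h \<in> carrier G" "w = h \<otimes> (k \<otimes> z \<otimes> inv k) \<otimes> inv h" by (auto simp: conj_class_def)
    then have "w = (h \<otimes> k) \<otimes> z \<otimes> inv (h \<otimes> k)" using conj_conj[OF h(1) k z] by simp
    then show "w \<in> conj_class G z"
      unfolding conj_class_def using k h(1) by (intro CollectI exI[of _ "h \<otimes> k"] conjI) simp_all
  qed
  have "x = inv g \<otimes> y \<otimes> inv (inv g)" using g conj_inv_cancel(2)[OF g(1) assms(1)] by simp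
  then have "conj_class G x \<subseteq> conj_class G y" using sub[of "inv g" y] g assms(1) by simp
  then show ?thesis using sub[OF g(1) assms(1)] g(2) by blast
qed

text \<open>The fibres of \<open>g \<mapsto> g x g\<^bsup>-1\<^esup>\<close> all have the same number of
  elements, as they are cosets of the centralizer.\<close>

lemma sum_conj:
  fixes f :: "'a \<Rightarrow> complex"
  assumes x: "x \<in> carrier G"
  shows "of_nat (card (conj_class G x)) * (\<Sum>g\<in>carrier G. f (g \<otimes> x \<otimes> inv g))
    = of_nat (card (carrier G)) * (\<Sum>y\<in>conj_class G x. f y)"
proof -
  let ?K = "conj_class G x" and ?c = "\<lambda>g. g \<otimes> x \<otimes> inv g"
  define N where "N = card {g \<in> carrier G. ?c g = x}"
  have im: "?c ` carrier G = ?K" by (auto simp: conj_class_def)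
  have fib: "card {g \<in> carrier G. ?c g = y} = N" if y: "y \<in> ?K" for y
  proof -
    obtain h where h: "h \<in> carrier G" "y = ?c h" using y by (auto simp: conj_class_def)
    have "bij_betw (\<lambda>g. h \<otimes> g) {g \<in> carrier G. ?c g = x} {g \<in> carrier G. ?c g = y}"
    proof (rule bij_betw_byWitness[where f' = "\<lambda>g. inv h \<otimes> g"])
      show "(\<lambda>g. h \<otimes> g) ` {g \<in> carrier G. ?c g = x} \<subseteq> {g \<in> carrier G. ?c g = y}"
      proof (rule image_subsetI, clarsimp, intro conjI)
        fix g assume g: "g \<in> carrier G" "?c g = x"
        show "h \<otimes> g \<in> carrier G" using h g by simp
        show "?c (h \<otimes> g) = y" using conj_conj[OF h(1) g(1) x] g(2) h(2) by simp
      qed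
      have "?c (inv h \<otimes> g) = x" if g: "g \<in> carrier G" "?c g = y" for g
      proof -
        have "?c (inv h \<otimes> g) = inv h \<otimes> ?c g \<otimes> inv (inv h)" using conj_conj[of "inv h" g x] h(1) g(1) x by simp
        also have "\<dots> = inv h \<otimes> ?c h \<otimes> h" using g(2) h by simp
        also have "\<dots> = x" by (rule conj_inv_cancel(2)[OF h(1) x])
        finally show ?thesis .
      qed
      then show "(\<lambda>g. inv h \<otimes> g) ` {g \<in> carrier G. ?c g = y} \<subseteq> {g \<in> carrier G. ?c g = x}"
        using h by auto
    qed (use h in \<open>auto simp flip: m_assoc\<close>)
    then show ?thesis unfolding N_def by (rule bij_betw_same_card[symmetric])
  qed
  have *: "(\<Sum>g\<in>carrier G. F (?c g)) = of_nat N * (\<Sum>y\<in>?K. F y)" for F :: "'a \<Rightarrow> complex"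
  proof -
    have "(\<Sum>g\<in>carrier G. F (?c g)) = (\<Sum>y\<in>?K. \<Sum>g | g \<in> carrier G \<and> ?c g = y. F (?c g))"
      using sum.image_gen[OF finite_carrier, of "\<lambda>g. F (?c g)" ?c] by (simp add: im)
    also have "\<dots> = (\<Sum>y\<in>?K. of_nat N * F y)" by (intro sum.cong refl) (simp add: fib)
    finally show ?thesis by (simp add: sum_distrib_left)
  qed
  have "of_nat (card (carrier G)) = (of_nat N * of_nat (card ?K) :: complex)" using *[of "\<lambda>_. 1"] by simp
  then show ?thesis using *[of f] by simp
qed

text \<open>The sum \<open>Z\<close> over the class of \<open>x\<close> commutes with the
  representation, so an eigenspace of \<open>Z\<close> is everything. One vector on which the whole
  class acts by known scalars therefore determines the central character.\<close>

lemma central_character_eigenvector: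
  assumes \<rho>: "irreducible_representation G d \<rho>" and x: "x \<in> carrier G"
    and v: "v \<in> carrier_vec d" "v \<noteq> 0\<^sub>v d" and eig: "\<And>y. y \<in> conj_class G x \<Longrightarrow> \<rho> y *\<^sub>v v = c y \<cdot>\<^sub>v v"
  shows "central_character G (restrict (\<lambda>g. mat_trace (\<rho> g)) (carrier G)) x = (\<Sum>y\<in>conj_class G x. c y)"
    (is "_ = ?w")
proof -
  let ?K = "conj_class G x"
  note [simp] = representation_carrier[OF \<rho>]
  have K: "y \<in> ?K \<Longrightarrow> y \<in> carrier G" for y using conj_class_subset[OF x] by blast
  define Z where "Z = mat_sum d ?K (\<lambda>_. 1) \<rho>"
  have Zc: "Z \<in> carrier_mat d d" by (simp add: Z_def)
  have comm: "\<rho> g * Z = Z * \<rho> g" if g: "g \<in> carrier G" for g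
  proof -
    have "\<rho> g * Z = mat_sum d ?K (\<lambda>_. 1) (\<lambda>y. \<rho> g * \<rho> y)"
      unfolding Z_def using g K by (intro mat_sum_left_mult) auto
    also have "\<dots> = mat_sum d ?K (\<lambda>_. 1) (\<lambda>y. \<rho> (g \<otimes> y \<otimes> inv g) * \<rho> g)"
      unfolding mat_sum_def
    proof (intro cong_mat refl, clarsimp, rule sum.cong[OF refl])
      fix i j y assume "y \<in> ?K"
      then have y: "y \<in> carrier G" by (rule K)
      have "g \<otimes> y \<otimes> inv g \<otimes> g = g \<otimes> y" using g y by (simp add: m_assoc)
      then have "\<rho> g * \<rho> y = \<rho> (g \<otimes> y \<otimes> inv g) * \<rho> g"
        using g y by (simp flip: representation_mult[OF \<rho>])
      then show "(\<rho> g * \<rho> y) $$ (i, j) = (\<rho> (g \<otimes> y \<otimes> inv g) * \<rho> g) $$ (i, j)" by simp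
    qed
    also have "\<dots> = mat_sum d ?K (\<lambda>_. 1) (\<lambda>y. \<rho> y * \<rho> g)"
      by (rule mat_sum_reindex[OF bij_betw_conj_class[OF g x], of d "\<lambda>y. \<rho> y * \<rho> g"])
    also have "\<dots> = Z * \<rho> g"
      unfolding Z_def using g K by (intro mat_sum_right_mult[symmetric]) auto
    finally show ?thesis .
  qed
  have Zv: "Z *\<^sub>v v = ?w \<cdot>\<^sub>v v"
  proof -
    have "Z *\<^sub>v v = vec d (\<lambda>i. \<Sum>y\<in>?K. 1 * (\<rho> y *\<^sub>v v) $ i)"
      unfolding Z_def using K v by (intro mat_sum_mult_vec) auto
    also have "\<dots> = ?w \<cdot>\<^sub>v v"
      using v by (intro eq_vecI) (auto simp: eig sum_distrib_right)
    finally show ?thesis .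
  qed
  let ?W = "{u \<in> carrier_vec d. Z *\<^sub>v u = ?w \<cdot>\<^sub>v u}"
  have "?W = {0\<^sub>v d} \<or> ?W = carrier_vec d"
  proof (rule irreducible_subspace[OF \<rho>])
    have "?w \<cdot>\<^sub>v 0\<^sub>v d = (0\<^sub>v d :: complex vec)" by (intro eq_vecI) simp_all
    then show "0\<^sub>v d \<in> ?W" using mult_mat_vec_zero[OF Zc] by simp
    show "u + w \<in> ?W" if "u \<in> ?W" "w \<in> ?W" for u w
      using that Zc by (simp add: mult_add_distrib_mat_vec[of _ d d] smult_add_distrib_vec[of _ d])
    show "a \<cdot>\<^sub>v u \<in> ?W" if "u \<in> ?W" for a u
      using that Zc by (simp add: mult_mat_vec[of _ d d] smult_smult_assoc mult.commute)
    show "\<rho> g *\<^sub>v u \<in> ?W" if g: "g \<in> carrier G" and u: "u \<in> ?W" for g u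
    proof -
      have uc: "u \<in> carrier_vec d" "Z *\<^sub>v u = ?w \<cdot>\<^sub>v u" using u by simp_all
      have "Z *\<^sub>v (\<rho> g *\<^sub>v u) = (Z * \<rho> g) *\<^sub>v u" using Zc g uc(1) by (simp add: assoc_mult_mat_vec[of _ d d _ d])
      also have "\<dots> = (\<rho> g * Z) *\<^sub>v u" using comm[OF g] by simp
      also have "\<dots> = \<rho> g *\<^sub>v (Z *\<^sub>v u)" using Zc g uc(1) by (simp add: assoc_mult_mat_vec[of _ d d _ d])
      also have "\<dots> = ?w \<cdot>\<^sub>v (\<rho> g *\<^sub>v u)" using g uc by (simp add: mult_mat_vec[of _ d d])
      finally show ?thesis
        using mult_mat_vec_carrier[OF representation_carrier[OF \<rho> g] uc(1)] by simp
    qed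
  qed simp
  moreover have "?W \<noteq> {0\<^sub>v d}"
  proof
    assume "?W = {0\<^sub>v d}"
    moreover have "v \<in> ?W" using v Zv by simp
    ultimately show False using v by (simp only: singleton_iff)
  qed
  ultimately have W: "?W = carrier_vec d" by simp
  have Zu: "Z *\<^sub>v unit_vec d i = ?w \<cdot>\<^sub>v unit_vec d i" for i
  proof -
    have "unit_vec d i \<in> ?W" unfolding W by simp
    then show ?thesis by simp
  qed
  have diag: "Z $$ (i, i) = ?w" if i: "i < d" for i
  proof -
    have "Z $$ (i, i) = (Z *\<^sub>v unit_vec d i) $ i" using i Zc by (simp add: scalar_prod_right_unit)
    then show ?thesis using i by (simp add: Zu)
  qed
  have "mat_trace Z = of_nat d * ?w" using diag by (simp add: mat_trace_sum[OF Zc])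
  moreover have "mat_trace Z = of_nat (card ?K) * mat_trace (\<rho> x)"
  proof -
    have "mat_trace (\<rho> y) = mat_trace (\<rho> x)" if y: "y \<in> ?K" for y
    proof -
      obtain g where g: "g \<in> carrier G" "y = g \<otimes> x \<otimes> inv g" using y by (auto simp: conj_class_def)
      have "mat_trace (\<rho> y) = mat_trace (\<rho> (g \<otimes> x) * \<rho> (inv g))" using g x by (simp add: representation_mult[OF \<rho>])
      also have "\<dots> = mat_trace (\<rho> (inv g) * \<rho> (g \<otimes> x))" using g x by (intro mat_trace_mult_comm[of _ d d]) simp_all
      also have "\<rho> (inv g) * \<rho> (g \<otimes> x) = \<rho> x" using g x by (simp flip: representation_mult[OF \<rho>] m_assoc)
      finally show ?thesis .
    qed
    then show ?thesis unfolding Z_def using K by (simp add: mat_trace_mat_sum)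
  qed
  moreover have "mat_trace (\<rho> \<one>) = of_nat d" "d \<noteq> 0"
    using \<rho> representation_one[OF \<rho>] by (simp_all add: mat_trace_one irreducible_representation_def)
  ultimately show ?thesis using x by (simp add: central_character_def)
qed

text \<open>A sum over a normal subset splits into class sums. This is applied with the set
  \<open>M\<close> being an ideal: if every class contributes an element of the ideal, so does the whole
  set.\<close>

lemma sum_class_function:
  fixes f g :: "'a \<Rightarrow> complex"
  assumes D: "D \<subseteq> carrier G" "\<And>x. x \<in> D \<Longrightarrow> conj_class G x \<subseteq> D"
    and f: "\<And>x y. x \<in> D \<Longrightarrow> y \<in> conj_class G x \<Longrightarrow> f y = f x"
    and M: "0 \<in> M" "\<And>x y. x \<in> M \<Longrightarrow> y \<in> M \<Longrightarrow> x + y \<in> M"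
    and fM: "\<And>x. x \<in> D \<Longrightarrow> f x * (\<Sum>y\<in>conj_class G x. g y) \<in> M"
  shows "(\<Sum>x\<in>D. f x * g x) \<in> M"
proof -
  have fin: "finite D" using D(1) finite_carrier finite_subset by blast
  have Msum: "(\<And>i. i \<in> I \<Longrightarrow> F i \<in> M) \<Longrightarrow> sum F I \<in> M" for I and F :: "'a set \<Rightarrow> complex"
    by (induction I rule: infinite_finite_induct) (simp_all add: M)
  have "(\<Sum>x\<in>D. f x * g x) = (\<Sum>K\<in>conj_class G ` D. \<Sum>x | x \<in> D \<and> conj_class G x = K. f x * g x)"
    by (rule sum.image_gen[OF fin])
  also have "\<dots> \<in> M"
  proof (rule Msum)
    fix K assume "K \<in> conj_class G ` D"
    then obtain x where x: "x \<in> D" "K = conj_class G x" by blast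
    have xc: "x \<in> carrier G" using x(1) D(1) by blast
    have "{y \<in> D. conj_class G y = K} = conj_class G x"
    proof (intro equalityI subsetI)
      fix y assume "y \<in> {y \<in> D. conj_class G y = K}"
      then have "y \<in> carrier G" "conj_class G y = conj_class G x" using D(1) x(2) by auto
      then show "y \<in> conj_class G x" using conj_class_self[of y] by simp
    next
      fix y assume y: "y \<in> conj_class G x"
      then have "y \<in> D" using D(2)[OF x(1)] by blast
      then show "y \<in> {y \<in> D. conj_class G y = K}" using conj_class_eq[OF xc y] x(2) by simp
    qed
    then have "(\<Sum>x | x \<in> D \<and> conj_class G x = K. f x * g x) = (\<Sum>y\<in>conj_class G x. f x * g y)"
      using f[OF x(1)] by (intro sum.cong) simp_all
    also have "\<dots> \<in> M" using fM[OF x(1)] by (simp add: sum_distrib_left)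
    finally show "(\<Sum>x | x \<in> D \<and> conj_class G x = K. f x * g x) \<in> M" .
  qed
  finally show ?thesis .
qed

end

section \<open>Linear characters and their extensions\<close>

text \<open>Linear characters of a subgroup are extended by zero to the ambient group, so that induction
  is a plain sum over the group and distinct characters are distinct functions.\<close>

definition lin_char :: "('a, 'b) monoid_scheme \<Rightarrow> 'a set \<Rightarrow> ('a \<Rightarrow> complex) \<Rightarrow> bool" where
  "lin_char G N \<theta> \<longleftrightarrow> (\<forall>x\<in>N. \<forall>y\<in>N. \<theta> (x \<otimes>\<^bsub>G\<^esub> y) = \<theta> x * \<theta> y) \<and> (\<forall>x\<in>N. \<theta> x \<noteq> 0) \<and> (\<forall>x. x \<notin> N \<longrightarrow> \<theta> x = 0)"

definition induced :: "('a, 'b) monoid_scheme \<Rightarrow> 'a set \<Rightarrow> ('a \<Rightarrow> complex) \<Rightarrow> 'a \<Rightarrow> complex" where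
  "induced G N \<theta> =
     restrict (\<lambda>g. (\<Sum>x\<in>carrier G. \<theta> (x \<otimes>\<^bsub>G\<^esub> g \<otimes>\<^bsub>G\<^esub> inv\<^bsub>G\<^esub> x)) / of_nat (card N)) (carrier G)"

lemma lin_charD:
  assumes "lin_char G N \<theta>"
  shows "x \<in> N \<Longrightarrow> y \<in> N \<Longrightarrow> \<theta> (x \<otimes>\<^bsub>G\<^esub> y) = \<theta> x * \<theta> y" "x \<in> N \<Longrightarrow> \<theta> x \<noteq> 0" "x \<notin> N \<Longrightarrow> \<theta> x = 0"
  using assms by (auto simp: lin_char_def)

locale finite_group_subgroup = finite_group G + subgroup N G for N and G (structure)
begin

lemma finite_N: "finite N"
  using finite_carrier subset finite_subset by blast

lemma N_closed [simp]:
  "\<one> \<in> N" "x \<in> N \<Longrightarrow> inv x \<in> N" "x \<in> N \<Longrightarrow> y \<in> N \<Longrightarrow> x \<otimes> y \<in> N" "x \<in> N \<Longrightarrow> x \<in> carrier G"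
  using subgroup.one_closed[OF subgroup_axioms] subgroup.m_inv_closed[OF subgroup_axioms]
    subgroup.m_closed[OF subgroup_axioms] subgroup.subset[OF subgroup_axioms] by auto

lemma card_N_pos: "0 < card N"
  using finite_N N_closed(1) by (auto simp: card_gt_0_iff simp del: N_closed)

lemma lin_char_one: "lin_char G N \<theta> \<Longrightarrow> \<theta> \<one> = 1"
  using lin_charD(2)[of G N \<theta> \<one>] lin_charD(1)[of G N \<theta> \<one> \<one>] by simp

lemma lin_char_inv: "lin_char G N \<theta> \<Longrightarrow> x \<in> N \<Longrightarrow> \<theta> (inv x) = inverse (\<theta> x)"
proof -
  assume \<theta>: "lin_char G N \<theta>" and x: "x \<in> N"
  have "\<theta> x * \<theta> (inv x) = 1" using lin_charD(1)[OF \<theta> x N_closed(2)[OF x]] lin_char_one[OF \<theta>] x by simp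
  then show ?thesis using inverse_unique by metis
qed

lemma mem_mult_iff: "x \<in> N \<Longrightarrow> y \<in> carrier G \<Longrightarrow> x \<otimes> y \<in> N \<longleftrightarrow> y \<in> N"
proof
  assume x: "x \<in> N" and y: "y \<in> carrier G" and "x \<otimes> y \<in> N"
  then have "inv x \<otimes> (x \<otimes> y) \<in> N" by simp
  then show "y \<in> N" using x y by (simp flip: m_assoc)
qed simp

lemma lin_char_mult_left: "lin_char G N \<theta> \<Longrightarrow> x \<in> N \<Longrightarrow> y \<in> carrier G \<Longrightarrow> \<theta> (x \<otimes> y) = \<theta> x * \<theta> y"
  using mem_mult_iff[of x y] lin_charD[of G N \<theta>] by (cases "y \<in> N") auto

lemma lin_char_power: "lin_char G N \<theta> \<Longrightarrow> x \<in> N \<Longrightarrow> \<theta> x ^ card N = 1"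
proof -
  assume \<theta>: "lin_char G N \<theta>" and x: "x \<in> N"
  have pw: "x [^] k \<in> N \<and> \<theta> (x [^] k) = \<theta> x ^ k" for k :: nat
    using x by (induction k) (auto simp: lin_char_one[OF \<theta>] lin_charD(1)[OF \<theta>])
  interpret N: group "G\<lparr>carrier := N\<rparr>" by (rule subgroup_is_group[OF group_axioms])
  have "x [^]\<^bsub>G\<lparr>carrier := N\<rparr>\<^esub> card N = \<one>"
    using N.pow_order_eq_1[of x] x by (simp add: Coset.order_def)
  then have "x [^] card N = \<one>" by (simp add: nat_pow_consistent[symmetric])
  then show ?thesis using pw[of "card N"] lin_char_one[OF \<theta>] by simp
qed

lemma lin_char_algebraic_int:
  assumes \<theta>: "lin_char G N \<theta>"
  shows "algebraic_int (\<theta> x)"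
proof (cases "x \<in> N")
  case True
  show ?thesis
    by (rule algebraic_int_root[of 1 "Polynomial.monom 1 (card N)"])
      (simp_all add: poly_monom degree_monom_eq lin_char_power[OF \<theta> True] card_N_pos)
qed (simp add: lin_charD(3)[OF \<theta>])

lemma bij_betw_mult_N: "y \<in> N \<Longrightarrow> bij_betw (\<lambda>x. y \<otimes> x) N N"
  by (intro bij_betw_byWitness[where f' = "\<lambda>x. inv y \<otimes> x"]) (auto simp flip: m_assoc)

lemma lin_char_orthogonal:
  assumes \<theta>: "lin_char G N \<theta>" and \<eta>: "lin_char G N \<eta>" and ne: "\<theta> \<noteq> \<eta>"
  shows "(\<Sum>x\<in>N. inverse (\<theta> x) * \<eta> x) = 0" (is "?S = 0")
proof -
  obtain y where y: "y \<in> N" "\<theta> y \<noteq> \<eta> y" using ne lin_charD(3)[OF \<theta>] lin_charD(3)[OF \<eta>] by (metis ext)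
  have "?S = (\<Sum>x\<in>N. inverse (\<theta> (y \<otimes> x)) * \<eta> (y \<otimes> x))"
    by (rule sum.reindex_bij_betw[OF bij_betw_mult_N[OF y(1)], symmetric])
  also have "\<dots> = inverse (\<theta> y) * \<eta> y * ?S"
    using y(1) by (simp add: lin_charD(1)[OF \<theta>] lin_charD(1)[OF \<eta>] sum_distrib_left mult_ac)
  finally have "(1 - inverse (\<theta> y) * \<eta> y) * ?S = 0" by (simp add: left_diff_distrib)
  moreover have "inverse (\<theta> y) * \<eta> y \<noteq> 1" using y lin_charD(2)[OF \<theta>] by (auto simp: field_simps)
  ultimately show ?thesis by simp
qed

lemma finite_lin_chars: "finite {\<theta>. lin_char G N \<theta>}"
proof -
  let ?F = "{\<theta>. \<forall>x. (x \<in> N \<longrightarrow> \<theta> x \<in> {z :: complex. z ^ card N = 1}) \<and> (x \<notin> N \<longrightarrow> \<theta> x = 0)}"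
  have "{\<theta>. lin_char G N \<theta>} \<subseteq> ?F"
    by (intro subsetI CollectI conjI allI impI) (simp_all add: lin_char_power lin_charD(3))
  moreover have "finite ?F"
    using card_N_pos by (intro finite_set_of_finite_funs finite_N finite_roots_unity) simp
  ultimately show ?thesis by (rule finite_subset)
qed

text \<open>Existence of a linear character \<open>\<mu>\<close> with kernel exactly \<open>C\<close>
  says that \<open>N / C\<close> is cyclic. Multiplication by \<open>\<mu>\<close> permutes the
  extensions, so their sum vanishes outside \<open>C\<close>; pairing that sum with
  \<open>\<theta>0\<close> counts them.\<close>

lemma extensions_of_lin_char:
  assumes C: "subgroup C G" "C \<subseteq> N" and \<theta>0: "lin_char G N \<theta>0" and \<mu>: "lin_char G N \<mu>" "\<And>x. x \<in> N \<Longrightarrow> \<mu> x = 1 \<longleftrightarrow> x \<in> C"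
  defines "E \<equiv> {\<theta>. lin_char G N \<theta> \<and> (\<forall>x\<in>C. \<theta> x = \<theta>0 x)}"
  shows "finite E" "\<And>x. x \<in> N - C \<Longrightarrow> (\<Sum>\<theta>\<in>E. \<theta> x) = 0" "card E * card C = card N"
proof -
  have EN: "lin_char G N \<theta>" if "\<theta> \<in> E" for \<theta> using that by (simp add: E_def)
  show fin: "finite E" by (rule finite_subset[OF _ finite_lin_chars]) (auto simp: E_def)
  show z: "(\<Sum>\<theta>\<in>E. \<theta> x) = 0" if x: "x \<in> N - C" for x
  proof -
    have "bij_betw (\<lambda>\<theta> y. \<mu> y * \<theta> y) E E"
    proof (rule bij_betw_byWitness[where f' = "\<lambda>\<theta> y. inverse (\<mu> y) * \<theta> y"])
      have c: "\<mu> y * (inverse (\<mu> y) * \<theta> y) = \<theta> y" "inverse (\<mu> y) * (\<mu> y * \<theta> y) = \<theta> y" if "\<theta> \<in> E" for \<theta> y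
        using lin_charD(2)[OF \<mu>(1), of y] lin_charD(3)[OF EN[OF that], of y] by (cases "y \<in> N"; simp)+
      show "\<forall>\<theta>\<in>E. (\<lambda>y. inverse (\<mu> y) * (\<mu> y * \<theta> y)) = \<theta>" "\<forall>\<theta>\<in>E. (\<lambda>y. \<mu> y * (inverse (\<mu> y) * \<theta> y)) = \<theta>"
        using c by auto
      show "(\<lambda>\<theta> y. \<mu> y * \<theta> y) ` E \<subseteq> E" "(\<lambda>\<theta> y. inverse (\<mu> y) * \<theta> y) ` E \<subseteq> E"
        using \<mu> C(2) by (auto simp: E_def lin_char_def)
    qed
    then have "(\<Sum>\<theta>\<in>E. \<theta> x) = (\<Sum>\<theta>\<in>E. \<mu> x * \<theta> x)"
      using sum.reindex_bij_betw[of "\<lambda>\<theta> y. \<mu> y * \<theta> y" E E "\<lambda>\<theta>. \<theta> x"] by simp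
    then have "(\<Sum>\<theta>\<in>E. \<theta> x) = \<mu> x * (\<Sum>\<theta>\<in>E. \<theta> x)" by (rule trans[OF _ sum_distrib_left[symmetric]])
    then have "(\<Sum>\<theta>\<in>E. \<theta> x) = 0 \<or> \<mu> x = 1" by (rule iffD1[OF mult_cancel_right1])
    then show ?thesis using \<mu>(2)[of x] x by blast
  qed
  have \<theta>0E: "\<theta>0 \<in> E" using \<theta>0 by (simp add: E_def)
  have "(\<Sum>x\<in>N. \<Sum>\<theta>\<in>E. inverse (\<theta>0 x) * \<theta> x) = (\<Sum>x\<in>C. \<Sum>\<theta>\<in>E. inverse (\<theta>0 x) * \<theta> x)"
  proof (rule sum.mono_neutral_right[OF finite_N C(2)], rule ballI)
    fix x assume "x \<in> N - C"
    then have "(\<Sum>\<theta>\<in>E. \<theta> x) = 0" by (rule z)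
    then show "(\<Sum>\<theta>\<in>E. inverse (\<theta>0 x) * \<theta> x) = 0" by (simp only: mult_zero_right flip: sum_distrib_left)
  qed
  also have "\<dots> = (\<Sum>x\<in>C. of_nat (card E))"
  proof (rule sum.cong[OF refl])
    fix x assume x: "x \<in> C"
    then have "\<theta>0 x \<noteq> 0" using C(2) lin_charD(2)[OF \<theta>0] by blast
    then have "inverse (\<theta>0 x) * \<theta> x = 1" if "\<theta> \<in> E" for \<theta> using that x by (auto simp: E_def)
    then show "(\<Sum>\<theta>\<in>E. inverse (\<theta>0 x) * \<theta> x) = of_nat (card E)" by simp
  qed
  finally have "(\<Sum>x\<in>N. \<Sum>\<theta>\<in>E. inverse (\<theta>0 x) * \<theta> x) = of_nat (card E * card C)" by simp
  moreover have "(\<Sum>x\<in>N. \<Sum>\<theta>\<in>E. inverse (\<theta>0 x) * \<theta> x) = (\<Sum>\<theta>\<in>E. if \<theta> = \<theta>0 then of_nat (card N) else 0)"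
  proof (subst sum.swap, rule sum.cong[OF refl])
    fix \<theta> assume \<theta>: "\<theta> \<in> E"
    show "(\<Sum>x\<in>N. inverse (\<theta>0 x) * \<theta> x) = (if \<theta> = \<theta>0 then of_nat (card N) else 0)"
      using lin_char_orthogonal[OF \<theta>0 EN[OF \<theta>]] lin_charD(2)[OF \<theta>0] by auto
  qed
  ultimately have "(of_nat (card E * card C) :: complex) = of_nat (card N)" using fin \<theta>0E by simp
  then show "card E * card C = card N" by (simp only: of_nat_eq_iff)
qed

text \<open>Projecting the \<open>C\<close>-eigenvector \<open>v\<close> to the eigenspace of each
  extension of \<open>\<theta>0\<close> gives vectors whose sum is a nonzero multiple of
  \<open>v\<close>, because the sum of the extensions is supported on \<open>C\<close>. So one
  projection is nonzero.\<close>

lemma extension_eigenvector: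
  assumes C: "subgroup C G" "C \<subseteq> N" and \<theta>0: "lin_char G N \<theta>0" and \<mu>: "lin_char G N \<mu>" "\<And>x. x \<in> N \<Longrightarrow> \<mu> x = 1 \<longleftrightarrow> x \<in> C"
    and \<rho>: "irreducible_representation G d \<rho>"
    and v: "v \<in> carrier_vec d" "v \<noteq> 0\<^sub>v d" "\<And>x. x \<in> C \<Longrightarrow> \<rho> x *\<^sub>v v = \<theta>0 x \<cdot>\<^sub>v v"
  obtains \<theta> u where "lin_char G N \<theta>" "\<And>x. x \<in> C \<Longrightarrow> \<theta> x = \<theta>0 x"
    "u \<in> carrier_vec d" "u \<noteq> 0\<^sub>v d" "\<And>x. x \<in> N \<Longrightarrow> \<rho> x *\<^sub>v u = \<theta> x \<cdot>\<^sub>v u"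
proof -
  define E where "E = {\<theta>. lin_char G N \<theta> \<and> (\<forall>x\<in>C. \<theta> x = \<theta>0 x)}"
  note E = extensions_of_lin_char[OF C \<theta>0 \<mu>, folded E_def]
  have NG: "x \<in> N \<Longrightarrow> x \<in> carrier G" for x using subset by blast
  note [simp] = representation_carrier[OF \<rho> NG]
  define u where "u \<theta> = vec d (\<lambda>i. \<Sum>x\<in>N. \<theta> (inv x) * (\<rho> x *\<^sub>v v) $ i)" for \<theta>
  have eig: "\<rho> y *\<^sub>v u \<theta> = \<theta> y \<cdot>\<^sub>v u \<theta>" if \<theta>: "lin_char G N \<theta>" and y: "y \<in> N" for \<theta> y
  proof -
    have um: "u \<theta> = mat_sum d N (\<lambda>x. \<theta> (inv x)) \<rho> *\<^sub>v v"
      unfolding u_def using v(1) by (intro mat_sum_mult_vec[symmetric]) auto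
    have "\<rho> y *\<^sub>v u \<theta> = (\<rho> y * mat_sum d N (\<lambda>x. \<theta> (inv x)) \<rho>) *\<^sub>v v"
      unfolding um using y v(1) by (simp add: assoc_mult_mat_vec[of _ d d _ d])
    also have "\<dots> = mat_sum d N (\<lambda>x. \<theta> (inv x)) (\<lambda>x. \<rho> y * \<rho> x) *\<^sub>v v"
      using y by (subst mat_sum_left_mult) auto
    also have "\<dots> = vec d (\<lambda>i. \<Sum>x\<in>N. \<theta> (inv x) * ((\<rho> y * \<rho> x) *\<^sub>v v) $ i)"
      using v(1) mult_carrier_mat[OF representation_carrier[OF \<rho> NG[OF y]] representation_carrier[OF \<rho> NG]]
      by (intro mat_sum_mult_vec) auto
    also have "\<dots> = vec d (\<lambda>i. \<Sum>x\<in>N. \<theta> y * (\<theta> (inv (y \<otimes> x)) * (\<rho> (y \<otimes> x) *\<^sub>v v) $ i))"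
    proof (intro eq_vecI, simp_all, rule sum.cong[OF refl])
      fix i x assume x: "x \<in> N"
      have "\<theta> (inv (y \<otimes> x)) = inverse (\<theta> y) * \<theta> (inv x)"
        using x y by (simp add: lin_char_inv[OF \<theta>] lin_charD(1)[OF \<theta>])
      then have "\<theta> y * \<theta> (inv (y \<otimes> x)) = \<theta> (inv x)" using lin_charD(2)[OF \<theta> y] by simp
      then show "\<theta> (inv x) * ((\<rho> y * \<rho> x) *\<^sub>v v) $ i = \<theta> y * (\<theta> (inv (y \<otimes> x)) * (\<rho> (y \<otimes> x) *\<^sub>v v) $ i)"
        using x y NG by (simp add: representation_mult[OF \<rho>] flip: mult.assoc)
    qed
    also have "\<dots> = vec d (\<lambda>i. \<Sum>x\<in>N. \<theta> y * (\<theta> (inv x) * (\<rho> x *\<^sub>v v) $ i))"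
      by (subst sum.reindex_bij_betw[OF bij_betw_mult_N[OF y]]) simp
    also have "\<dots> = \<theta> y \<cdot>\<^sub>v u \<theta>" by (intro eq_vecI) (simp_all add: u_def sum_distrib_left)
    finally show ?thesis .
  qed
  have "\<exists>\<theta>\<in>E. u \<theta> \<noteq> 0\<^sub>v d"
  proof (rule ccontr)
    assume "\<not> ?thesis"
    then have zero: "u \<theta> = 0\<^sub>v d" if "\<theta> \<in> E" for \<theta> using that by blast
    obtain i where i: "i < d" "v $ i \<noteq> 0" using v by (metis carrier_vecD eq_vecI index_zero_vec)
    have "(\<Sum>\<theta>\<in>E. u \<theta> $ i) = (\<Sum>x\<in>N. (\<Sum>\<theta>\<in>E. \<theta> (inv x)) * (\<rho> x *\<^sub>v v) $ i)"
      using i by (simp add: u_def sum_distrib_right sum.swap[of _ E N])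
    also have "\<dots> = (\<Sum>x\<in>C. (\<Sum>\<theta>\<in>E. \<theta> (inv x)) * (\<rho> x *\<^sub>v v) $ i)"
    proof (rule sum.mono_neutral_right[OF finite_N C(2)], rule ballI)
      fix x assume x: "x \<in> N - C"
      then have "inv x \<in> N - C" using subgroup.m_inv_closed[OF C(1), of "inv x"] NG by auto
      then show "(\<Sum>\<theta>\<in>E. \<theta> (inv x)) * (\<rho> x *\<^sub>v v) $ i = 0" using E(2) by simp
    qed
    also have "\<dots> = (\<Sum>x\<in>C. of_nat (card E) * v $ i)"
    proof (rule sum.cong[OF refl])
      fix x assume x: "x \<in> C"
      then have ix: "inv x \<in> C" "x \<in> N" "\<theta>0 x \<noteq> 0"
        using C subgroup.m_inv_closed[OF C(1)] lin_charD(2)[OF \<theta>0] by auto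
      have "\<theta> (inv x) = inverse (\<theta>0 x)" if "\<theta> \<in> E" for \<theta>
        using that ix lin_char_inv[OF \<theta>0 ix(2)] by (auto simp: E_def)
      then have "(\<Sum>\<theta>\<in>E. \<theta> (inv x)) = (\<Sum>\<theta>\<in>E. inverse (\<theta>0 x))" by (rule sum.cong[OF refl])
      then have "(\<Sum>\<theta>\<in>E. \<theta> (inv x)) = of_nat (card E) * inverse (\<theta>0 x)" by simp
      then show "(\<Sum>\<theta>\<in>E. \<theta> (inv x)) * (\<rho> x *\<^sub>v v) $ i = of_nat (card E) * v $ i"
        using i v(1) v(3)[OF x] ix(3) by simp
    qed
    also have "\<dots> = of_nat (card N) * v $ i" by (simp flip: E(3) add: mult_ac)
    finally have "of_nat (card N) * v $ i = 0" using zero i by simp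
    then show False using i card_N_pos by simp
  qed
  then obtain \<theta> where "\<theta> \<in> E" "u \<theta> \<noteq> 0\<^sub>v d" by blast
  then show ?thesis using that[of \<theta> "u \<theta>"] eig by (auto simp: E_def u_def)
qed

end

section \<open>Characters induced from a normal subgroup\<close>

locale finite_group_normal = finite_group_subgroup +
  assumes conj_closed: "g \<in> carrier G \<Longrightarrow> x \<in> N \<Longrightarrow> g \<otimes> x \<otimes> inv g \<in> N"
begin

lemma conj_mem_iff: "g \<in> carrier G \<Longrightarrow> x \<in> carrier G \<Longrightarrow> g \<otimes> x \<otimes> inv g \<in> N \<longleftrightarrow> x \<in> N"
  using conj_closed[of "inv g" "g \<otimes> x \<otimes> inv g"] conj_closed[of g x] conj_inv_cancel(2)[of g x] by auto

text \<open>Right coset representatives \<open>t i\<close>, numbered so that they can index the rows of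
  matrices.\<close>

lemma transversal_exists:
  obtains r and t :: "nat \<Rightarrow> 'a" where "r * card N = card (carrier G)" "\<And>i. i < r \<Longrightarrow> t i \<in> carrier G"
    "\<And>g. g \<in> carrier G \<Longrightarrow> \<exists>!i. i < r \<and> g \<otimes> inv (t i) \<in> N"
proof -
  note sub = subgroup_axioms
  define r where "r = card (rcosets N)"
  have "finite (rcosets N)" unfolding RCOSETS_def using finite_carrier by simp
  then obtain f where f: "bij_betw f {0..<r} (rcosets N)" unfolding r_def using ex_bij_betw_nat_finite by blast
  define t where "t i = (SOME x. x \<in> f i)" for i
  have t: "t i \<in> carrier G \<and> f i = N #> t i" if i: "i < r" for i
  proof -
    have "f i \<in> rcosets N" using f i by (auto simp: bij_betw_def)
    then obtain a where a: "a \<in> carrier G" "f i = N #> a" by (auto simp: RCOSETS_def)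
    then have "a \<in> f i" using rcos_self[OF a(1) sub] by simp
    then have "t i \<in> f i" unfolding t_def by (rule someI)
    then have "t i \<in> N #> a" using a(2) by simp
    moreover from this have "t i \<in> carrier G" using r_coset_subset_G[OF subset a(1)] by blast
    ultimately show ?thesis using repr_independence[OF _ a(1) sub, of "t i"] a(2) by simp
  qed
  have mem: "g \<otimes> inv (t i) \<in> N \<longleftrightarrow> g \<in> f i" if "i < r" "g \<in> carrier G" for i g
    using subgroup.rcos_module[OF sub group_axioms, of "t i" g] t[OF that(1)] that(2) by simp
  show ?thesis
  proof (rule that[of r t])
    show "r * card N = card (carrier G)" using lagrange[OF sub] by (simp add: r_def Coset.order_def)
    show "t i \<in> carrier G" if "i < r" for i using t[OF that] by simp
    fix g assume g: "g \<in> carrier G"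
    have "N #> g \<in> rcosets N" using g by (auto simp: RCOSETS_def)
    then have "N #> g \<in> f ` {0..<r}" using f by (simp add: bij_betw_def)
    then obtain i where i: "i < r" "f i = N #> g" by (metis atLeastLessThan_iff imageE)
    have gi: "g \<in> f i" using i(2) rcos_self[OF g sub] by simp
    show "\<exists>!i. i < r \<and> g \<otimes> inv (t i) \<in> N"
    proof (rule ex1I[of _ i])
      show "i < r \<and> g \<otimes> inv (t i) \<in> N" using i(1) gi mem g by blast
      fix j assume j: "j < r \<and> g \<otimes> inv (t j) \<in> N"
      then have "g \<in> f j" using mem g by blast
      then have "g \<in> N #> t j" using t j by simp
      then have "N #> t j = N #> g" using repr_independence[OF _ _ sub, of g "t j"] t j by simp
      then have "f j = f i" using t j i(2) by simp
      then show "j = i" using f i(1) j by (auto simp: bij_betw_def inj_on_def)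
    qed
  qed
qed

end

text \<open>The representation induced from \<open>\<theta>\<close>, in the basis given by a
  transversal.\<close>

locale monomial_rep = finite_group_normal +
  fixes r :: nat and t :: "nat \<Rightarrow> 'a" and \<theta> :: "'a \<Rightarrow> complex"
  assumes index: "r * card N = card (carrier G)"
    and t_carrier [simp]: "i < r \<Longrightarrow> t i \<in> carrier G"
    and t_unique: "g \<in> carrier G \<Longrightarrow> \<exists>!i. i < r \<and> g \<otimes> inv (t i) \<in> N"
    and \<theta>: "lin_char G N \<theta>"
begin

definition mono_mat :: "'a \<Rightarrow> complex mat" where
  "mono_mat g = mat r r (\<lambda>(i, j). \<theta> (t i \<otimes> g \<otimes> inv (t j)))"

lemma mono_carrier [simp]: "mono_mat g \<in> carrier_mat r r"
  by (simp add: mono_mat_def)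

lemma r_pos: "0 < r"
  using t_unique[of \<one>] by auto

lemma t_eqI: "i < r \<Longrightarrow> j < r \<Longrightarrow> t i \<otimes> inv (t j) \<in> N \<Longrightarrow> i = j"
  using t_unique[of "t i"] by (metis N_closed(1) r_inv t_carrier)

lemma \<theta>_conj_N:
  assumes "x \<in> N" "y \<in> carrier G"
  shows "\<theta> (x \<otimes> y \<otimes> inv x) = \<theta> y"
proof (cases "y \<in> N")
  case True
  then show ?thesis using assms lin_charD(2)[OF \<theta> assms(1)] by (simp add: lin_charD(1)[OF \<theta>] lin_char_inv[OF \<theta>])
next
  case False
  then have "x \<otimes> y \<otimes> inv x \<notin> N" using conj_mem_iff[of x y] assms by simp
  then show ?thesis using False lin_charD(3)[OF \<theta>] by simp
qed

lemma mono_mult: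
  assumes g: "g \<in> carrier G" and h: "h \<in> carrier G"
  shows "mono_mat (g \<otimes> h) = mono_mat g * mono_mat h"
proof (rule eq_matI)
  fix i j assume "i < dim_row (mono_mat g * mono_mat h)" "j < dim_col (mono_mat g * mono_mat h)"
  then have ij: "i < r" "j < r" by (auto simp: mono_mat_def)
  obtain k where k: "k < r" "t i \<otimes> g \<otimes> inv (t k) \<in> N" "\<And>l. l < r \<Longrightarrow> t i \<otimes> g \<otimes> inv (t l) \<in> N \<Longrightarrow> l = k"
  proof -
    have "\<exists>!k. k < r \<and> t i \<otimes> g \<otimes> inv (t k) \<in> N" using t_unique[of "t i \<otimes> g"] g ij by simp
    then show ?thesis using that by (elim ex1E) metis
  qed
  have "(mono_mat g * mono_mat h) $$ (i, j) = (\<Sum>l<r. \<theta> (t i \<otimes> g \<otimes> inv (t l)) * \<theta> (t l \<otimes> h \<otimes> inv (t j)))"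
    using ij by (simp add: mono_mat_def scalar_prod_def lessThan_atLeast0)
  also have "\<dots> = (\<Sum>l\<in>{k}. \<theta> (t i \<otimes> g \<otimes> inv (t l)) * \<theta> (t l \<otimes> h \<otimes> inv (t j)))"
  proof (rule sum.mono_neutral_right)
    show "\<forall>l\<in>{..<r} - {k}. \<theta> (t i \<otimes> g \<otimes> inv (t l)) * \<theta> (t l \<otimes> h \<otimes> inv (t j)) = 0"
    proof
      fix l assume "l \<in> {..<r} - {k}"
      then have "t i \<otimes> g \<otimes> inv (t l) \<notin> N" using k(3) by auto
      then show "\<theta> (t i \<otimes> g \<otimes> inv (t l)) * \<theta> (t l \<otimes> h \<otimes> inv (t j)) = 0" using lin_charD(3)[OF \<theta>] by simp
    qed
  qed (use k(1) in auto)
  also have "\<dots> = \<theta> ((t i \<otimes> g \<otimes> inv (t k)) \<otimes> (t k \<otimes> h \<otimes> inv (t j)))"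
  proof -
    have "t k \<otimes> h \<otimes> inv (t j) \<in> carrier G" using k(1) h ij by simp
    from lin_char_mult_left[OF \<theta> k(2) this] show ?thesis by simp
  qed
  also have "(t i \<otimes> g \<otimes> inv (t k)) \<otimes> (t k \<otimes> h \<otimes> inv (t j)) = t i \<otimes> (g \<otimes> h) \<otimes> inv (t j)"
  proof -
    have "inv (t k) \<otimes> (t k \<otimes> (h \<otimes> inv (t j))) = h \<otimes> inv (t j)"
      using k(1) h ij by (simp flip: m_assoc)
    then show ?thesis using k(1) g h ij by (simp add: m_assoc)
  qed
  finally show "mono_mat (g \<otimes> h) $$ (i, j) = (mono_mat g * mono_mat h) $$ (i, j)" using ij by (simp add: mono_mat_def)
qed (simp_all add: mono_mat_def)

lemma mono_one: "mono_mat \<one> = 1\<^sub>m r"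
proof (rule eq_matI)
  fix i j assume "i < dim_row (1\<^sub>m r :: complex mat)" "j < dim_col (1\<^sub>m r :: complex mat)"
  then have ij: "i < r" "j < r" by auto
  then show "mono_mat \<one> $$ (i, j) = 1\<^sub>m r $$ (i, j)"
    using t_eqI[OF ij] lin_charD(3)[OF \<theta>] lin_char_one[OF \<theta>] by (auto simp: mono_mat_def)
qed (simp_all add: mono_mat_def)

text \<open>Every group element is uniquely \<open>n \<otimes> t i\<close>.\<close>

lemma sum_carrier:
  fixes F :: "'a \<Rightarrow> complex"
  shows "(\<Sum>x\<in>carrier G. F x) = (\<Sum>i<r. \<Sum>n\<in>N. F (n \<otimes> t i))"
proof -
  have "bij_betw (\<lambda>(i, n). n \<otimes> t i) ({..<r} \<times> N) (carrier G)"
    unfolding bij_betw_def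
  proof
    show "inj_on (\<lambda>(i, n). n \<otimes> t i) ({..<r} \<times> N)"
    proof (rule inj_onI, clarsimp)
      fix i j n k assume A: "i < r" "j < r" "n \<in> N" "k \<in> N" and eq: "n \<otimes> t i = k \<otimes> t j"
      have "(n \<otimes> t i) \<otimes> inv (t i) \<in> N" "(n \<otimes> t i) \<otimes> inv (t j) \<in> N"
        using A by (simp add: m_assoc, subst eq) (use A in \<open>simp add: m_assoc\<close>)
      moreover have "\<exists>!l. l < r \<and> n \<otimes> t i \<otimes> inv (t l) \<in> N" using t_unique[of "n \<otimes> t i"] A by simp
      ultimately have "i = j" using A(1,2) by blast
      then show "i = j \<and> n = k" using eq A by simp
    qed
    show "(\<lambda>(i, n). n \<otimes> t i) ` ({..<r} \<times> N) = carrier G"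
    proof (intro equalityI subsetI)
      fix g assume g: "g \<in> carrier G"
      then obtain i where i: "i < r" "g \<otimes> inv (t i) \<in> N" using ex1_implies_ex[OF t_unique[OF g]] by blast
      then have "g = (g \<otimes> inv (t i)) \<otimes> t i" using g by (simp add: m_assoc)
      then show "g \<in> (\<lambda>(i, n). n \<otimes> t i) ` ({..<r} \<times> N)" using i by force
    qed auto
  qed
  from sum.reindex_bij_betw[OF this, of F] show ?thesis
    by (simp add: sum.cartesian_product case_prod_unfold)
qed

lemma mono_trace:
  assumes g: "g \<in> carrier G"
  shows "mat_trace (mono_mat g) = induced G N \<theta> g" "mat_trace (mono_mat g) = (\<Sum>i<r. \<theta> (t i \<otimes> g \<otimes> inv (t i)))"
proof -
  show tr: "mat_trace (mono_mat g) = (\<Sum>i<r. \<theta> (t i \<otimes> g \<otimes> inv (t i)))"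
    by (subst mat_trace_sum[of _ r]) (auto simp: mono_mat_def)
  have "(\<Sum>x\<in>carrier G. \<theta> (x \<otimes> g \<otimes> inv x)) = (\<Sum>i<r. \<Sum>n\<in>N. \<theta> (t i \<otimes> g \<otimes> inv (t i)))"
    unfolding sum_carrier[of "\<lambda>x. \<theta> (x \<otimes> g \<otimes> inv x)"]
  proof (intro sum.cong refl)
    fix i n assume i: "i \<in> {..<r}" and n: "n \<in> N"
    have "(n \<otimes> t i) \<otimes> g \<otimes> inv (n \<otimes> t i) = n \<otimes> (t i \<otimes> g \<otimes> inv (t i)) \<otimes> inv n"
      using i n g conj_conj[of n "t i" g] by simp
    then show "\<theta> (n \<otimes> t i \<otimes> g \<otimes> inv (n \<otimes> t i)) = \<theta> (t i \<otimes> g \<otimes> inv (t i))"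
      using \<theta>_conj_N[OF n, of "t i \<otimes> g \<otimes> inv (t i)"] i g by simp
  qed
  then show "mat_trace (mono_mat g) = induced G N \<theta> g"
    using g card_N_pos by (simp add: induced_def tr flip: sum_distrib_left)
qed

text \<open>The constituents of the restriction of the induced representation to
  \<open>N\<close>.\<close>

definition conjugate_char :: "nat \<Rightarrow> 'a \<Rightarrow> complex" where
  "conjugate_char i x = (if x \<in> N then \<theta> (t i \<otimes> x \<otimes> inv (t i)) else 0)"

lemma conjugate_lin_char: "i < r \<Longrightarrow> lin_char G N (conjugate_char i)"
  unfolding lin_char_def
proof (intro conjI ballI allI impI)
  assume i: "i < r"
  fix x assume x: "x \<in> N"
  have cx: "t i \<otimes> x \<otimes> inv (t i) \<in> N" using conj_closed x i by simp
  then show "conjugate_char i x \<noteq> 0" using x lin_charD(2)[OF \<theta>] by (simp add: conjugate_char_def)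
  fix y assume y: "y \<in> N"
  have cy: "t i \<otimes> y \<otimes> inv (t i) \<in> N" using conj_closed y i by simp
  have "t i \<otimes> (x \<otimes> y) \<otimes> inv (t i) = (t i \<otimes> x \<otimes> inv (t i)) \<otimes> (t i \<otimes> y \<otimes> inv (t i))"
  proof -
    have "inv (t i) \<otimes> (t i \<otimes> (y \<otimes> inv (t i))) = y \<otimes> inv (t i)" using i y by (simp flip: m_assoc)
    then show ?thesis using i x y by (simp add: m_assoc)
  qed
  then show "conjugate_char i (x \<otimes> y) = conjugate_char i x * conjugate_char i y"
    using x y lin_charD(1)[OF \<theta> cx cy] by (simp add: conjugate_char_def)
qed (simp add: conjugate_char_def)

lemma mono_diagonal:
  assumes x: "x \<in> N" and ij: "i < r" "j < r"
  shows "mono_mat x $$ (i, j) = (if i = j then conjugate_char i x else 0)"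
proof (cases "i = j")
  case False
  have cx: "t i \<otimes> x \<otimes> inv (t i) \<in> N" using conj_closed x ij by simp
  have "t i \<otimes> x \<otimes> inv (t j) = (t i \<otimes> x \<otimes> inv (t i)) \<otimes> (t i \<otimes> inv (t j))"
  proof -
    have "inv (t i) \<otimes> (t i \<otimes> inv (t j)) = inv (t j)" using ij by (simp flip: m_assoc)
    then show ?thesis using ij x by (simp add: m_assoc)
  qed
  then have "t i \<otimes> x \<otimes> inv (t j) \<notin> N" using mem_mult_iff[OF cx, of "t i \<otimes> inv (t j)"] t_eqI[OF ij] False ij by auto
  then show ?thesis using False ij lin_charD(3)[OF \<theta>] by (simp add: mono_mat_def)
qed (use x ij in \<open>simp add: mono_mat_def conjugate_char_def\<close>)

text \<open>Mackey's criterion for a normal subgroup. The conjugates of \<open>\<theta>\<close> are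
  pairwise distinct, so projecting a nonzero vector of an invariant subspace to one of them yields a
  basis vector, and the group permutes the basis vectors transitively up to scalars.\<close>

lemma mono_irreducible:
  assumes stab: "\<And>g. g \<in> carrier G - N \<Longrightarrow> \<exists>x\<in>N. \<theta> (g \<otimes> x \<otimes> inv g) \<noteq> \<theta> x"
  shows "irreducible_representation G r mono_mat"
  unfolding irreducible_representation_def
proof (intro conjI allI impI)
  show "matrix_representation G r mono_mat"
    by (simp add: matrix_representation_def mono_mult mono_one)
  show "0 < r" by (rule r_pos)
  have distinct: "conjugate_char i \<noteq> conjugate_char j" if ij: "i < r" "j < r" "i \<noteq> j" for i j
  proof -
    have "t i \<otimes> inv (t j) \<in> carrier G - N" using t_eqI[OF ij(1,2)] ij by auto
    from stab[OF this] obtain y where y: "y \<in> N" "\<theta> (t i \<otimes> inv (t j) \<otimes> y \<otimes> inv (t i \<otimes> inv (t j))) \<noteq> \<theta> y" by blast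
    define x where "x = inv (t j) \<otimes> y \<otimes> t j"
    have x: "x \<in> N" using conj_closed[of "inv (t j)" y] y ij by (simp add: x_def)
    have "t j \<otimes> x \<otimes> inv (t j) = y" unfolding x_def using conj_inv_cancel(1)[of "t j" y] y ij by simp
    moreover have "t i \<otimes> x \<otimes> inv (t i) = t i \<otimes> inv (t j) \<otimes> y \<otimes> inv (t i \<otimes> inv (t j))"
      unfolding x_def using conj_conj[of "t i" "inv (t j)" y] y ij by simp
    ultimately have "conjugate_char i x \<noteq> conjugate_char j x" using x y(2) by (simp add: conjugate_char_def)
    then show ?thesis by auto
  qed
  fix W assume "VectorSpace.subspace class_ring W (module_vec TYPE(complex) r) \<and> (\<forall>g\<in>carrier G. \<forall>w\<in>W. mono_mat g *\<^sub>v w \<in> W)"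
  then have W: "VectorSpace.subspace class_ring W (module_vec TYPE(complex) r)"
    and inv: "\<And>g w. g \<in> carrier G \<Longrightarrow> w \<in> W \<Longrightarrow> mono_mat g *\<^sub>v w \<in> W" by blast+
  have Wc: "w \<in> carrier_vec r" if "w \<in> W" for w using W that by (auto simp: subspace_module_vec_iff)
  show "W = {0\<^sub>v r} \<or> W = carrier_vec r"
  proof (cases "W = {0\<^sub>v r}")
    case False
    moreover have "0\<^sub>v r \<in> W" using W by (simp add: subspace_module_vec_iff)
    ultimately obtain w where w: "w \<in> W" "w \<noteq> 0\<^sub>v r" by blast
    then obtain i where i: "i < r" "w $ i \<noteq> 0" using Wc[OF w(1)] by (metis carrier_vecD eq_vecI index_zero_vec)
    define u where "u = vec r (\<lambda>k. \<Sum>x\<in>N. inverse (conjugate_char i x) * (mono_mat x *\<^sub>v w) $ k)"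
    have uW: "u \<in> W" unfolding u_def
      using inv[OF _ w(1)] by (intro subspace_sum_vec[OF W finite_N]) simp
    have mw: "(mono_mat x *\<^sub>v w) $ k = conjugate_char k x * w $ k" if x: "x \<in> N" and k: "k < r" for x k
    proof -
      have "(mono_mat x *\<^sub>v w) $ k = (\<Sum>j<r. mono_mat x $$ (k, j) * w $ j)"
        using k Wc[OF w(1)] by (auto simp: scalar_prod_def lessThan_atLeast0 mono_mat_def)
      also have "\<dots> = (\<Sum>j<r. if j = k then conjugate_char k x * w $ k else 0)"
        using x k by (intro sum.cong refl) (auto simp: mono_diagonal)
      finally show ?thesis using k by simp
    qed
    have uk: "u $ k = (if k = i then of_nat (card N) * w $ i else 0)" if k: "k < r" for k
    proof -
      have "u $ k = (\<Sum>x\<in>N. inverse (conjugate_char i x) * conjugate_char k x) * w $ k"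
        using k by (simp add: u_def mw sum_distrib_right mult.assoc)
      also have "(\<Sum>x\<in>N. inverse (conjugate_char i x) * conjugate_char k x) = (if k = i then of_nat (card N) else 0)"
        using lin_char_orthogonal[OF conjugate_lin_char[OF i(1)] conjugate_lin_char[OF k]] distinct[OF i(1) k]
          lin_charD(2)[OF conjugate_lin_char[OF i(1)]] by auto
      finally show ?thesis by simp
    qed
    define c where "c = of_nat (card N) * w $ i"
    have "c \<noteq> 0" using i(2) card_N_pos by (simp add: c_def)
    then have "unit_vec r i = inverse c \<cdot>\<^sub>v u"
      using uk[folded c_def] i(1) Wc[OF uW] by (intro eq_vecI) auto
    then have eiW: "unit_vec r i \<in> W" using W uW by (simp add: subspace_module_vec_iff)
    have ejW: "unit_vec r j \<in> W" if j: "j < r" for j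
    proof -
      have "mono_mat (inv (t j) \<otimes> t i) *\<^sub>v unit_vec r i = unit_vec r j"
      proof (rule eq_vecI)
        show "dim_vec (mono_mat (inv (t j) \<otimes> t i) *\<^sub>v unit_vec r i) = dim_vec (unit_vec r j)" by (simp add: mono_mat_def)
        fix k assume "k < dim_vec (unit_vec r j :: complex vec)"
        then have k: "k < r" by simp
        have "t k \<otimes> (inv (t j) \<otimes> t i) \<otimes> inv (t i) = t k \<otimes> inv (t j)" using i j k by (simp add: m_assoc)
        then have "(mono_mat (inv (t j) \<otimes> t i) *\<^sub>v unit_vec r i) $ k = \<theta> (t k \<otimes> inv (t j))"
          using k i(1) by (simp add: mono_mat_def scalar_prod_right_unit)
        also have "\<dots> = unit_vec r j $ k"
          using t_eqI[OF k j] lin_charD(3)[OF \<theta>] lin_char_one[OF \<theta>] j k by (cases "k = j") auto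
        finally show "(mono_mat (inv (t j) \<otimes> t i) *\<^sub>v unit_vec r i) $ k = unit_vec r j $ k" .
      qed
      then show ?thesis using inv[OF _ eiW, of "inv (t j) \<otimes> t i"] i j by simp
    qed
    have "v \<in> W" if v: "v \<in> carrier_vec r" for v
    proof -
      have "v = vec r (\<lambda>k. \<Sum>j<r. v $ j * unit_vec r j $ k)"
        using v by (intro eq_vecI) (auto simp: unit_vec_def if_distrib sum.delta cong: if_cong)
      also have "\<dots> \<in> W" by (intro subspace_sum_vec[OF W]) (use ejW in auto)
      finally show ?thesis .
    qed
    then show ?thesis using Wc by blast
  qed simp
qed

text \<open>Frobenius reciprocity: an eigenvector \<open>v\<close> of type \<open>\<theta>\<close> in an
  irreducible representation gives the nonzero intertwiner \<open>T\<close> sending the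
  \<open>j\<close>-th basis vector to \<open>(t j)\<^bsup>-1\<^esup> v\<close>.\<close>

lemma trace_eq_of_eigenvector:
  assumes stab: "\<And>g. g \<in> carrier G - N \<Longrightarrow> \<exists>x\<in>N. \<theta> (g \<otimes> x \<otimes> inv g) \<noteq> \<theta> x"
    and \<rho>: "irreducible_representation G d \<rho>"
    and v: "v \<in> carrier_vec d" "v \<noteq> 0\<^sub>v d" "\<And>x. x \<in> N \<Longrightarrow> \<rho> x *\<^sub>v v = \<theta> x \<cdot>\<^sub>v v"
    and g: "g \<in> carrier G"
  shows "mat_trace (\<rho> g) = mat_trace (mono_mat g)"
proof -
  note \<rho>c = representation_carrier[OF \<rho>]
  have \<rho>\<rho>: "\<rho> h *\<^sub>v (\<rho> k *\<^sub>v v) = \<rho> (h \<otimes> k) *\<^sub>v v" if "h \<in> carrier G" "k \<in> carrier G" for h k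
    using assoc_mult_mat_vec[OF \<rho>c[OF that(1)] \<rho>c[OF that(2)] v(1)] representation_mult[OF \<rho> that] by simp
  define T where "T = mat d r (\<lambda>(k, j). (\<rho> (inv (t j)) *\<^sub>v v) $ k)"
  have Tc: "T \<in> carrier_mat d r" by (simp add: T_def)
  have colT: "col T j = \<rho> (inv (t j)) *\<^sub>v v" if j: "j < r" for j
    using j \<rho>c[of "inv (t j)"] by (intro eq_vecI) (auto simp: T_def)
  have "T \<noteq> 0\<^sub>m d r"
  proof
    assume T: "T = 0\<^sub>m d r"
    have "\<rho> (inv (t 0)) *\<^sub>v v = 0\<^sub>v d" using colT[OF r_pos] r_pos by (simp add: T)
    then have "\<rho> (t 0 \<otimes> inv (t 0)) *\<^sub>v v = 0\<^sub>v d"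
      using \<rho>\<rho>[of "t 0" "inv (t 0)"] r_pos mult_mat_vec_zero[OF \<rho>c[of "t 0"]] by simp
    then show False using v r_pos by (simp add: representation_one[OF \<rho>])
  qed
  moreover have "\<rho> h * T = T * mono_mat h" if h: "h \<in> carrier G" for h
  proof (rule eq_matI)
    fix k j assume "k < dim_row (T * mono_mat h)" "j < dim_col (T * mono_mat h)"
    then have kj: "k < d" "j < r" by (auto simp: T_def mono_mat_def)
    have eq: "t i \<otimes> h \<otimes> inv (t j) \<in> N \<longleftrightarrow> t j \<otimes> inv h \<otimes> inv (t i) \<in> N" if i: "i < r" for i
    proof -
      have "inv (t i \<otimes> h \<otimes> inv (t j)) = t j \<otimes> inv h \<otimes> inv (t i)" using i kj h by (simp add: inv_mult_group m_assoc)
      moreover have "inv (t j \<otimes> inv h \<otimes> inv (t i)) = t i \<otimes> h \<otimes> inv (t j)" using i kj h by (simp add: inv_mult_group m_assoc)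
      ultimately show ?thesis using N_closed(2) by metis
    qed
    have "\<exists>!i. i < r \<and> t j \<otimes> inv h \<otimes> inv (t i) \<in> N" using t_unique[of "t j \<otimes> inv h"] h kj by simp
    then obtain i where i: "i < r" "t i \<otimes> h \<otimes> inv (t j) \<in> N" "\<And>l. l < r \<Longrightarrow> t l \<otimes> h \<otimes> inv (t j) \<in> N \<Longrightarrow> l = i"
      using eq by (elim ex1E) metis
    have "(T * mono_mat h) $$ (k, j) = (\<Sum>l<r. (\<rho> (inv (t l)) *\<^sub>v v) $ k * \<theta> (t l \<otimes> h \<otimes> inv (t j)))"
      using kj by (simp add: T_def mono_mat_def scalar_prod_def lessThan_atLeast0)
    also have "\<dots> = (\<Sum>l\<in>{i}. (\<rho> (inv (t l)) *\<^sub>v v) $ k * \<theta> (t l \<otimes> h \<otimes> inv (t j)))"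
    proof (rule sum.mono_neutral_right)
      show "\<forall>l\<in>{..<r} - {i}. (\<rho> (inv (t l)) *\<^sub>v v) $ k * \<theta> (t l \<otimes> h \<otimes> inv (t j)) = 0"
      proof
        fix l assume "l \<in> {..<r} - {i}"
        then have "t l \<otimes> h \<otimes> inv (t j) \<notin> N" using i(3) by auto
        then show "(\<rho> (inv (t l)) *\<^sub>v v) $ k * \<theta> (t l \<otimes> h \<otimes> inv (t j)) = 0" using lin_charD(3)[OF \<theta>] by simp
      qed
    qed (use i(1) in auto)
    also have "\<dots> = (\<rho> (inv (t i)) *\<^sub>v (\<theta> (t i \<otimes> h \<otimes> inv (t j)) \<cdot>\<^sub>v v)) $ k"
      using kj i(1) v(1) \<rho>c[of "inv (t i)"] by (subst mult_mat_vec[of _ d d]) (auto simp: mult.commute)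
    also have "\<rho> (inv (t i)) *\<^sub>v (\<theta> (t i \<otimes> h \<otimes> inv (t j)) \<cdot>\<^sub>v v) = \<rho> (inv (t i) \<otimes> (t i \<otimes> h \<otimes> inv (t j))) *\<^sub>v v"
      using v(3)[OF i(2)] \<rho>\<rho>[of "inv (t i)" "t i \<otimes> h \<otimes> inv (t j)"] i(1) kj h by simp
    also have "inv (t i) \<otimes> (t i \<otimes> h \<otimes> inv (t j)) = h \<otimes> inv (t j)"
    proof -
      have "inv (t i) \<otimes> (t i \<otimes> (h \<otimes> inv (t j))) = h \<otimes> inv (t j)" using i(1) kj h by (simp flip: m_assoc)
      then show ?thesis using i(1) kj h by (simp add: m_assoc)
    qed
    also have "\<rho> (h \<otimes> inv (t j)) *\<^sub>v v = \<rho> h *\<^sub>v col T j"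
      using \<rho>\<rho>[of h "inv (t j)"] h kj by (simp add: colT)
    also have "(\<rho> h *\<^sub>v col T j) $ k = (\<rho> h * T) $$ (k, j)" using kj \<rho>c[OF h] Tc by simp
    finally show "(\<rho> h * T) $$ (k, j) = (T * mono_mat h) $$ (k, j)" by simp
  qed (use \<rho>c[OF h] in \<open>auto simp: T_def mono_mat_def\<close>)
  ultimately show ?thesis by (intro schur_trace_eq[OF mono_irreducible[OF stab] \<rho> Tc _ _ g])
qed

end

context finite_group_subgroup
begin

lemma induced_one: "lin_char G N \<theta> \<Longrightarrow> induced G N \<theta> \<one> = of_nat (card (carrier G)) / of_nat (card N)"
  by (simp add: induced_def lin_char_one)

text \<open>The degree of the induced character cancels, so its central character is an honest sum of
  roots of unity.\<close>

lemma central_character_induced: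
  assumes \<theta>: "lin_char G N \<theta>" and x: "x \<in> carrier G"
  shows "central_character G (induced G N \<theta>) x = (\<Sum>y\<in>conj_class G x. \<theta> y)"
proof -
  have "card (carrier G) \<noteq> 0" using finite_carrier by auto
  then show ?thesis
    using sum_conj[OF x, of \<theta>] card_N_pos x
    by (simp add: central_character_def induced_one[OF \<theta>]) (simp add: induced_def)
qed

end

context finite_group_normal
begin

context
  fixes \<theta> :: "'a \<Rightarrow> complex"
  assumes \<theta>: "lin_char G N \<theta>"
begin

lemma induced_algebraic_int:
  assumes "g \<in> carrier G"
  shows "algebraic_int (induced G N \<theta> g)"
proof -
  obtain r and t :: "nat \<Rightarrow> 'a" where rt: "r * card N = card (carrier G)" "\<And>i. i < r \<Longrightarrow> t i \<in> carrier G"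
    "\<And>g. g \<in> carrier G \<Longrightarrow> \<exists>!i. i < r \<and> g \<otimes> inv (t i) \<in> N" using transversal_exists by blast
  interpret monomial_rep N G r t \<theta> by unfold_locales (fact rt \<theta>)+
  have "algebraic_int (\<Sum>i\<in>I. \<theta> (f i))" for I :: "nat set" and f
    by (induction I rule: infinite_finite_induct)
      (auto intro: algebraic_int_add_mult(1) lin_char_algebraic_int[OF \<theta>])
  then show ?thesis using mono_trace[OF assms] by metis
qed

lemma
  assumes stab: "\<And>g. g \<in> carrier G - N \<Longrightarrow> \<exists>x\<in>N. \<theta> (g \<otimes> x \<otimes> inv g) \<noteq> \<theta> x"
  shows induced_in_Irr: "induced G N \<theta> \<in> Irr G"
    and character_eq_induced: "\<And>\<rho> d v. irreducible_representation G d \<rho> \<Longrightarrow> v \<in> carrier_vec d \<Longrightarrow> v \<noteq> 0\<^sub>v d \<Longrightarrow>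
      (\<And>x. x \<in> N \<Longrightarrow> \<rho> x *\<^sub>v v = \<theta> x \<cdot>\<^sub>v v) \<Longrightarrow> restrict (\<lambda>g. mat_trace (\<rho> g)) (carrier G) = induced G N \<theta>"
proof -
  obtain r and t :: "nat \<Rightarrow> 'a" where rt: "r * card N = card (carrier G)" "\<And>i. i < r \<Longrightarrow> t i \<in> carrier G"
    "\<And>g. g \<in> carrier G \<Longrightarrow> \<exists>!i. i < r \<and> g \<otimes> inv (t i) \<in> N" using transversal_exists by blast
  interpret monomial_rep N G r t \<theta> by unfold_locales (fact rt \<theta>)+
  have eq: "restrict (\<lambda>g. mat_trace (mono_mat g)) (carrier G) = induced G N \<theta>"
    using mono_trace(1) by (auto simp: induced_def restrict_def)
  show "induced G N \<theta> \<in> Irr G"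
    unfolding Irr_def
    by (intro CollectI exI[of _ r] exI[of _ mono_mat] conjI eq[symmetric] mono_irreducible[OF stab])
  fix \<rho> d v
  assume "irreducible_representation G d \<rho>" "v \<in> carrier_vec d" "v \<noteq> 0\<^sub>v d" "\<And>x. x \<in> N \<Longrightarrow> \<rho> x *\<^sub>v v = \<theta> x \<cdot>\<^sub>v v"
  from trace_eq_of_eigenvector[OF stab this]
  have "restrict (\<lambda>g. mat_trace (\<rho> g)) (carrier G) = restrict (\<lambda>g. mat_trace (mono_mat g)) (carrier G)"
    by (intro restrict_ext) simp
  then show "restrict (\<lambda>g. mat_trace (\<rho> g)) (carrier G) = induced G N \<theta>" using eq by simp
qed

end

end

section \<open>Congruences modulo the maximal ideal\<close>

context
  fixes p :: nat
  assumes p: "prime p"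
begin

lemma max_ideal_props:
  "x \<in> max_ideal_over p \<Longrightarrow> algebraic_int x" "0 \<in> max_ideal_over p"
  "x \<in> max_ideal_over p \<Longrightarrow> y \<in> max_ideal_over p \<Longrightarrow> x + y \<in> max_ideal_over p"
  "x \<in> max_ideal_over p \<Longrightarrow> algebraic_int z \<Longrightarrow> z * x \<in> max_ideal_over p"
  using maximalideal.axioms(1)[OF max_ideal_over(1)[OF p]]
  unfolding ideal_algebraic_integers_iff by blast+

lemma max_ideal_uminus: "x \<in> max_ideal_over p \<Longrightarrow> - x \<in> max_ideal_over p"
  using max_ideal_props(4)[of x "- 1"] by simp

lemma max_ideal_diff: "x \<in> max_ideal_over p \<Longrightarrow> y \<in> max_ideal_over p \<Longrightarrow> x - y \<in> max_ideal_over p"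
  using max_ideal_props(3)[of x "- y"] max_ideal_uminus[of y] by simp

lemma max_ideal_sum: "(\<And>i. i \<in> I \<Longrightarrow> f i \<in> max_ideal_over p) \<Longrightarrow> sum f I \<in> max_ideal_over p"
  by (induction I rule: infinite_finite_induct) (simp_all add: max_ideal_props)

lemma max_ideal_prime:
  assumes "x * y \<in> max_ideal_over p" "algebraic_int x" "algebraic_int y"
  shows "x \<in> max_ideal_over p \<or> y \<in> max_ideal_over p"
proof -
  have "primeideal (max_ideal_over p) algebraic_integers"
    by (rule cring.maximalideal_prime[OF cring_algebraic_integers max_ideal_over(1)[OF p]])
  from primeideal.I_prime[OF this, of x y] assms show ?thesis by (simp add: algebraic_integers_def)
qed

lemma one_notin_max_ideal: "1 \<notin> max_ideal_over p"
proof
  assume one: "1 \<in> max_ideal_over p"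
  have "carrier algebraic_integers \<noteq> max_ideal_over p"
    by (rule maximalideal.I_notcarr[OF max_ideal_over(1)[OF p]])
  moreover have "carrier algebraic_integers = max_ideal_over p"
    using max_ideal_props(1) max_ideal_props(4)[OF one] by (auto simp: algebraic_integers_def)
  ultimately show False by simp
qed

lemma max_ideal_power: "x ^ k \<in> max_ideal_over p \<Longrightarrow> algebraic_int x \<Longrightarrow> x \<in> max_ideal_over p"
proof (induction k)
  case (Suc k)
  have "algebraic_int (x ^ k)" using Suc.prems(2) by (induction k) (auto intro: algebraic_int_add_mult(2))
  then show ?case using Suc max_ideal_prime[of x "x ^ k"] by auto
qed (simp add: one_notin_max_ideal)

lemma of_nat_in_max_ideal_iff: "of_nat k \<in> max_ideal_over p \<longleftrightarrow> p dvd k"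
proof
  assume k: "of_nat k \<in> max_ideal_over p"
  show "p dvd k"
  proof (rule ccontr)
    assume "\<not> p dvd k"
    then have "coprime (int p) (int k)" using p by (simp add: prime_imp_coprime)
    then obtain u v where "u * int p + v * int k = 1" using bezout_int[of "int p" "int k"] by auto
    then have "(of_int (u * int p + v * int k) :: complex) = 1" by simp
    then have "of_int u * of_nat p + of_int v * of_nat k = (1 :: complex)" by simp
    moreover have "of_int u * of_nat p + of_int v * of_nat k \<in> max_ideal_over p"
      using max_ideal_over(2)[OF p] k by (intro max_ideal_props(3,4)) auto
    ultimately show False using one_notin_max_ideal by simp
  qed
next
  assume "p dvd k"
  then obtain l where "k = p * l" ..
  then show "of_nat k \<in> max_ideal_over p"
    using max_ideal_props(4)[OF max_ideal_over(2)[OF p], of "of_nat l"] by (simp add: mult.commute)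
qed

text \<open>In characteristic \<open>p\<close> one has \<open>x\<^sup>p - 1 = (x - 1)\<^sup>p\<close>,
  so there is only one root of unity of \<open>p\<close>-power order.\<close>

lemma unity_root_minus_one_in_max_ideal:
  assumes "x ^ (p ^ a) = 1" "algebraic_int x"
  shows "x - 1 \<in> max_ideal_over p"
  using assms
proof (induction a arbitrary: x)
  case 0
  then show ?case by (simp add: max_ideal_props)
next
  case (Suc a)
  have ap: "algebraic_int (y ^ k)" if "algebraic_int y" for y :: complex and k
    using that by (induction k) (auto intro: algebraic_int_add_mult(2))
  have "(x ^ p) ^ (p ^ a) = 1" using Suc.prems(1) by (simp flip: power_mult)
  then have xp: "x ^ p - 1 \<in> max_ideal_over p" using Suc.IH[of "x ^ p"] ap[OF Suc.prems(2)] by simp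
  define y where "y = x - 1"
  have y: "algebraic_int y" using algebraic_int_add_mult(1)[of x "- 1"] Suc.prems(2) by (simp add: y_def)
  have p0: "0 < p" using p by (simp add: prime_gt_0_nat)
  have "x ^ p = (y + 1) ^ p" by (simp add: y_def)
  also have "\<dots> = (\<Sum>k\<le>p. of_nat (p choose k) * y ^ k)" by (simp add: binomial_ring)
  also have "\<dots> = of_nat (p choose p) * y ^ p + (of_nat (p choose 0) * y ^ 0 + (\<Sum>k\<in>{..p} - {p} - {0}. of_nat (p choose k) * y ^ k))"
    using p0 by (subst sum.remove[of _ p], simp, simp, subst sum.remove[of _ 0]) auto
  finally have "y ^ p = (x ^ p - 1) - (\<Sum>k\<in>{..p} - {p} - {0}. of_nat (p choose k) * y ^ k)" by simp
  also have "\<dots> \<in> max_ideal_over p"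
  proof (intro max_ideal_diff[OF xp] max_ideal_sum)
    fix k assume k: "k \<in> {..p} - {p} - {0}"
    then have k': "0 < k" "\<not> p dvd k" by (auto dest: dvd_imp_le)
    have "p dvd k * (p choose k)" using times_binomial_minus1_eq[OF k'(1), of p] by simp
    then have "p dvd (p choose k)" using p k'(2) by (simp add: prime_dvd_mult_iff)
    then have c: "of_nat (p choose k) \<in> max_ideal_over p" by (simp only: of_nat_in_max_ideal_iff)
    show "of_nat (p choose k) * y ^ k \<in> max_ideal_over p"
      using max_ideal_props(4)[OF c ap[OF y]] by (simp only: mult.commute)
  qed
  finally show ?case using max_ideal_power[OF _ y] by (simp add: y_def)
qed

text \<open>An integer prime to \<open>p\<close> is invertible in the residue field, so it may be
  cleared from the denominator.\<close>

lemma local_max_ideal_int: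
  assumes "x / of_nat k \<in> local_max_ideal p" "algebraic_int x" "\<not> p dvd k"
  shows "x \<in> max_ideal_over p"
proof -
  obtain r s where rs: "x / of_nat k = r / s" "r \<in> max_ideal_over p" "algebraic_int s" "s \<notin> max_ideal_over p"
    using assms(1) by (auto simp: local_max_ideal_def)
  have "s \<noteq> 0" using rs(4) max_ideal_props(2) by auto
  moreover have "k \<noteq> 0" using assms(3) by (intro notI) simp
  ultimately have "s * x = of_nat k * r" using rs(1) by (simp add: field_simps)
  then have "s * x \<in> max_ideal_over p" using max_ideal_props(4)[OF rs(2), of "of_nat k"] by simp
  then show ?thesis using max_ideal_prime[OF _ rs(3) assms(2)] rs(4) by blast
qed

end

section \<open>Groups of affine maps modulo \<open>n\<close>\<close>

text \<open>The affine map \<open>x \<mapsto> h x + k\<close> of the integers modulo \<open>n\<close>,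
  encoded by the pair of the standard representatives of \<open>k\<close> and \<open>h\<close> so that
  the group has natural numbers as elements.\<close>

definition affine_elt :: "nat \<Rightarrow> int \<Rightarrow> int \<Rightarrow> nat" where
  "affine_elt n k h = prod_encode (nat (k mod int n), nat (h mod int n))"

definition affine_group :: "nat \<Rightarrow> int set \<Rightarrow> nat monoid" where
  "affine_group n H = \<lparr>carrier = {affine_elt n k h | k h. h \<in> H},
     monoid.mult = (\<lambda>x y. affine_elt n (int (fst (prod_decode x)) + int (snd (prod_decode x)) * int (fst (prod_decode y)))
       (int (snd (prod_decode x)) * int (snd (prod_decode y)))),
     one = affine_elt n 0 1\<rparr>"

text \<open>Unit groups modulo \<open>n\<close> are represented by unions of residue classes of
  integers; this keeps products and inverses free of reductions modulo \<open>n\<close>.\<close>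

locale unit_group =
  fixes n :: nat and H :: "int set"
  assumes n: "0 < n"
    and H_one: "1 \<in> H"
    and H_mult: "h \<in> H \<Longrightarrow> k \<in> H \<Longrightarrow> h * k \<in> H"
    and H_cong: "[h = k] (mod int n) \<Longrightarrow> h \<in> H \<longleftrightarrow> k \<in> H"
    and H_coprime: "h \<in> H \<Longrightarrow> coprime h (int n)"
    and H_inverse: "h \<in> H \<Longrightarrow> \<exists>k\<in>H. [h * k = 1] (mod int n)"
begin

abbreviation "E \<equiv> affine_elt n"
abbreviation "G \<equiv> affine_group n H"

definition residues :: "int set \<Rightarrow> int set" where
  "residues B = B \<inter> {0..<int n}"

lemma E_eq_iff: "E k h = E k' h' \<longleftrightarrow> [k = k'] (mod int n) \<and> [h = h'] (mod int n)"
proof -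
  have "nat (x mod int n) = nat (y mod int n) \<longleftrightarrow> x mod int n = y mod int n" for x y
    using n by (simp add: eq_nat_nat_iff)
  then show ?thesis by (simp add: affine_elt_def cong_def)
qed

lemma E_cong: "[k = k'] (mod int n) \<Longrightarrow> [h = h'] (mod int n) \<Longrightarrow> E k h = E k' h'"
  by (simp add: E_eq_iff)

lemma decode_E: "[int (fst (prod_decode (E k h))) = k] (mod int n)" "[int (snd (prod_decode (E k h))) = h] (mod int n)"
  using n by (simp_all add: affine_elt_def cong_def)

lemma E_mult: "E k h \<otimes>\<^bsub>G\<^esub> E k' h' = E (k + h * k') (h * h')"
  unfolding affine_group_def by (simp, intro E_cong cong_add cong_mult decode_E)

lemma G_one: "\<one>\<^bsub>G\<^esub> = E 0 1"
  by (simp add: affine_group_def)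

lemma E_in_carrier [simp]: "E k h \<in> carrier G \<longleftrightarrow> h \<in> H"
proof
  assume "E k h \<in> carrier G"
  then obtain k' h' where "E k h = E k' h'" "h' \<in> H" by (auto simp: affine_group_def)
  then show "h \<in> H" using H_cong[of h h'] by (simp add: E_eq_iff)
qed (auto simp: affine_group_def)

lemma carrierE:
  assumes "x \<in> carrier G"
  obtains k h where "x = E k h" "h \<in> H"
  using assms by (auto simp: affine_group_def)

lemma group_G: "group G"
proof (rule groupI)
  fix x y z assume x: "x \<in> carrier G" and y: "y \<in> carrier G" and z: "z \<in> carrier G"
  obtain k h k' h' k'' h'' where e: "x = E k h" "y = E k' h'" "z = E k'' h''" "h \<in> H" "h' \<in> H" "h'' \<in> H"
    using carrierE[OF x] carrierE[OF y] carrierE[OF z] by metis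
  show "x \<otimes>\<^bsub>G\<^esub> y \<in> carrier G" using e by (simp add: E_mult H_mult)
  show "x \<otimes>\<^bsub>G\<^esub> y \<otimes>\<^bsub>G\<^esub> z = x \<otimes>\<^bsub>G\<^esub> (y \<otimes>\<^bsub>G\<^esub> z)" by (simp add: e E_mult algebra_simps)
  show "\<one>\<^bsub>G\<^esub> \<otimes>\<^bsub>G\<^esub> x = x" by (simp add: e E_mult G_one)
  obtain t where t: "t \<in> H" "[h * t = 1] (mod int n)" using H_inverse[OF e(4)] by blast
  have "E (- (t * k)) t \<otimes>\<^bsub>G\<^esub> x = \<one>\<^bsub>G\<^esub>"
    unfolding e E_mult G_one using t by (intro E_cong) (simp_all add: mult.commute)
  then show "\<exists>y\<in>carrier G. y \<otimes>\<^bsub>G\<^esub> x = \<one>\<^bsub>G\<^esub>" using t by (intro bexI[of _ "E (- (t * k)) t"]) simp_all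
qed (simp add: G_one H_one)

lemma carrier_image: "carrier G = (\<lambda>(h, k). E k h) ` (residues H \<times> {0..<int n})"
proof (intro equalityI subsetI)
  fix x assume "x \<in> carrier G"
  then obtain k h where x: "x = E k h" "h \<in> H" by (rule carrierE)
  then have "x = E (k mod int n) (h mod int n)" by (simp add: E_eq_iff)
  moreover have "h mod int n \<in> residues H" using x n H_cong[of "h mod int n" h] by (simp add: residues_def cong_def)
  ultimately show "x \<in> (\<lambda>(h, k). E k h) ` (residues H \<times> {0..<int n})" using n
    by (intro image_eqI[of _ _ "(h mod int n, k mod int n)"]) simp_all
qed (auto simp: residues_def)

lemma finite_residues: "finite (residues B)"
  by (simp add: residues_def)

sublocale finite_group G
  by (rule finite_group.intro[OF group_G]) (simp add: finite_group_axioms_def carrier_image finite_residues)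

lemma inj_E: "inj_on (\<lambda>(h, k). E k h) (residues B \<times> {0..<int n})"
  by (rule inj_onI) (auto simp: E_eq_iff residues_def cong_def)

text \<open>The preimage in \<open>G\<close> of a set of units under the linear part.\<close>

definition above :: "int set \<Rightarrow> nat set" where
  "above B = {E k h | k h. h \<in> B}"

lemma inv_E: "h \<in> H \<Longrightarrow> t \<in> H \<Longrightarrow> [h * t = 1] (mod int n) \<Longrightarrow> inv\<^bsub>G\<^esub> (E k h) = E (- (t * k)) t"
  by (rule inv_equality) (simp_all add: E_mult G_one E_eq_iff mult.commute)

lemma inv_E1: "inv\<^bsub>G\<^esub> (E k 1) = E (- k) 1"
  using inv_E[of 1 1 k] H_one by simp

lemma conj_E:
  assumes "h \<in> H" "t \<in> H"
  shows "E l t \<otimes>\<^bsub>G\<^esub> E k h \<otimes>\<^bsub>G\<^esub> inv\<^bsub>G\<^esub> (E l t) = E (t * k + l - h * l) h"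
proof -
  obtain s where s: "s \<in> H" "[t * s = 1] (mod int n)" using H_inverse[OF assms(2)] by blast
  have "[t * h * (- (s * l)) = - (h * l)] (mod int n)"
  proof -
    have "[t * s * (- (h * l)) = 1 * (- (h * l))] (mod int n)" by (rule cong_mult[OF s(2) cong_refl])
    then show ?thesis by (simp add: mult_ac)
  qed
  then have "[l + t * k + t * h * (- (s * l)) = l + t * k + - (h * l)] (mod int n)" by (rule cong_add[OF cong_refl])
  then have 1: "[l + t * k + t * h * (- (s * l)) = t * k + l - h * l] (mod int n)" by (simp add: algebra_simps)
  have "[t * s * h = 1 * h] (mod int n)" by (rule cong_mult[OF s(2) cong_refl])
  then have 2: "[t * h * s = h] (mod int n)" by (simp add: mult_ac)
  show ?thesis unfolding inv_E[OF assms(2) s] E_mult by (rule E_cong[OF 1 2])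
qed

text \<open>Conjugation fixes the linear part; it moves the translation part by the multiples of
  \<open>1 - h\<close> and multiplies it by elements of \<open>H\<close>.\<close>

lemma conj_class_E: "h \<in> H \<Longrightarrow> conj_class G (E k h) = {E (t * k + l - h * l) h | t l. t \<in> H}"
proof (intro equalityI subsetI)
  assume h: "h \<in> H"
  fix y assume "y \<in> conj_class G (E k h)"
  then obtain g where g: "g \<in> carrier G" "y = g \<otimes>\<^bsub>G\<^esub> E k h \<otimes>\<^bsub>G\<^esub> inv\<^bsub>G\<^esub> g" by (auto simp: conj_class_def)
  obtain l t where "g = E l t" "t \<in> H" using g(1) by (rule carrierE)
  then show "y \<in> {E (t * k + l - h * l) h | t l. t \<in> H}" using g(2) conj_E[OF h] by auto
next
  assume h: "h \<in> H"
  fix y assume "y \<in> {E (t * k + l - h * l) h | t l. t \<in> H}"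
  then obtain t l where "y = E (t * k + l - h * l) h" "t \<in> H" by blast
  then show "y \<in> conj_class G (E k h)"
    unfolding conj_class_def using conj_E[OF h, of t l k] by (intro CollectI exI[of _ "E l t"]) simp
qed

lemma sum_above:
  fixes F :: "nat \<Rightarrow> complex"
  assumes "\<And>h k. [h = k] (mod int n) \<Longrightarrow> h \<in> B \<longleftrightarrow> k \<in> B"
  shows "(\<Sum>x\<in>above B. F x) = (\<Sum>h\<in>residues B. \<Sum>k\<in>{0..<int n}. F (E k h))"
    "card (above B) = n * card (residues B)"
proof -
  have im: "above B = (\<lambda>(h, k). E k h) ` (residues B \<times> {0..<int n})"
  proof (intro equalityI subsetI)
    fix x assume "x \<in> above B"
    then obtain k h where x: "x = E k h" "h \<in> B" by (auto simp: above_def)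
    then have "x = E (k mod int n) (h mod int n)" by (simp add: E_eq_iff)
    moreover have "h mod int n \<in> residues B" using x n assms[of "h mod int n" h] by (simp add: residues_def cong_def)
    ultimately show "x \<in> (\<lambda>(h, k). E k h) ` (residues B \<times> {0..<int n})" using n
      by (intro image_eqI[of _ _ "(h mod int n, k mod int n)"]) simp_all
  qed (auto simp: residues_def above_def)
  show "(\<Sum>x\<in>above B. F x) = (\<Sum>h\<in>residues B. \<Sum>k\<in>{0..<int n}. F (E k h))"
    unfolding im sum.reindex[OF inj_E] by (simp add: sum.cartesian_product case_prod_unfold)
  show "card (above B) = n * card (residues B)"
    unfolding im card_image[OF inj_E] by (simp add: card_cartesian_product)
qed

lemma carrier_above: "carrier G = above H"
  by (simp add: above_def affine_group_def)

lemma card_G: "card (carrier G) = n * card (residues H)"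
  unfolding carrier_above by (rule sum_above(2)[OF H_cong])

definition unit_subgroup :: "int set \<Rightarrow> bool" where
  "unit_subgroup B \<longleftrightarrow> B \<subseteq> H \<and> 1 \<in> B \<and> (\<forall>h\<in>B. \<forall>k\<in>B. h * k \<in> B) \<and>
     (\<forall>h k. [h = k] (mod int n) \<longrightarrow> h \<in> B \<longrightarrow> k \<in> B) \<and> (\<forall>h\<in>B. \<forall>k\<in>H. [h * k = 1] (mod int n) \<longrightarrow> k \<in> B)"

lemma unit_subgroup_cong: "unit_subgroup B \<Longrightarrow> [h = k] (mod int n) \<Longrightarrow> h \<in> B \<longleftrightarrow> k \<in> B"
  unfolding unit_subgroup_def by (metis cong_sym)

lemma E_in_above: "unit_subgroup B \<Longrightarrow> E k h \<in> above B \<longleftrightarrow> h \<in> B"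
proof
  assume B: "unit_subgroup B" and "E k h \<in> above B"
  then obtain k' h' where "E k h = E k' h'" "h' \<in> B" by (auto simp: above_def)
  then show "h \<in> B" using unit_subgroup_cong[OF B, of h h'] by (simp add: E_eq_iff)
qed (auto simp: above_def)

lemma unit_subgroupD:
  assumes "unit_subgroup B"
  shows "h \<in> B \<Longrightarrow> h \<in> H" "1 \<in> B" "h \<in> B \<Longrightarrow> k \<in> B \<Longrightarrow> h * k \<in> B"
    "h \<in> B \<Longrightarrow> k \<in> H \<Longrightarrow> [h * k = 1] (mod int n) \<Longrightarrow> k \<in> B"
  using assms unfolding unit_subgroup_def by blast+

lemma above_normal:
  assumes B: "unit_subgroup B"
  shows "finite_group_normal (above B) G"
proof -
  note BH = unit_subgroupD(1)[OF B]
  have sub: "subgroup (above B) G"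
  proof (rule subgroupI)
    show "above B \<subseteq> carrier G" using BH by (auto simp: above_def)
    show "above B \<noteq> {}" using unit_subgroupD(2)[OF B] by (auto simp: above_def)
    fix x assume "x \<in> above B"
    then obtain k h where x: "x = E k h" "h \<in> B" by (auto simp: above_def)
    obtain t where t: "t \<in> H" "[h * t = 1] (mod int n)" using H_inverse[OF BH[OF x(2)]] by blast
    then have "t \<in> B" using unit_subgroupD(4)[OF B x(2)] by simp
    then show "inv\<^bsub>G\<^esub> x \<in> above B" unfolding x(1) inv_E[OF BH[OF x(2)] t] by (simp add: E_in_above[OF B])
    fix y assume "y \<in> above B"
    then obtain k' h' where y: "y = E k' h'" "h' \<in> B" by (auto simp: above_def)
    show "x \<otimes>\<^bsub>G\<^esub> y \<in> above B" using unit_subgroupD(3)[OF B] x y by (simp add: E_mult E_in_above[OF B])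
  qed
  have conj: "g \<otimes>\<^bsub>G\<^esub> x \<otimes>\<^bsub>G\<^esub> inv\<^bsub>G\<^esub> g \<in> above B" if g: "g \<in> carrier G" and x: "x \<in> above B" for g x
  proof -
    obtain l t where "g = E l t" "t \<in> H" using g by (rule carrierE)
    moreover obtain k h where "x = E k h" "h \<in> B" using x by (auto simp: above_def)
    ultimately show ?thesis using conj_E[OF BH, of h t l k] by (simp add: E_in_above[OF B])
  qed
  show ?thesis
    by (intro finite_group_normal.intro finite_group_subgroup.intro finite_group_axioms sub finite_group_normal_axioms.intro conj)
qed

lemma card_above: "unit_subgroup B \<Longrightarrow> card (above B) = n * card (residues B)"
  by (rule sum_above(2)[OF unit_subgroup_cong])

lemma sum_G: "(\<Sum>x\<in>carrier G. F x) = (\<Sum>t\<in>residues H. \<Sum>l\<in>{0..<int n}. F (E l t))" for F :: "nat \<Rightarrow> complex"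
  unfolding carrier_above by (rule sum_above(1)[OF H_cong])

definition trivial_units :: "int set" where
  "trivial_units = {h. [h = 1] (mod int n)}"

lemma trivial_units_subgroup: "unit_subgroup trivial_units"
  unfolding unit_subgroup_def
proof (intro conjI ballI allI impI)
  show "trivial_units \<subseteq> H" using H_cong H_one by (auto simp: trivial_units_def)
  show "h * k \<in> trivial_units" if "h \<in> trivial_units" "k \<in> trivial_units" for h k
    using cong_mult[of h 1 "int n" k 1] that by (simp add: trivial_units_def)
  show "k \<in> trivial_units" if "[h = k] (mod int n)" "h \<in> trivial_units" for h k
    using that cong_sym cong_trans unfolding trivial_units_def by blast
  show "k \<in> trivial_units" if "h \<in> trivial_units" "[h * k = 1] (mod int n)" for h k
  proof -
    have "[h * k = 1 * k] (mod int n)" using that(1) by (intro cong_mult cong_refl) (simp add: trivial_units_def)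
    then have "[1 * k = 1] (mod int n)" using that(2) cong_sym cong_trans by blast
    then show ?thesis by (simp add: trivial_units_def)
  qed
qed (simp add: trivial_units_def)

lemma card_trivial_units: "card (residues trivial_units) = 1"
proof -
  have "residues trivial_units = {1 mod int n}"
    using n by (auto simp: residues_def trivial_units_def cong_def)
  then show ?thesis by simp
qed

sublocale C: finite_group_normal "above trivial_units" G
  by (rule above_normal[OF trivial_units_subgroup])

lemma card_C: "card (above trivial_units) = n"
  using card_above[OF trivial_units_subgroup] card_trivial_units by simp

lemma E_in_C: "E k h \<in> above trivial_units \<longleftrightarrow> [h = 1] (mod int n)"
  unfolding E_in_above[OF trivial_units_subgroup] by (simp add: trivial_units_def)

text \<open>The character \<open>k \<mapsto> \<zeta>\<^bsup>jk\<^esup>\<close> of the group of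
  translations.\<close>

definition lam :: "int \<Rightarrow> nat \<Rightarrow> complex" where
  "lam j x = (if x \<in> above trivial_units then zeta n (j * int (fst (prod_decode x))) else 0)"

lemma lam_E: "lam j (E k h) = (if [h = 1] (mod int n) then zeta n (j * k) else 0)"
proof -
  have "zeta n (j * int (fst (prod_decode (E k h)))) = zeta n (j * k)"
    by (intro zeta_cong[OF n] cong_mult cong_refl decode_E)
  then show ?thesis by (simp add: lam_def E_in_C)
qed

lemma lam_cong: "[i = j] (mod int n) \<Longrightarrow> lam i = lam j"
  by (rule ext) (simp add: lam_def zeta_cong[OF n cong_mult[OF _ cong_refl]])

lemma C_E: "x \<in> above trivial_units \<Longrightarrow> \<exists>k. x = E k 1"
proof -
  assume "x \<in> above trivial_units"
  then obtain k h where "x = E k h" "[h = 1] (mod int n)" by (auto simp: above_def trivial_units_def)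
  then have "x = E k 1" using E_cong[OF cong_refl, of h 1 k] by simp
  then show ?thesis by blast
qed

lemma lam_lin_char: "lin_char G (above trivial_units) (lam j)"
  unfolding lin_char_def
proof (intro conjI ballI allI impI)
  fix x assume x: "x \<in> above trivial_units"
  obtain k where k: "x = E k 1" using C_E[OF x] by (elim exE)
  show "lam j x \<noteq> 0" by (simp add: k lam_E)
  fix y assume y: "y \<in> above trivial_units"
  obtain l where l: "y = E l 1" using C_E[OF y] by (elim exE)
  show "lam j (x \<otimes>\<^bsub>G\<^esub> y) = lam j x * lam j y"
    by (simp add: k l E_mult lam_E zeta_add ring_distribs)
qed (simp add: lam_def)

lemma lin_char_above_E:
  assumes B: "unit_subgroup B" and \<theta>: "lin_char G (above B) \<theta>" "\<And>x. x \<in> above trivial_units \<Longrightarrow> \<theta> x = lam j x"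
  shows "\<theta> (E k h) = zeta n (j * k) * \<theta> (E 0 h)"
proof (cases "h \<in> B")
  case True
  note B1 = unit_subgroupD(2)[OF B]
  have "\<theta> (E k 1 \<otimes>\<^bsub>G\<^esub> E 0 h) = \<theta> (E k 1) * \<theta> (E 0 h)"
    using True B1 by (intro lin_charD(1)[OF \<theta>(1)]) (simp_all add: E_in_above[OF B])
  moreover have "\<theta> (E k 1) = zeta n (j * k)"
    using \<theta>(2)[of "E k 1"] by (simp add: E_in_C lam_E)
  ultimately show ?thesis by (simp add: E_mult)
next
  case False
  then show ?thesis using lin_charD(3)[OF \<theta>(1)] by (simp add: E_in_above[OF B])
qed

text \<open>If \<open>B\<close> fixes \<open>\<lambda>\<^sub>j\<close>, then the value of
  \<open>\<theta>\<close> at a conjugate of \<open>x \<mapsto> h x + k\<close> does not depend on the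
  translation by which one conjugates, so only the sum over \<open>H\<close> remains.\<close>

lemma induced_above_E:
  assumes B: "unit_subgroup B" and \<theta>: "lin_char G (above B) \<theta>" "\<And>x. x \<in> above trivial_units \<Longrightarrow> \<theta> x = lam j x"
    and Bj: "\<And>h. h \<in> B \<Longrightarrow> [j * h = j] (mod int n)" and h: "h \<in> H"
  shows "induced G (above B) \<theta> (E k h) = \<theta> (E 0 h) * (\<Sum>t\<in>residues H. zeta n (j * t * k)) / of_nat (card (residues B))"
proof -
  have "(\<Sum>x\<in>carrier G. \<theta> (x \<otimes>\<^bsub>G\<^esub> E k h \<otimes>\<^bsub>G\<^esub> inv\<^bsub>G\<^esub> x))
      = (\<Sum>t\<in>residues H. \<Sum>l\<in>{0..<int n}. zeta n (j * t * k) * \<theta> (E 0 h))"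
    unfolding sum_G
  proof (intro sum.cong refl)
    fix t l assume "t \<in> residues H"
    then have t: "t \<in> H" by (simp add: residues_def)
    show "\<theta> (E l t \<otimes>\<^bsub>G\<^esub> E k h \<otimes>\<^bsub>G\<^esub> inv\<^bsub>G\<^esub> (E l t)) = zeta n (j * t * k) * \<theta> (E 0 h)"
    proof (cases "h \<in> B")
      case True
      have "[j * t * k + j * l - j * h * l = j * t * k + j * l - j * l] (mod int n)"
        by (intro cong_diff cong_refl cong_mult Bj[OF True])
      then have "zeta n (j * (t * k + l - h * l)) = zeta n (j * t * k)"
        by (intro zeta_cong[OF n]) (simp add: algebra_simps)
      then show ?thesis
        by (simp only: conj_E[OF h t] lin_char_above_E[OF B \<theta>, of "t * k + l - h * l" h])
    next
      case False
      then show ?thesis unfolding conj_E[OF h t] using lin_charD(3)[OF \<theta>(1)] by (simp add: E_in_above[OF B])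
    qed
  qed
  also have "\<dots> = of_nat n * (\<theta> (E 0 h) * (\<Sum>t\<in>residues H. zeta n (j * t * k)))"
    using n by (simp add: sum_distrib_left mult_ac)
  finally show ?thesis using h n by (simp add: induced_def card_above[OF B])
qed

lemma induced_lam_E:
  assumes "h \<in> H"
  shows "induced G (above trivial_units) (lam j) (E k h) = (if [h = 1] (mod int n) then \<Sum>t\<in>residues H. zeta n (j * t * k) else 0)"
proof -
  have "[j * h = j] (mod int n)" if "h \<in> trivial_units" for h
    using cong_mult[of j j "int n" h 1] that by (simp add: trivial_units_def)
  from induced_above_E[OF trivial_units_subgroup lam_lin_char _ this assms, where k = k] show ?thesis
    using card_trivial_units by (simp add: lam_E)
qed

text \<open>The translation by one separates the characters \<open>\<lambda>\<^sub>j\<close>, so an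
  element of \<open>G\<close> fixing \<open>\<theta>\<close> has its linear part in the stabilizer of
  \<open>j\<close>.\<close>

lemma stabilizer_condition:
  assumes B: "unit_subgroup B" and \<theta>: "\<And>x. x \<in> above trivial_units \<Longrightarrow> \<theta> x = lam j x"
    and stab: "\<And>t. t \<in> H \<Longrightarrow> [j * t = j] (mod int n) \<Longrightarrow> t \<in> B"
    and g: "g \<in> carrier G - above B"
  shows "\<exists>x\<in>above B. \<theta> (g \<otimes>\<^bsub>G\<^esub> x \<otimes>\<^bsub>G\<^esub> inv\<^bsub>G\<^esub> g) \<noteq> \<theta> x"
proof -
  have E1: "E k 1 \<in> above trivial_units" for k by (simp add: E_in_C)
  obtain l t where lt: "g = E l t" "t \<in> H" using g by (auto elim: carrierE)
  then have "t \<notin> B" using g by (simp add: E_in_above[OF B])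
  then have "zeta n (j * t) \<noteq> zeta n j" using stab[OF lt(2)] by (auto simp: zeta_eq_iff[OF n])
  moreover have "g \<otimes>\<^bsub>G\<^esub> E 1 1 \<otimes>\<^bsub>G\<^esub> inv\<^bsub>G\<^esub> g = E t 1" unfolding lt(1) conj_E[OF H_one lt(2)] by simp
  ultimately show ?thesis using \<theta>[OF E1] by (intro bexI[of _ "E 1 1"]) (simp_all add: lam_E E_in_above[OF B] unit_subgroupD(2)[OF B])
qed

text \<open>Proportional orbit sums of linear characters belong to the same orbit: take the Fourier
  coefficient of both sides at \<open>\<lambda>\<^sub>j\<close>.\<close>

lemma trace_orthogonality:
  assumes eq: "\<And>k. (\<Sum>t\<in>residues H. zeta n (i * t * k)) = c * (\<Sum>t\<in>residues H. zeta n (j * t * k))" and c: "c \<noteq> 0"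
  obtains t where "t \<in> H" "[i * t = j] (mod int n)"
proof -
  have S: "(\<Sum>k\<in>{0..<int n}. zeta n (- (j * k)) * (\<Sum>t\<in>residues H. zeta n (i * t * k)))
      = of_nat n * of_nat (card {t \<in> residues H. [i * t = j] (mod int n)})" for i
  proof -
    have "(\<Sum>k\<in>{0..<int n}. zeta n (- (j * k)) * (\<Sum>t\<in>residues H. zeta n (i * t * k)))
        = (\<Sum>t\<in>residues H. \<Sum>k\<in>{0..<int n}. zeta n ((i * t - j) * k))"
      by (subst sum.swap) (simp add: sum_distrib_left algebra_simps flip: zeta_add)
    also have "\<dots> = (\<Sum>t\<in>residues H. if [i * t = j] (mod int n) then of_nat n else 0)"
      by (simp add: sum_zeta[OF n] cong_iff_dvd_diff)
    finally show ?thesis by (simp add: sum.If_cases[OF finite_residues] Int_def)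
  qed
  have "1 mod int n \<in> {t \<in> residues H. [j * t = j] (mod int n)}"
    using n H_one H_cong[of "1 mod int n" 1] by (auto simp: residues_def cong_def mod_mult_right_eq)
  moreover have "finite {t \<in> residues H. [j * t = j] (mod int n)}" using finite_residues by simp
  ultimately have "card {t \<in> residues H. [j * t = j] (mod int n)} \<noteq> 0" by (metis card_0_eq empty_iff)
  moreover have "of_nat n * of_nat (card {t \<in> residues H. [i * t = j] (mod int n)})
      = c * (of_nat n * of_nat (card {t \<in> residues H. [j * t = j] (mod int n)}) :: complex)"
    unfolding S[symmetric] eq by (simp add: sum_distrib_left mult_ac)
  ultimately have "card {t \<in> residues H. [i * t = j] (mod int n)} \<noteq> 0" using c n by (intro notI) simp
  then have "{t \<in> residues H. [i * t = j] (mod int n)} \<noteq> {}" by (intro notI) (simp only: card.empty)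
  then obtain t where "t \<in> residues H" "[i * t = j] (mod int n)" by blast
  then show ?thesis using that[of t] by (simp add: residues_def)
qed

lemma bij_betw_residues:
  assumes B: "unit_subgroup B" and h: "h \<in> B"
  shows "bij_betw (\<lambda>k. (h * k) mod int n) (residues B) (residues B)"
  unfolding residues_def
proof (rule bij_betw_mult_residues[OF n])
  show "k * l \<in> B" if "k \<in> B" "l \<in> B" for k l by (rule unit_subgroupD(3)[OF B that])
  show "k \<in> B \<longleftrightarrow> l \<in> B" if "[k = l] (mod int n)" for k l by (rule unit_subgroup_cong[OF B that])
  show "h \<in> B" by (rule h)
  show "coprime h (int n)" by (rule H_coprime[OF unit_subgroupD(1)[OF B h]])
qed

lemma card_coset:
  assumes B: "unit_subgroup B" and t: "t \<in> H"
  shows "card {r \<in> residues H. \<exists>h\<in>B. [r = t * h] (mod int n)} = card (residues B)"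
proof -
  have "inj_on (\<lambda>h. (t * h) mod int n) (residues B)"
  proof (rule inj_onI)
    fix h k assume hk: "h \<in> residues B" "k \<in> residues B" "(t * h) mod int n = (t * k) mod int n"
    then have "[t * h = t * k] (mod int n)" by (simp only: cong_def)
    then have "[h = k] (mod int n)" using H_coprime[OF t] by (simp only: cong_mult_lcancel)
    then show "h = k" using hk by (simp add: residues_def cong_def)
  qed
  moreover have "(\<lambda>h. (t * h) mod int n) ` residues B = {r \<in> residues H. \<exists>h\<in>B. [r = t * h] (mod int n)}"
  proof (intro equalityI subsetI)
    fix r assume "r \<in> (\<lambda>h. (t * h) mod int n) ` residues B"
    then obtain h where h: "h \<in> B" "r = (t * h) mod int n" by (auto simp: residues_def)
    have c: "[r = t * h] (mod int n)" by (simp add: h(2) cong_def)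
    then have "r \<in> H" using H_cong[OF c] H_mult[OF t unit_subgroupD(1)[OF B h(1)]] by simp
    then have "r \<in> residues H" using n h(2) by (simp add: residues_def)
    then show "r \<in> {r \<in> residues H. \<exists>h\<in>B. [r = t * h] (mod int n)}" using c h(1) by blast
  next
    fix r assume "r \<in> {r \<in> residues H. \<exists>h\<in>B. [r = t * h] (mod int n)}"
    then obtain h where r: "r \<in> {0..<int n}" and h: "h \<in> B" "[r = t * h] (mod int n)" by (auto simp: residues_def)
    have hh: "[h mod int n = h] (mod int n)" by (simp add: cong_def)
    have "h mod int n \<in> residues B" using unit_subgroup_cong[OF B hh] h(1) n by (simp add: residues_def)
    moreover have "r = (t * (h mod int n)) mod int n"
    proof -
      have "(t * (h mod int n)) mod int n = (t * h) mod int n" by (rule mod_mult_right_eq)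
      also have "\<dots> = r mod int n" using h(2) by (simp only: cong_def)
      also have "\<dots> = r" using r by simp
      finally show ?thesis ..
    qed
    ultimately show "r \<in> (\<lambda>h. (t * h) mod int n) ` residues B" by (rule image_eqI[rotated])
  qed
  ultimately show ?thesis by (metis card_image)
qed

lemma H_subgroup: "unit_subgroup H"
  unfolding unit_subgroup_def
proof (intro conjI ballI allI impI)
  show "k \<in> H" if "[h = k] (mod int n)" "h \<in> H" for h k using H_cong[OF that(1)] that(2) by simp
qed (simp_all add: H_one H_mult)

lemma sum_residues_mult:
  assumes h: "h \<in> H"
  shows "(\<Sum>t\<in>residues H. zeta n (j * h * t * k)) = (\<Sum>t\<in>residues H. zeta n (j * t * k))"
proof -
  have "(\<Sum>t\<in>residues H. zeta n (j * h * t * k)) = (\<Sum>t\<in>residues H. zeta n (j * ((h * t) mod int n) * k))"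
  proof (intro sum.cong refl zeta_cong[OF n])
    fix t
    have "[j * (h * t) * k = j * ((h * t) mod int n) * k] (mod int n)"
      by (intro cong_mult cong_refl) (simp add: cong_def)
    then show "[j * h * t * k = j * ((h * t) mod int n) * k] (mod int n)" by (simp add: mult_ac)
  qed
  also have "\<dots> = (\<Sum>t\<in>residues H. zeta n (j * t * k))"
    by (rule sum.reindex_bij_betw[OF bij_betw_residues[OF H_subgroup h]])
  finally show ?thesis .
qed

text \<open>The linear parts commute, so commutators are translations, and translations commute.\<close>

lemma solvable_G: "solvable G"
proof -
  have C: "subgroup (above trivial_units) G" by (rule C.subgroup_axioms)
  have "derived G (carrier G) \<subseteq> above trivial_units"
    unfolding derived_def
  proof (rule generate_subgroup_incl[OF _ C])
    show "derived_set G (carrier G) \<subseteq> above trivial_units"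
    proof
      fix z assume "z \<in> derived_set G (carrier G)"
      then obtain x y where xy: "x \<in> carrier G" "y \<in> carrier G" "z = x \<otimes>\<^bsub>G\<^esub> y \<otimes>\<^bsub>G\<^esub> inv\<^bsub>G\<^esub> x \<otimes>\<^bsub>G\<^esub> inv\<^bsub>G\<^esub> y" by blast
      obtain k h where x: "x = E k h" "h \<in> H" using xy(1) by (rule carrierE)
      obtain l t where y: "y = E l t" "t \<in> H" using xy(2) by (rule carrierE)
      obtain u where u: "u \<in> H" "[t * u = 1] (mod int n)" using H_inverse[OF y(2)] by blast
      obtain v where v: "v \<in> H" "[h * v = 1] (mod int n)" using H_inverse[OF x(2)] by blast
      have "\<exists>w. z = E w (h * t * v * u)" 
        unfolding xy(3) unfolding x(1) y(1) unfolding inv_E[OF x(2) v] inv_E[OF y(2) u] unfolding E_mult by blast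
      moreover have "[h * t * v * u = 1] (mod int n)"
        using cong_mult[OF u(2) v(2)] by (simp add: mult_ac)
      ultimately show "z \<in> above trivial_units" by (auto simp: E_in_C)
    qed
  qed
  moreover have "derived G (above trivial_units) \<subseteq> {\<one>\<^bsub>G\<^esub>}"
    unfolding derived_def
  proof (rule generate_subgroup_incl)
    show "subgroup {\<one>\<^bsub>G\<^esub>} G" by (rule triv_subgroup)
    show "derived_set G (above trivial_units) \<subseteq> {\<one>\<^bsub>G\<^esub>}"
    proof
      fix z assume "z \<in> derived_set G (above trivial_units)"
      then obtain x y where xy: "x \<in> above trivial_units" "y \<in> above trivial_units" "z = x \<otimes>\<^bsub>G\<^esub> y \<otimes>\<^bsub>G\<^esub> inv\<^bsub>G\<^esub> x \<otimes>\<^bsub>G\<^esub> inv\<^bsub>G\<^esub> y" by blast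
      obtain k where x: "x = E k 1" using C_E[OF xy(1)] by (elim exE)
      obtain l where y: "y = E l 1" using C_E[OF xy(2)] by (elim exE)
      show "z \<in> {\<one>\<^bsub>G\<^esub>}" unfolding xy(3) x y by (simp add: inv_E1 E_mult G_one)
    qed
  qed
  ultimately have "(derived G ^^ 2) (carrier G) \<subseteq> {\<one>\<^bsub>G\<^esub>}"
    using mono_derived[of "derived G (carrier G)" "above trivial_units"] by (simp add: numeral_2_eq_2)
  moreover have "\<one>\<^bsub>G\<^esub> \<in> (derived G ^^ 2) (carrier G)"
    by (rule subgroup.one_closed[OF exp_of_derived_is_subgroup[OF subgroup_self]])
  ultimately have "(derived G ^^ 2) (carrier G) = {\<one>\<^bsub>G\<^esub>}" by blast
  then show ?thesis unfolding solvable_def by (rule trivial_derived_seq_imp_solvable[OF subgroup_self])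
qed

end

section \<open>The units congruent to one modulo \<open>m\<close>\<close>

text \<open>For \<open>H\<close> the Galois group over \<open>F\<close>, the last assumption is the
  hypothesis on the degree of \<open>\<rat>\<^sub>n\<close> over \<open>\<langle>F,
  \<rat>\<^sub>m\<rangle>\<close>.\<close>

locale block_data = unit_group +
  fixes p a m :: nat
  assumes p: "prime p" and nam: "n = p ^ a * m" and pm: "\<not> p dvd m"
    and pA: "\<not> p dvd card (H \<inter> {h. [h = 1] (mod int m)} \<inter> {0..<int n})"
begin

definition A :: "int set" where
  "A = H \<inter> {h. [h = 1] (mod int m)}"

lemma pA': "\<not> p dvd card (residues A)"
  using pA by (simp add: A_def residues_def)

lemma m0: "0 < m" and q0: "0 < p ^ a" and p0: "0 < p"
  using n nam p by (auto simp: prime_gt_0_nat)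

lemma int_n: "int n = int (p ^ a) * int m"
  using nam by simp

lemma coprime_pm: "coprime (int (p ^ a)) (int m)"
proof -
  have "coprime p m" using p pm by (simp add: prime_imp_coprime)
  then have "coprime (p ^ a) m" by simp
  then show ?thesis by (simp only: coprime_int_iff)
qed

lemma dvd_n_iff: "int n dvd x \<longleftrightarrow> int (p ^ a) dvd x \<and> int m dvd x"
  unfolding int_n using divides_mult[OF _ _ coprime_pm, of x] dvd_mult_left dvd_mult_right by blast

lemma cong_n_iff: "[x = y] (mod int n) \<longleftrightarrow> [x = y] (mod int (p ^ a)) \<and> [x = y] (mod int m)"
  by (simp only: cong_iff_dvd_diff dvd_n_iff)

lemma A_subset: "h \<in> A \<Longrightarrow> h \<in> H" "h \<in> A \<Longrightarrow> [h = 1] (mod int m)"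
  by (simp_all add: A_def)

lemma A_I: "h \<in> H \<Longrightarrow> [h = 1] (mod int m) \<Longrightarrow> h \<in> A"
  by (simp add: A_def)

lemma A_subgroup: "unit_subgroup A"
  unfolding unit_subgroup_def
proof (intro conjI ballI allI impI)
  show "A \<subseteq> H" by (auto simp: A_def)
  show "1 \<in> A" by (simp add: A_def H_one)
  show "h * k \<in> A" if "h \<in> A" "k \<in> A" for h k
    using cong_mult[OF A_subset(2)[OF that(1)] A_subset(2)[OF that(2)]] H_mult[OF A_subset(1)[OF that(1)] A_subset(1)[OF that(2)]]
    by (intro A_I) simp_all
  show "k \<in> A" if "[h = k] (mod int n)" "h \<in> A" for h k
  proof (rule A_I)
    show "k \<in> H" using H_cong[OF that(1)] A_subset(1)[OF that(2)] by simp
    have "[h = k] (mod int m)" using that(1) unfolding cong_n_iff by blast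
    then show "[k = 1] (mod int m)" using A_subset(2)[OF that(2)] cong_sym cong_trans by blast
  qed
  show "k \<in> A" if "h \<in> A" "k \<in> H" "[h * k = 1] (mod int n)" for h k
  proof (rule A_I[OF that(2)])
    have "[h * k = 1 * k] (mod int m)" by (rule cong_mult[OF A_subset(2)[OF that(1)] cong_refl])
    moreover have "[h * k = 1] (mod int m)" using that(3) unfolding cong_n_iff by blast
    ultimately have "[1 * k = 1] (mod int m)" using cong_sym cong_trans by blast
    then show "[k = 1] (mod int m)" by simp
  qed
qed

lemma cong_one_power_p:
  assumes "[t = 1] (mod int p)"
  shows "[t ^ (p ^ i) = 1] (mod int (p ^ i))"
proof -
  have "[t ^ (p ^ i) = 1] (mod int (p ^ Suc i))"
  proof (induction i)
    case 0
    then show ?case using assms by simp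
  next
    case (Suc i)
    let ?u = "t ^ (p ^ i)"
    have u: "int (p ^ Suc i) dvd ?u - 1" using Suc by (simp only: cong_iff_dvd_diff)
    have "[?u = 1] (mod int p)" using cong_pow[OF assms, of "p ^ i"] by simp
    then have "[(\<Sum>k<p. ?u ^ k) = (\<Sum>k<p. 1 ^ k)] (mod int p)" by (intro cong_sum cong_pow)
    then have "int p dvd (\<Sum>k<p. ?u ^ k)" by (simp add: cong_dvd_iff)
    then have "int (p ^ Suc i) * int p dvd (?u - 1) * (\<Sum>k<p. ?u ^ k)" by (rule mult_dvd_mono[OF u])
    also have "(?u - 1) * (\<Sum>k<p. ?u ^ k) = ?u ^ p - 1" by (rule power_diff_1_eq[symmetric])
    also have "?u ^ p = t ^ (p ^ Suc i)" by (simp flip: power_mult add: mult.commute)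
    finally show ?case by (simp add: cong_iff_dvd_diff mult.commute)
  qed
  then show ?thesis by (rule cong_dvd_modulus) simp
qed

lemma A_power_card:
  assumes t: "t \<in> A"
  shows "[t ^ card (residues A) = 1] (mod int n)"
proof -
  let ?R = "residues A"
  have "(\<Prod>k\<in>?R. (t * k) mod int n) = \<Prod>?R"
    using prod.reindex_bij_betw[OF bij_betw_residues[OF A_subgroup t], of "\<lambda>x. x"] by simp
  moreover have "[(\<Prod>k\<in>?R. (t * k) mod int n) = (\<Prod>k\<in>?R. t * k)] (mod int n)"
    by (intro cong_prod) (simp add: cong_def)
  ultimately have "[t ^ card ?R * \<Prod>?R = 1 * \<Prod>?R] (mod int n)"
    by (simp add: prod.distrib cong_sym)
  moreover have "coprime (\<Prod>?R) (int n)"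
    by (rule prod_coprime_left) (auto simp: residues_def intro: H_coprime A_subset(1))
  ultimately show ?thesis by (simp only: cong_mult_rcancel)
qed

text \<open>The order of \<open>t\<close> divides \<open>|A|\<close>, which is prime to
  \<open>p\<close>, and it is a power of \<open>p\<close> because \<open>t\<close> is one modulo
  \<open>p\<close>.\<close>

lemma A_trivial:
  assumes t: "t \<in> A" and tp: "[t = 1] (mod int p)"
  shows "[t = 1] (mod int n)"
proof -
  let ?u = "p ^ a" and ?v = "card (residues A)"
  have 1: "[t ^ ?u = 1] (mod int n)"
    unfolding cong_n_iff using cong_one_power_p[OF tp, of a] cong_pow[OF A_subset(2)[OF t], of ?u] by simp
  have "coprime ?u ?v" using p pA' by (simp add: prime_imp_coprime)
  then obtain x y where xy: "?u * x = ?v * y + 1" using bezout_nat[of ?u ?v] q0 by auto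
  have "[(t ^ ?u) ^ x = 1 ^ x] (mod int n)" "[(t ^ ?v) ^ y = 1 ^ y] (mod int n)"
    by (intro cong_pow 1 A_power_card[OF t])+
  then have 2: "[t ^ (?u * x) = 1] (mod int n)" "[t ^ (?v * y) = 1] (mod int n)"
    by (simp_all only: power_mult power_one)
  have "[t ^ (?v * y) * t = 1 * t] (mod int n)" by (rule cong_mult[OF 2(2) cong_refl])
  then have "[t ^ (?v * y + 1) = t] (mod int n)" by (simp add: mult.commute)
  then have "[t ^ (?u * x) = t] (mod int n)" by (simp only: xy)
  then show ?thesis using 2(1) cong_sym cong_trans by blast
qed

lemma A_minus_one:
  assumes t: "t \<in> A" and nt: "\<not> [t = 1] (mod int n)"
  shows "coprime (t - 1) (int (p ^ a))"
proof -
  have "\<not> [t = 1] (mod int p)" using A_trivial[OF t] nt by blast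
  then have "\<not> int p dvd t - 1" by (simp only: cong_iff_dvd_diff not_False_eq_True)
  moreover have "prime (int p)" using p by simp
  ultimately have "coprime (int p) (t - 1)" by (intro prime_imp_coprime)
  then show ?thesis by (simp add: coprime_commute)
qed

text \<open>The label of the linear character of \<open>C\<close> that agrees with
  \<open>\<lambda>\<^sub>1\<close> on the \<open>p'\<close>-part and is trivial on the
  \<open>p\<close>-part.\<close>

definition eps :: int where
  "eps = (SOME x. [x = 1] (mod int m) \<and> [x = 0] (mod int (p ^ a)))"

lemma eps: "[eps = 1] (mod int m)" "[eps = 0] (mod int (p ^ a))"
proof -
  have "coprime (int m) (int (p ^ a))" using coprime_pm by (simp add: coprime_commute)
  then obtain x where "[x = 1] (mod int m) \<and> [x = 0] (mod int (p ^ a))"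
    using binary_chinese_remainder_int by blast
  then have "[eps = 1] (mod int m) \<and> [eps = 0] (mod int (p ^ a))" unfolding eps_def by (rule someI)
  then show "[eps = 1] (mod int m)" "[eps = 0] (mod int (p ^ a))" by auto
qed

lemma eps_unique: "[j = 1] (mod int m) \<Longrightarrow> int (p ^ a) dvd j \<Longrightarrow> [j = eps] (mod int n)"
  unfolding cong_n_iff using eps cong_sym cong_trans cong_0_iff by blast

lemma eps_A: "h \<in> A \<Longrightarrow> [eps * h = eps] (mod int n)"
proof -
  assume h: "h \<in> A"
  have "[eps * h = eps * 1] (mod int m)" by (rule cong_mult[OF cong_refl A_subset(2)[OF h]])
  moreover have "[eps * h = 0 * h] (mod int (p ^ a))" by (rule cong_mult[OF eps(2) cong_refl])
  ultimately show ?thesis unfolding cong_n_iff using eps(2) by (auto intro: cong_trans cong_sym)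
qed

lemma stab_eps: "t \<in> H \<Longrightarrow> [eps * t = eps] (mod int n) \<Longrightarrow> t \<in> A"
proof (rule A_I)
  assume "t \<in> H" "[eps * t = eps] (mod int n)"
  then have "[eps * t = eps] (mod int m)" unfolding cong_n_iff by blast
  moreover have "[eps * t = 1 * t] (mod int m)" by (rule cong_mult[OF eps(1) cong_refl])
  ultimately show "[t = 1] (mod int m)" using eps(1) cong_sym cong_trans by (metis mult_1)
qed

text \<open>A unit fixing \<open>j\<close> is one modulo \<open>m\<close>, so it lies in
  \<open>A\<close>. If it were nontrivial, \<open>j (t - 1) \<equiv> 0\<close> modulo
  \<open>p\<^sup>a\<close> with \<open>t - 1\<close> a unit would force \<open>p\<^sup>a\<close> to
  divide \<open>j\<close>.\<close>

lemma stab_J: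
  assumes j: "[j = 1] (mod int m)" "\<not> int (p ^ a) dvd j" and t: "t \<in> H" "[j * t = j] (mod int n)"
  shows "t \<in> trivial_units"
proof -
  have "[j * t = j] (mod int m)" using t(2) unfolding cong_n_iff by blast
  moreover have "[j * t = 1 * t] (mod int m)" by (rule cong_mult[OF j(1) cong_refl])
  ultimately have "[t = 1] (mod int m)" using j(1) cong_sym cong_trans by (metis mult_1)
  then have tA: "t \<in> A" by (rule A_I[OF t(1)])
  have "[t = 1] (mod int n)"
  proof (rule ccontr)
    assume "\<not> ?thesis"
    then have c: "coprime (t - 1) (int (p ^ a))" by (rule A_minus_one[OF tA])
    have "[j * t = j] (mod int (p ^ a))" using t(2) unfolding cong_n_iff by blast
    then have "int (p ^ a) dvd j * t - j" by (simp only: cong_iff_dvd_diff)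
    also have "j * t - j = j * (t - 1)" by (simp add: right_diff_distrib)
    finally have "int (p ^ a) dvd j * (t - 1)" .
    moreover have "coprime (int (p ^ a)) (t - 1)" using c by (simp only: coprime_commute)
    ultimately show False using j(2) by (simp only: coprime_dvd_mult_left_iff)
  qed
  then show ?thesis by (simp add: trivial_units_def)
qed

lemma stab_1: "t \<in> H \<Longrightarrow> [1 * t = 1] (mod int n) \<Longrightarrow> t \<in> trivial_units"
  by (simp add: trivial_units_def)

text \<open>Reduction modulo \<open>p\<close> embeds \<open>A\<close> into the cyclic group of units
  modulo \<open>p\<close>. The discrete logarithm with respect to a primitive root \<open>g\<close>
  turns the \<open>(p - 1)\<close>-th roots of unity into a faithful character.\<close>

lemma faithful_character_of_A:
  obtains \<mu> :: "int \<Rightarrow> complex" where "\<And>h. \<mu> h \<noteq> 0" "\<And>h k. h \<in> A \<Longrightarrow> k \<in> A \<Longrightarrow> \<mu> (h * k) = \<mu> h * \<mu> k"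
    "\<And>h. h \<in> A \<Longrightarrow> \<mu> h = 1 \<longleftrightarrow> [h = 1] (mod int n)" "\<And>h k. [h = k] (mod int n) \<Longrightarrow> \<mu> h = \<mu> k"
proof (cases "a = 0")
  case True
  have "[h = 1] (mod int n)" if "h \<in> A" for h using A_subset(2)[OF that] True nam by simp
  then show ?thesis using that[of "\<lambda>_. 1"] by simp
next
  case False
  have pn: "p dvd n" using False nam by simp
  then have pnI: "int p dvd int n" by (simp only: int_dvd_int_iff)
  obtain g where g: "residue_primroot p g" using prime_primitive_root_exists[OF prime_gt_1_nat[OF p] p] by (elim exE)
  have gp: "coprime p g" "Pocklington.ord p g = p - 1"
    using g unfolding residue_primroot_def totient_prime[OF p] by blast+
  have p1: "0 < p - 1" using prime_gt_1_nat[OF p] by simp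
  define dlog where "dlog h = (SOME i. [h = int (g ^ i)] (mod int p))" for h :: int
  have ex: "\<exists>i. [h = int (g ^ i)] (mod int p)" if h: "h \<in> A" for h
  proof -
    have "coprime h (int n)" by (rule H_coprime[OF A_subset(1)[OF h]])
    then have hp: "coprime h (int p)" by (rule coprime_divisors[OF dvd_refl pnI])
    have hh: "[int (nat (h mod int p)) = h] (mod int p)"
    proof -
      have "0 \<le> h mod int p" using p0 by simp
      then have "int (nat (h mod int p)) = h mod int p" by (rule nat_0_le)
      then show ?thesis by (simp only: cong_def mod_mod_trivial)
    qed
    have "coprime (int (nat (h mod int p))) (int p)" by (rule cong_imp_coprime[OF cong_sym[OF hh] hp])
    then have c: "coprime (nat (h mod int p)) p" by (rule coprime_int_iff[THEN iffD1])
    have "nat (h mod int p) \<noteq> 0"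
    proof
      assume "nat (h mod int p) = 0"
      then show False using c prime_gt_1_nat[OF p] by simp
    qed
    moreover have "nat (h mod int p) < p" using p0 by (simp add: nat_less_iff)
    ultimately have "nat (h mod int p) \<in> totatives p" using c by (simp add: totatives_def)
    then have "nat (h mod int p) \<in> (\<lambda>i. g ^ i mod p) ` {..<totient p}"
      using residue_primroot_is_generator[OF prime_gt_1_nat[OF p] g] by (simp add: bij_betw_def)
    then obtain i where "nat (h mod int p) = g ^ i mod p" by blast
    then have "[int (nat (h mod int p)) = int (g ^ i)] (mod int p)" by (simp only: cong_int_iff) (simp add: cong_def)
    then show ?thesis using hh cong_sym cong_trans by blast
  qed
  have dlog: "[h = int (g ^ dlog h)] (mod int p)" if "h \<in> A" for h
    unfolding dlog_def by (rule someI_ex[OF ex[OF that]])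
  have dcong: "dlog h = dlog k" if "[h = k] (mod int n)" for h k
  proof -
    have "[h = k] (mod int p)" by (rule cong_dvd_modulus[OF that pnI])
    then have "[h = x] (mod int p) \<longleftrightarrow> [k = x] (mod int p)" for x using cong_sym cong_trans by blast
    then show ?thesis unfolding dlog_def by simp
  qed
  have gg: "[g ^ i = g ^ j] (mod p) \<longleftrightarrow> [i = j] (mod (p - 1))" for i j
    using order_divides_expdiff[of p g i j] gp by simp
  have z: "zeta (p - 1) (int i) = zeta (p - 1) (int j) \<longleftrightarrow> [int (g ^ i) = int (g ^ j)] (mod int p)" for i j
    unfolding zeta_eq_iff[OF p1] cong_int_iff gg ..
  show ?thesis
  proof (rule that[of "\<lambda>h. zeta (p - 1) (int (dlog h))"])
    fix h k assume h: "h \<in> A" and k: "k \<in> A"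
    have "[int (g ^ dlog (h * k)) = h * k] (mod int p)" using dlog[OF unit_subgroupD(3)[OF A_subgroup h k]] by (rule cong_sym)
    moreover have "[h * k = int (g ^ dlog h) * int (g ^ dlog k)] (mod int p)" by (rule cong_mult[OF dlog[OF h] dlog[OF k]])
    ultimately have "[int (g ^ dlog (h * k)) = int (g ^ (dlog h + dlog k))] (mod int p)"
      by (simp add: power_add) (rule cong_trans)
    then have "zeta (p - 1) (int (dlog (h * k))) = zeta (p - 1) (int (dlog h + dlog k))" by (simp only: z)
    then show "zeta (p - 1) (int (dlog (h * k))) = zeta (p - 1) (int (dlog h)) * zeta (p - 1) (int (dlog k))"
      by (simp add: zeta_add)
  next
    fix h assume h: "h \<in> A"
    have "zeta (p - 1) (int (dlog h)) = 1 \<longleftrightarrow> [int (g ^ dlog h) = 1] (mod int p)"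
      using z[of "dlog h" 0] by simp
    also have "\<dots> \<longleftrightarrow> [h = 1] (mod int p)" using dlog[OF h] cong_sym cong_trans by blast
    also have "\<dots> \<longleftrightarrow> [h = 1] (mod int n)"
      using A_trivial[OF h] cong_dvd_modulus[OF _ pnI] by blast
    finally show "zeta (p - 1) (int (dlog h)) = 1 \<longleftrightarrow> [h = 1] (mod int n)" .
  next
    fix h k assume "[h = k] (mod int n)"
    then show "zeta (p - 1) (int (dlog h)) = zeta (p - 1) (int (dlog k))" by (simp add: dcong)
  qed simp
qed

end

section \<open>Irreducible characters and their restrictions to the translations\<close>

context block_data
begin

sublocale NA: finite_group_normal "above A" G
  by (rule above_normal[OF A_subgroup])

lemma A_one: "1 \<in> A"
  by (rule unit_subgroupD(2)[OF A_subgroup])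

lemma residues_one: "unit_subgroup B \<Longrightarrow> 1 mod int n \<in> residues B"
  using n unit_subgroup_cong[of B "1 mod int n" 1] unit_subgroupD(2)[of B] by (simp add: residues_def cong_def)

lemma card_residues_pos: "unit_subgroup B \<Longrightarrow> 0 < card (residues B)"
  using residues_one[of B] finite_residues[of B] by (auto simp: card_gt_0_iff)

lemma E_in_NA: "E k h \<in> above A \<longleftrightarrow> h \<in> A"
  by (rule E_in_above[OF A_subgroup])

lemma C_subset_NA: "above trivial_units \<subseteq> above A"
proof
  fix x assume "x \<in> above trivial_units"
  from C_E[OF this] obtain k where "x = E k 1" by (elim exE)
  then show "x \<in> above A" by (simp add: E_in_NA A_one)
qed

text \<open>The extension of \<open>\<lambda>\<^sub>\<epsilon>\<close> to \<open>C \<rtimes> A\<close>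
  that is trivial on the complement \<open>A\<close>.\<close>

definition theta0 :: "nat \<Rightarrow> complex" where
  "theta0 x = (if x \<in> above A then zeta n (eps * int (fst (prod_decode x))) else 0)"

lemma theta0_E: "theta0 (E k h) = (if h \<in> A then zeta n (eps * k) else 0)"
proof -
  have "zeta n (eps * int (fst (prod_decode (E k h)))) = zeta n (eps * k)"
    by (intro zeta_cong[OF n] cong_mult cong_refl decode_E)
  then show ?thesis by (simp add: theta0_def E_in_NA)
qed

lemma above_A_E: "x \<in> above A \<Longrightarrow> \<exists>k h. x = E k h \<and> h \<in> A"
  by (auto simp: above_def)

lemma theta0_lin_char: "lin_char G (above A) theta0"
  unfolding lin_char_def
proof (intro conjI ballI allI impI)
  fix x assume x: "x \<in> above A"
  obtain k h where kh: "x = E k h" "h \<in> A" using above_A_E[OF x] by (elim exE conjE)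
  show "theta0 x \<noteq> 0" by (simp add: kh theta0_E)
  fix y assume y: "y \<in> above A"
  obtain l t where lt: "y = E l t" "t \<in> A" using above_A_E[OF y] by (elim exE conjE)
  have ht: "h * t \<in> A" by (rule unit_subgroupD(3)[OF A_subgroup kh(2) lt(2)])
  have "[eps * h * l = eps * l] (mod int n)" by (rule cong_mult[OF eps_A[OF kh(2)] cong_refl])
  then have "[eps * k + eps * h * l = eps * k + eps * l] (mod int n)" by (rule cong_add[OF cong_refl])
  then have "zeta n (eps * (k + h * l)) = zeta n (eps * k + eps * l)"
    by (intro zeta_cong[OF n]) (simp only: distrib_left mult.assoc)
  then show "theta0 (x \<otimes>\<^bsub>G\<^esub> y) = theta0 x * theta0 y"
    unfolding kh(1) lt(1) E_mult theta0_E using kh(2) lt(2) ht by (simp add: zeta_add)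
qed (simp add: theta0_def)

lemma theta0_C: "x \<in> above trivial_units \<Longrightarrow> theta0 x = lam eps x"
proof -
  assume "x \<in> above trivial_units"
  from C_E[OF this] obtain k where "x = E k 1" by (elim exE)
  then show ?thesis by (simp add: theta0_E lam_E A_one)
qed

text \<open>The quotient of \<open>C \<rtimes> A\<close> by \<open>C\<close> is \<open>A\<close>, so a
  faithful character of \<open>A\<close> inflates to a linear character with kernel
  \<open>C\<close>.\<close>

lemma mu_lin_char:
  "\<exists>M. lin_char G (above A) M \<and> (\<forall>x\<in>above A. M x = 1 \<longleftrightarrow> x \<in> above trivial_units)"
proof (rule faithful_character_of_A)
  fix \<mu> :: "int \<Rightarrow> complex"
  assume \<mu>: "\<And>h. \<mu> h \<noteq> 0" "\<And>h k. h \<in> A \<Longrightarrow> k \<in> A \<Longrightarrow> \<mu> (h * k) = \<mu> h * \<mu> k"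
    "\<And>h. h \<in> A \<Longrightarrow> \<mu> h = 1 \<longleftrightarrow> [h = 1] (mod int n)" "\<And>h k. [h = k] (mod int n) \<Longrightarrow> \<mu> h = \<mu> k"
  define M where "M x = (if x \<in> above A then \<mu> (int (snd (prod_decode x))) else 0)" for x
  have ME: "M (E k h) = (if h \<in> A then \<mu> h else 0)" for k h
    using \<mu>(4)[OF decode_E(2)] by (simp add: M_def E_in_NA)
  show ?thesis
  proof (intro exI[of _ M] conjI ballI)
    show "lin_char G (above A) M"
      unfolding lin_char_def
    proof (intro conjI ballI allI impI)
      fix x assume x: "x \<in> above A"
      obtain k h where kh: "x = E k h" "h \<in> A" using above_A_E[OF x] by (elim exE conjE)
      show "M x \<noteq> 0" by (simp add: kh ME \<mu>(1))
      fix y assume y: "y \<in> above A"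
      obtain l t where lt: "y = E l t" "t \<in> A" using above_A_E[OF y] by (elim exE conjE)
      have ht: "h * t \<in> A" by (rule unit_subgroupD(3)[OF A_subgroup kh(2) lt(2)])
      show "M (x \<otimes>\<^bsub>G\<^esub> y) = M x * M y"
        unfolding kh(1) lt(1) E_mult ME using kh(2) lt(2) ht \<mu>(2) by simp
    qed (simp add: M_def)
    fix x assume x: "x \<in> above A"
    obtain k h where kh: "x = E k h" "h \<in> A" using above_A_E[OF x] by (elim exE conjE)
    show "M x = 1 \<longleftrightarrow> x \<in> above trivial_units" using \<mu>(3)[OF kh(2)] kh(2) by (simp add: kh(1) ME E_in_C)
  qed
qed

definition Theta :: "(nat \<Rightarrow> complex) set" where
  "Theta = {\<theta>. lin_char G (above A) \<theta> \<and> (\<forall>x\<in>above trivial_units. \<theta> x = lam eps x)}"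

lemma Theta_D:
  assumes "\<theta> \<in> Theta"
  shows "lin_char G (above A) \<theta>" "\<And>x. x \<in> above trivial_units \<Longrightarrow> \<theta> x = lam eps x"
  using assms by (auto simp: Theta_def)

lemma theta0_Theta: "theta0 \<in> Theta"
  using theta0_lin_char theta0_C by (simp add: Theta_def)

lemma C_subgroup_G: "subgroup (above trivial_units) G"
  by (rule C.subgroup_axioms)

lemma Theta_card: "finite Theta" "card Theta = card (residues A)"
proof -
  obtain M where M0: "lin_char G (above A) M" "\<forall>x\<in>above A. M x = 1 \<longleftrightarrow> x \<in> above trivial_units"
    using mu_lin_char by (elim exE conjE)
  note M = M0(1) M0(2)[rule_format]
  have eq: "Theta = {\<theta>. lin_char G (above A) \<theta> \<and> (\<forall>x\<in>above trivial_units. \<theta> x = theta0 x)}"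
    by (simp add: Theta_def theta0_C)
  note ext = NA.extensions_of_lin_char[OF C_subgroup_G C_subset_NA theta0_lin_char M, folded eq]
  show "finite Theta" by (rule ext(1))
  have "card Theta * n = n * card (residues A)"
    using ext(3) card_C card_above[OF A_subgroup] by simp
  then show "card Theta = card (residues A)" using n by simp
qed

lemma Theta_eigenvector:
  assumes \<rho>: "irreducible_representation G d \<rho>"
    and v: "v \<in> carrier_vec d" "v \<noteq> 0\<^sub>v d" "\<And>x. x \<in> above trivial_units \<Longrightarrow> \<rho> x *\<^sub>v v = lam eps x \<cdot>\<^sub>v v"
  shows "\<exists>\<theta>\<in>Theta. \<exists>u\<in>carrier_vec d. u \<noteq> 0\<^sub>v d \<and> (\<forall>x\<in>above A. \<rho> x *\<^sub>v u = \<theta> x \<cdot>\<^sub>v u)"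
proof -
  obtain M where M0: "lin_char G (above A) M" "\<forall>x\<in>above A. M x = 1 \<longleftrightarrow> x \<in> above trivial_units"
    using mu_lin_char by (elim exE conjE)
  note M = M0(1) M0(2)[rule_format]
  have v': "\<rho> x *\<^sub>v v = theta0 x \<cdot>\<^sub>v v" if "x \<in> above trivial_units" for x using v(3)[OF that] theta0_C[OF that] by simp
  show ?thesis
  proof (rule NA.extension_eigenvector[OF C_subgroup_G C_subset_NA theta0_lin_char M \<rho> v(1,2) v'])
    fix \<theta> u assume *: "lin_char G (above A) \<theta>" "\<And>x. x \<in> above trivial_units \<Longrightarrow> \<theta> x = theta0 x"
      "u \<in> carrier_vec d" "u \<noteq> 0\<^sub>v d" "\<And>x. x \<in> above A \<Longrightarrow> \<rho> x *\<^sub>v u = \<theta> x \<cdot>\<^sub>v u"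
    have "\<theta> \<in> Theta" using *(1,2) by (simp add: Theta_def theta0_C)
    then show ?thesis by (rule bexI[rotated]) (intro bexI[OF _ *(3)] conjI *(4) ballI *(5))
  qed
qed

abbreviation "ind_C j \<equiv> induced G (above trivial_units) (lam j)"
abbreviation "ind_A \<theta> \<equiv> induced G (above A) \<theta>"

lemma ind_A_E:
  "\<theta> \<in> Theta \<Longrightarrow> h \<in> H \<Longrightarrow>
    ind_A \<theta> (E k h) = \<theta> (E 0 h) * (\<Sum>t\<in>residues H. zeta n (eps * t * k)) / of_nat (card (residues A))"
  by (rule induced_above_E[OF A_subgroup Theta_D eps_A])

lemma ind_C_Irr:
  assumes "\<And>t. t \<in> H \<Longrightarrow> [j * t = j] (mod int n) \<Longrightarrow> t \<in> trivial_units"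
  shows "ind_C j \<in> Irr G"
  by (rule C.induced_in_Irr[OF lam_lin_char stabilizer_condition[OF trivial_units_subgroup refl assms]])

lemma ind_A_Irr: "\<theta> \<in> Theta \<Longrightarrow> ind_A \<theta> \<in> Irr G"
  by (rule NA.induced_in_Irr[OF Theta_D(1) stabilizer_condition[OF A_subgroup Theta_D(2) stab_eps]])

text \<open>Labels of the linear characters of \<open>C\<close> that agree with
  \<open>\<lambda>\<^sub>1\<close> on the \<open>p'\<close>-part and are nontrivial on the
  \<open>p\<close>-part, one for each character.\<close>

definition block_labels :: "int set" where
  "block_labels = {j \<in> {0..<int n}. [j = 1] (mod int m) \<and> \<not> int (p ^ a) dvd j}"

text \<open>An eigenvector of the generator of the cyclic group \<open>C\<close> exists over the complex
  numbers; the eigenvalue is an \<open>n\<close>-th root of unity, since \<open>n\<close> translations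
  by one compose to the identity.\<close>

lemma irreducible_C_eigenvector:
  assumes \<rho>: "irreducible_representation G d \<rho>"
  shows "\<exists>j. \<exists>v\<in>carrier_vec d. v \<noteq> 0\<^sub>v d \<and> (\<forall>k. \<rho> (E k 1) *\<^sub>v v = zeta n (j * k) \<cdot>\<^sub>v v)"
proof -
  have d: "0 < d" using \<rho> by (simp add: irreducible_representation_def)
  have E1: "E k 1 \<in> carrier G" for k by (simp add: H_one)
  note \<rho>c = representation_carrier[OF \<rho> E1]
  obtain z where z: "eigenvalue (\<rho> (E 1 1)) z"
    using spectrum_non_empty[OF \<rho>c d] by (auto simp: spectrum_def)
  then obtain v where v: "v \<in> carrier_vec d" "v \<noteq> 0\<^sub>v d" "\<rho> (E 1 1) *\<^sub>v v = z \<cdot>\<^sub>v v"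
    using \<rho>c[of 1] by (auto simp: eigenvalue_def eigenvector_def)
  have pow: "\<rho> (E (int k) 1) *\<^sub>v v = z ^ k \<cdot>\<^sub>v v" for k
  proof (induction k)
    case 0
    have "\<rho> (E 0 1) = 1\<^sub>m d" using representation_one[OF \<rho>] by (simp add: G_one)
    then show ?case using v(1) by simp
  next
    case (Suc k)
    have "\<rho> (E (int (Suc k)) 1) = \<rho> (E 1 1) * \<rho> (E (int k) 1)"
      by (simp add: E_mult flip: representation_mult[OF \<rho> E1 E1])
    then have "\<rho> (E (int (Suc k)) 1) *\<^sub>v v = \<rho> (E 1 1) *\<^sub>v (z ^ k \<cdot>\<^sub>v v)"
      using assoc_mult_mat_vec[OF \<rho>c \<rho>c v(1)] Suc by simp
    also have "\<dots> = z ^ k \<cdot>\<^sub>v (z \<cdot>\<^sub>v v)" using v by (simp add: mult_mat_vec[OF \<rho>c v(1)])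
    finally show ?case by (simp add: smult_smult_assoc mult.commute)
  qed
  obtain i where i: "i < d" "v $ i \<noteq> 0" using v by (metis carrier_vecD eq_vecI index_zero_vec)
  have "E (int n) 1 = E (int 0) 1" by (simp add: E_eq_iff cong_def)
  then have "z ^ n \<cdot>\<^sub>v v = z ^ 0 \<cdot>\<^sub>v v" using pow[of n] pow[of 0] by simp
  then have "(z ^ n \<cdot>\<^sub>v v) $ i = (z ^ 0 \<cdot>\<^sub>v v) $ i" by simp
  then have "z ^ n = 1" using i v(1) by simp
  then obtain j where j: "z = zeta n j" using unity_root_eq_zeta[OF n] by metis
  show ?thesis
  proof (intro exI[of _ j] bexI[OF _ v(1)] conjI v(2) allI)
    fix k
    have kk: "[int (nat (k mod int n)) = k] (mod int n)"
    proof -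
      have "int (nat (k mod int n)) = k mod int n" using n by (intro nat_0_le) simp
      then show ?thesis by (simp only: cong_def mod_mod_trivial)
    qed
    have "\<rho> (E k 1) = \<rho> (E (int (nat (k mod int n))) 1)" using E_cong[OF kk cong_refl] by simp
    moreover have "z ^ nat (k mod int n) = zeta n (j * k)"
      unfolding j zeta_power by (rule zeta_cong[OF n cong_mult[OF cong_refl kk]])
    ultimately show "\<rho> (E k 1) *\<^sub>v v = zeta n (j * k) \<cdot>\<^sub>v v"
      using pow[of "nat (k mod int n)"] by (simp only:)
  qed
qed

text \<open>An irreducible \<open>\<psi>\<close> lies over some \<open>\<lambda>\<^sub>j\<close>, and
  this determines its central character on \<open>C\<close>. If \<open>j\<close> is congruent modulo
  \<open>m\<close> to some \<open>t \<in> H\<close>, then \<open>\<psi>\<close> also lies over the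
  conjugate \<open>\<lambda>\<^sub>i\<close> with \<open>i = j t\<^bsup>-1\<^esup> \<equiv> 1\<close>.
  The stabilizer of \<open>i\<close> is then either trivial or \<open>A\<close>, and in both cases
  \<open>\<psi>\<close> is induced from the stabilizer.\<close>

lemma Irr_cases:
  assumes \<psi>: "\<psi> \<in> Irr G"
  obtains j where "\<And>x. x \<in> above trivial_units \<Longrightarrow> central_character G \<psi> x = (\<Sum>y\<in>conj_class G x. lam j y)"
    "\<And>t. t \<in> H \<Longrightarrow> [j = t] (mod int m) \<Longrightarrow> \<psi> \<in> ind_C ` block_labels \<union> ind_A ` Theta"
proof -
  obtain d \<rho> where \<rho>: "irreducible_representation G d \<rho>" and \<psi>\<rho>: "\<psi> = restrict (\<lambda>g. mat_trace (\<rho> g)) (carrier G)"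
    using \<psi> by (auto simp: Irr_def)
  obtain j v where v0: "v \<in> carrier_vec d" "v \<noteq> 0\<^sub>v d" "\<forall>k. \<rho> (E k 1) *\<^sub>v v = zeta n (j * k) \<cdot>\<^sub>v v"
    using irreducible_C_eigenvector[OF \<rho>] by (elim exE bexE conjE)
  note v = v0(1,2) v0(3)[rule_format]
  note \<rho>c = representation_carrier[OF \<rho>]
  have lamv: "\<rho> x *\<^sub>v u = lam i x \<cdot>\<^sub>v u"
    if u: "\<And>k. \<rho> (E k 1) *\<^sub>v u = zeta n (i * k) \<cdot>\<^sub>v u" and x: "x \<in> above trivial_units" for i u x
  proof -
    obtain k where "x = E k 1" using C_E[OF x] by (elim exE)
    then show ?thesis using u by (simp add: lam_E)
  qed
  show ?thesis
  proof (rule that[of j])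
    fix x assume x: "x \<in> above trivial_units"
    have sub: "conj_class G x \<subseteq> above trivial_units" using C.conj_closed x by (auto simp: conj_class_def)
    show "central_character G \<psi> x = (\<Sum>y\<in>conj_class G x. lam j y)"
      unfolding \<psi>\<rho>
    proof (rule central_character_eigenvector[OF \<rho> _ v(1,2)])
      show "x \<in> carrier G" using x by simp
      fix y assume "y \<in> conj_class G x"
      then show "\<rho> y *\<^sub>v v = lam j y \<cdot>\<^sub>v v" using lamv[OF v(3)] sub by blast
    qed
  next
    fix t assume t: "t \<in> H" "[j = t] (mod int m)"
    obtain s where s: "s \<in> H" "[t * s = 1] (mod int n)" using H_inverse[OF t(1)] by blast
    have tc: "E k t \<in> carrier G" "E k s \<in> carrier G" "E k 1 \<in> carrier G" for k using t(1) s(1) H_one by simp_all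
    define i where "i = j * s"
    \<comment> \<open>Applying the automorphism t to an eigenvector for \<open>\<lambda>\<^sub>j\<close> gives one for the conjugate \<open>\<lambda>\<^sub>i\<close>.\<close>
    define u where "u = \<rho> (E 0 t) *\<^sub>v v"
    have uc: "u \<in> carrier_vec d" unfolding u_def by (rule mult_mat_vec_carrier[OF \<rho>c[OF tc(1)] v(1)])
    have mv: "\<rho> (g \<otimes>\<^bsub>G\<^esub> h) *\<^sub>v v = \<rho> g *\<^sub>v (\<rho> h *\<^sub>v v)" if "g \<in> carrier G" "h \<in> carrier G" for g h
      using assoc_mult_mat_vec[OF \<rho>c[OF that(1)] \<rho>c[OF that(2)] v(1)] representation_mult[OF \<rho> that] by simp
    have u0: "u \<noteq> 0\<^sub>v d"
    proof
      assume "u = 0\<^sub>v d"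
      then have "\<rho> (E 0 s \<otimes>\<^bsub>G\<^esub> E 0 t) *\<^sub>v v = 0\<^sub>v d"
        unfolding mv[OF tc(2,1)] u_def using mult_mat_vec_zero[OF \<rho>c[OF tc(2)]] by simp
      moreover have "E 0 s \<otimes>\<^bsub>G\<^esub> E 0 t = \<one>\<^bsub>G\<^esub>" using s(2) by (simp add: E_mult G_one E_eq_iff mult.commute)
      ultimately show False using v(1,2) representation_one[OF \<rho>] by simp
    qed
    have ui: "\<rho> (E k 1) *\<^sub>v u = zeta n (i * k) \<cdot>\<^sub>v u" for k
    proof -
      have "[t * s * k = 1 * k] (mod int n)" by (rule cong_mult[OF s(2) cong_refl])
      then have "E k 1 \<otimes>\<^bsub>G\<^esub> E 0 t = E 0 t \<otimes>\<^bsub>G\<^esub> E (s * k) 1"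
        by (simp add: E_mult E_eq_iff mult.assoc cong_sym)
      then have "\<rho> (E k 1) *\<^sub>v u = \<rho> (E 0 t) *\<^sub>v (\<rho> (E (s * k) 1) *\<^sub>v v)"
        unfolding u_def by (simp only: mv[OF tc(3,1), symmetric] mv[OF tc(1,3)])
      also have "\<dots> = zeta n (j * (s * k)) \<cdot>\<^sub>v u"
        unfolding v(3) u_def by (rule mult_mat_vec[OF \<rho>c[OF tc(1)] v(1)])
      finally show ?thesis by (simp add: i_def mult.assoc)
    qed
    have im: "[i = 1] (mod int m)"
    proof -
      have "[j * s = t * s] (mod int m)" by (rule cong_mult[OF t(2) cong_refl])
      moreover have "[t * s = 1] (mod int m)" using s(2) unfolding cong_n_iff by blast
      ultimately show ?thesis unfolding i_def by (rule cong_trans)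
    qed
    show "\<psi> \<in> ind_C ` block_labels \<union> ind_A ` Theta"
    proof (cases "int (p ^ a) dvd i")
      case False
      have "\<psi> = ind_C i" unfolding \<psi>\<rho>
        by (rule C.character_eq_induced[OF lam_lin_char stabilizer_condition[OF trivial_units_subgroup refl stab_J[OF im False]] \<rho> uc u0 lamv[OF ui]])
      also have "\<dots> = ind_C (i mod int n)" using lam_cong[of i "i mod int n"] by (simp add: cong_def)
      finally have 1: "\<psi> = ind_C (i mod int n)" .
      have c: "[i mod int n = i] (mod int n)" by (simp add: cong_def)
      have "[i mod int n = 1] (mod int m)" using c im unfolding cong_n_iff by (blast intro: cong_trans)
      moreover have "\<not> int (p ^ a) dvd i mod int n" using c False unfolding cong_n_iff by (blast dest: cong_dvd_iff)
      ultimately have "i mod int n \<in> block_labels" using n by (simp add: block_labels_def)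
      then show ?thesis using 1 by blast
    next
      case True
      have "lam i = lam eps" by (rule lam_cong[OF eps_unique[OF im True]])
      then have lv: "\<rho> x *\<^sub>v u = lam eps x \<cdot>\<^sub>v u" if "x \<in> above trivial_units" for x using lamv[OF ui that] by simp
      have ex: "\<exists>\<theta>\<in>Theta. \<exists>u\<in>carrier_vec d. u \<noteq> 0\<^sub>v d \<and> (\<forall>x\<in>above A. \<rho> x *\<^sub>v u = \<theta> x \<cdot>\<^sub>v u)"
        by (rule Theta_eigenvector[OF \<rho> uc u0 lv])
      obtain \<theta> w where \<theta>0: "\<theta> \<in> Theta" "w \<in> carrier_vec d" "w \<noteq> 0\<^sub>v d" "\<forall>x\<in>above A. \<rho> x *\<^sub>v w = \<theta> x \<cdot>\<^sub>v w"
        using ex by (elim bexE conjE)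
      note \<theta> = \<theta>0(1-3) \<theta>0(4)[rule_format]
      have "\<psi> = ind_A \<theta>" unfolding \<psi>\<rho>
        by (rule NA.character_eq_induced[OF Theta_D(1)[OF \<theta>(1)] stabilizer_condition[OF A_subgroup Theta_D(2)[OF \<theta>(1)] stab_eps] \<rho> \<theta>(2-4)])
      then show ?thesis using \<theta>(1) by blast
    qed
  qed
qed

section \<open>The block of the induced faithful character\<close>

text \<open>The group of \<open>p'\<close>-elements of \<open>C\<close>, on which all characters of the
  block restrict to multiples of one another.\<close>

definition C_pprime :: "nat set" where
  "C_pprime = (\<lambda>i. E (int (p ^ a) * i) 1) ` {0..<int m}"

lemma inj_C_pprime: "inj_on (\<lambda>i. E (int (p ^ a) * i) 1) {0..<int m}"
proof (rule inj_onI)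
  fix i j assume ij: "i \<in> {0..<int m}" "j \<in> {0..<int m}" and "E (int (p ^ a) * i) 1 = E (int (p ^ a) * j) 1"
  then have "[int (p ^ a) * i = int (p ^ a) * j] (mod int m)" unfolding E_eq_iff cong_n_iff by blast
  then have "[i = j] (mod int m)" using coprime_pm by (simp add: cong_mult_lcancel)
  then show "i = j" using ij by (simp add: cong_def)
qed

lemma C_pprime_E: "E (int (p ^ a) * i) 1 \<in> C_pprime"
proof -
  have "int (p ^ a) * i mod (int (p ^ a) * int m) = int (p ^ a) * (i mod int m)" by (rule mult_mod_right[symmetric])
  then have "[int (p ^ a) * i = int (p ^ a) * (i mod int m)] (mod int n)"
    by (simp only: cong_def int_n mod_mod_trivial flip: mult_mod_right)
  then have "E (int (p ^ a) * i) 1 = E (int (p ^ a) * (i mod int m)) 1" by (rule E_cong[OF _ cong_refl])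
  moreover have "i mod int m \<in> {0..<int m}" using m0 by simp
  ultimately show ?thesis unfolding C_pprime_def by (rule image_eqI)
qed

lemma C_pprime_C: "x \<in> C_pprime \<Longrightarrow> x \<in> above trivial_units"
  by (auto simp: C_pprime_def E_in_C)

lemma C_pprime_carrier: "x \<in> C_pprime \<Longrightarrow> x \<in> carrier G"
  using C_pprime_C C.N_closed(4) by blast

lemma C_pprime_conj: "x \<in> C_pprime \<Longrightarrow> conj_class G x \<subseteq> C_pprime"
proof
  fix y assume "x \<in> C_pprime" and y: "y \<in> conj_class G x"
  then obtain i where x: "x = E (int (p ^ a) * i) 1" by (auto simp: C_pprime_def)
  obtain t l where "y = E (t * (int (p ^ a) * i) + l - 1 * l) 1"
    using y unfolding x conj_class_E[OF H_one] by blast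
  then have "y = E (int (p ^ a) * (t * i)) 1" by (simp add: mult_ac)
  then show "y \<in> C_pprime" by (simp only: C_pprime_E)
qed

text \<open>The values \<open>\<psi>\<^sub>0(x\<^bsup>-1\<^esup>)\<close>, where
  \<open>\<psi>\<^sub>0\<close> is induced from \<open>\<theta>\<^sub>0\<close>.\<close>

definition psi0_inv :: "nat \<Rightarrow> complex" where
  "psi0_inv x = ind_A theta0 (inv\<^bsub>G\<^esub> x)"

lemma psi0_inv_E: "psi0_inv (E c 1) = (\<Sum>t\<in>residues H. zeta n (- (eps * t * c))) / of_nat (card (residues A))"
  using ind_A_E[OF theta0_Theta H_one, of "- c"] by (simp add: psi0_inv_def inv_E1 theta0_E A_one)

lemma psi0_inv_algebraic_int: "x \<in> carrier G \<Longrightarrow> algebraic_int (psi0_inv x)"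
  unfolding psi0_inv_def by (rule NA.induced_algebraic_int[OF theta0_lin_char]) simp

lemma psi0_inv_class:
  assumes x: "x \<in> C_pprime" and y: "y \<in> conj_class G x"
  shows "psi0_inv y = psi0_inv x"
proof -
  obtain c where c: "x = E c 1" using C_E[OF C_pprime_C[OF x]] by (elim exE)
  obtain t l where t: "y = E (t * c + l - 1 * l) 1" "t \<in> H"
    using y unfolding c conj_class_E[OF H_one] by blast
  then have y: "y = E (t * c) 1" by simp
  have "(\<Sum>r\<in>residues H. zeta n (- (eps * r * (t * c)))) = (\<Sum>r\<in>residues H. zeta n (eps * t * r * (- c)))"
    by (simp add: mult_ac)
  also have "\<dots> = (\<Sum>r\<in>residues H. zeta n (eps * r * (- c)))" by (rule sum_residues_mult[OF t(2)])
  finally show ?thesis unfolding y c psi0_inv_E by simp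
qed

text \<open>The elements of \<open>H\<close> in a given residue class modulo \<open>m\<close> form a
  coset of \<open>A\<close>.\<close>

lemma card_A_cong:
  assumes t: "t \<in> H"
  shows "card {r \<in> residues H. [r = t] (mod int m)} = card (residues A)"
proof -
  have "[r = t] (mod int m) \<longleftrightarrow> (\<exists>h\<in>A. [r = t * h] (mod int n))" if r: "r \<in> H" for r
  proof
    assume rt: "[r = t] (mod int m)"
    obtain u where u: "u \<in> H" "[t * u = 1] (mod int n)" using H_inverse[OF t] by blast
    have "[u * r = u * t] (mod int m)" by (rule cong_mult[OF cong_refl rt])
    moreover have "[u * t = 1] (mod int m)" using u(2) unfolding cong_n_iff by (simp add: mult.commute)
    ultimately have "[u * r = 1] (mod int m)" by (rule cong_trans)
    then have "u * r \<in> A" by (rule A_I[OF H_mult[OF u(1) r]])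
    moreover have "[r = t * (u * r)] (mod int n)"
      using cong_mult[OF cong_sym[OF u(2)] cong_refl, of r] by (simp add: mult.assoc)
    ultimately show "\<exists>h\<in>A. [r = t * h] (mod int n)" by (rule bexI[rotated])
  next
    assume "\<exists>h\<in>A. [r = t * h] (mod int n)"
    then obtain h where h: "h \<in> A" "[r = t * h] (mod int n)" by (elim bexE)
    have "[r = t * h] (mod int m)" using h(2) unfolding cong_n_iff by (elim conjE)
    moreover have "[t * h = t * 1] (mod int m)" by (rule cong_mult[OF cong_refl A_subset(2)[OF h(1)]])
    ultimately have "[r = t * 1] (mod int m)" by (rule cong_trans)
    then show "[r = t] (mod int m)" by (simp only: mult_1_right)
  qed
  then have "{r \<in> residues H. [r = t] (mod int m)} = {r \<in> residues H. \<exists>h\<in>A. [r = t * h] (mod int n)}"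
    by (intro Collect_cong conj_cong refl) (simp add: residues_def)
  then show ?thesis using card_coset[OF A_subgroup t] by simp
qed

text \<open>Restricted to the \<open>p'\<close>-elements, \<open>\<psi>\<^sub>0\<close> is the sum of
  the distinct \<open>H\<close>-conjugates of \<open>\<lambda>\<^sub>1\<close>. Orthogonality picks out
  the labels that are congruent modulo \<open>m\<close> to elements of \<open>H\<close>.\<close>

lemma sum_psi0_inv_lam:
  "(\<Sum>x\<in>C_pprime. psi0_inv x * lam j x) = (if \<exists>t\<in>H. [j = t] (mod int m) then of_nat m else 0)"
proof -
  let ?q = "int (p ^ a)" and ?A = "of_nat (card (residues A)) :: complex"
  have A0: "?A \<noteq> 0" using card_residues_pos[OF A_subgroup] by simp
  have zm: "zeta n (?q * k) = zeta m k" for k using zeta_cancel[OF q0, of m k] nam by simp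
  have "(\<Sum>x\<in>C_pprime. psi0_inv x * lam j x) = (\<Sum>i\<in>{0..<int m}. psi0_inv (E (?q * i) 1) * lam j (E (?q * i) 1))"
    by (simp only: C_pprime_def sum.reindex[OF inj_C_pprime] o_def)
  also have "\<dots> = (\<Sum>i\<in>{0..<int m}. \<Sum>t\<in>residues H. zeta m ((j - eps * t) * i) / ?A)"
  proof (rule sum.cong[OF refl])
    fix i
    have "zeta n (- (eps * t * (?q * i))) * zeta n (j * (?q * i)) = zeta m ((j - eps * t) * i)" for t
    proof -
      have "zeta n (- (eps * t * (?q * i))) * zeta n (j * (?q * i)) = zeta n (?q * ((j - eps * t) * i))"
        unfolding zeta_add[symmetric] by (rule arg_cong[of _ _ "zeta n"]) (simp add: algebra_simps)
      then show ?thesis by (simp only: zm)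
    qed
    then show "psi0_inv (E (?q * i) 1) * lam j (E (?q * i) 1) = (\<Sum>t\<in>residues H. zeta m ((j - eps * t) * i) / ?A)"
      unfolding psi0_inv_E lam_E by (simp add: sum_distrib_right sum_divide_distrib del: of_nat_power of_nat_mult)
  qed
  also have "\<dots> = (\<Sum>t\<in>residues H. (\<Sum>i\<in>{0..<int m}. zeta m ((j - eps * t) * i)) / ?A)"
    by (subst sum.swap) (simp only: sum_divide_distrib)
  also have "\<dots> = (\<Sum>t\<in>residues H. if [t = j] (mod int m) then of_nat m / ?A else 0)"
  proof (rule sum.cong[OF refl])
    fix t
    have "[eps * t = 1 * t] (mod int m)" by (rule cong_mult[OF eps(1) cong_refl])
    then have e: "[eps * t = t] (mod int m)" by (simp only: mult_1_left)
    have "[t = j] (mod int m) \<longleftrightarrow> [j = eps * t] (mod int m)"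
    proof
      assume "[t = j] (mod int m)"
      with e have "[eps * t = j] (mod int m)" by (rule cong_trans)
      then show "[j = eps * t] (mod int m)" by (rule cong_sym)
    next
      assume "[j = eps * t] (mod int m)"
      then have "[j = t] (mod int m)" using e by (rule cong_trans)
      then show "[t = j] (mod int m)" by (rule cong_sym)
    qed
    then have "int m dvd j - eps * t \<longleftrightarrow> [t = j] (mod int m)" by (simp only: cong_iff_dvd_diff)
    then show "(\<Sum>i\<in>{0..<int m}. zeta m ((j - eps * t) * i)) / ?A = (if [t = j] (mod int m) then of_nat m / ?A else 0)"
      by (simp add: sum_zeta[OF m0])
  qed
  also have "\<dots> = of_nat (card {t \<in> residues H. [t = j] (mod int m)}) * (of_nat m / ?A)"
    by (simp add: sum.If_cases[OF finite_residues] Int_def)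
  also have "\<dots> = (if \<exists>t\<in>H. [j = t] (mod int m) then of_nat m else 0)"
  proof (cases "\<exists>t\<in>H. [j = t] (mod int m)")
    case True
    then obtain t where t: "t \<in> H" "[j = t] (mod int m)" by blast
    have "{r \<in> residues H. [r = j] (mod int m)} = {r \<in> residues H. [r = t] (mod int m)}"
      using t(2) cong_sym cong_trans by blast
    then have "card {r \<in> residues H. [r = j] (mod int m)} = card (residues A)" using card_A_cong[OF t(1)] by simp
    then show ?thesis using True A0 by simp
  next
    case False
    have e: "{r \<in> residues H. [r = j] (mod int m)} = {}"
    proof -
      have "\<not> [r = j] (mod int m)" if "r \<in> residues H" for r
        using False that cong_sym by (auto simp: residues_def)
      then show ?thesis by blast
    qed
    show ?thesis unfolding e using False by simp
  qed
  finally show ?thesis .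
qed

abbreviation "M \<equiv> max_ideal_over p"
abbreviation "\<chi> \<equiv> ind_C 1"

lemmas M_props = max_ideal_props[OF p]

lemma m_notin_M: "of_nat m \<notin> M"
  using of_nat_in_max_ideal_iff[OF p] pm by blast

text \<open>The quotient of the two roots of unity has \<open>p\<close>-power order.\<close>

lemma zeta_diff_M:
  assumes "[i = j] (mod int m)"
  shows "zeta n (i * k) - zeta n (j * k) \<in> M"
proof -
  have "int m dvd i - j" using assms by (simp only: cong_iff_dvd_diff)
  then obtain l where l: "i - j = int m * l" ..
  have "zeta n ((i - j) * k) ^ (p ^ a) = zeta n ((i - j) * k * int (p ^ a))" by (rule zeta_power)
  also have "\<dots> = 1" unfolding zeta_eq_1_iff[OF n] l int_n by simp
  finally have "zeta n ((i - j) * k) - 1 \<in> M"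
    by (rule unity_root_minus_one_in_max_ideal[OF p _ zeta_algebraic_int[OF n]])
  then have "zeta n (j * k) * (zeta n ((i - j) * k) - 1) \<in> M" by (rule M_props(4)[OF _ zeta_algebraic_int[OF n]])
  moreover have "zeta n (j * k) * zeta n ((i - j) * k) = zeta n (i * k)"
    unfolding zeta_add[symmetric] by (rule arg_cong[of _ _ "zeta n"]) (simp add: algebra_simps)
  ultimately show ?thesis by (simp add: right_diff_distrib)
qed

lemma lam_diff_M:
  assumes "[i = j] (mod int m)"
  shows "lam i y - lam j y \<in> M"
proof (cases "y \<in> above trivial_units")
  case True
  then obtain k where "y = E k 1" using C_E[OF True] by (elim exE)
  then show ?thesis using zeta_diff_M[OF assms] by (simp add: lam_E)
next
  case False
  then show ?thesis using M_props(2) by (simp add: lam_def)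
qed

text \<open>For a nontrivial \<open>h \<in> A\<close>, the difference \<open>h - 1\<close> is divisible
  by \<open>m\<close> and prime to \<open>p\<close>. So the class of \<open>x \<mapsto> h x + k\<close>
  is a union of cosets of the group of \<open>p\<^sup>a\<close> translations by multiples of
  \<open>m\<close>, on each of which \<open>\<theta>\<close> is constant, and its sum is a multiple of
  \<open>p\<^sup>a\<close>.\<close>

lemma theta_class_sum_in_M:
  assumes \<theta>: "\<theta> \<in> Theta" and h: "h \<in> A" "\<not> [h = 1] (mod int n)"
  shows "(\<Sum>y\<in>conj_class G (E k h). \<theta> y) \<in> M"
proof -
  let ?K = "conj_class G (E k h)" and ?q = "p ^ a"
  note hH = A_subset(1)[OF h(1)]
  have finK: "finite ?K" using hH by (intro finite_conj_class) simp
  have a0: "a \<noteq> 0"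
  proof
    assume "a = 0"
    then have "n = m" using nam by simp
    then show False using h A_subset(2) by blast
  qed
  have qM: "of_nat ?q \<in> M" using of_nat_in_max_ideal_iff[OF p, of ?q] a0 by simp
  \<comment> \<open>The cosets are the fibres of the translation part modulo m.\<close>
  define \<phi> where "\<phi> y = int (fst (prod_decode y)) mod int m" for y
  have \<phi>E: "\<phi> (E z h') = z mod int m" for z h'
    using decode_E(1)[of z h'] unfolding cong_n_iff \<phi>_def by (simp add: cong_def)
  have \<theta>E: "\<theta> (E z h) = zeta n (eps * z) * \<theta> (E 0 h)" for z by (rule lin_char_above_E[OF A_subgroup Theta_D[OF \<theta>]])
  have "(\<Sum>y\<in>?K. \<theta> y) = (\<Sum>c\<in>\<phi> ` ?K. \<Sum>y | y \<in> ?K \<and> \<phi> y = c. \<theta> y)"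
    by (rule sum.image_gen[OF finK])
  also have "\<dots> \<in> M"
  proof (rule max_ideal_sum[OF p])
    fix c assume "c \<in> \<phi> ` ?K"
    then obtain y0 where y0: "y0 \<in> ?K" "c = \<phi> y0" by blast
    then obtain t l where t: "t \<in> H" and y0E: "y0 = E (t * k + l - h * l) h" unfolding conj_class_E[OF hH] by blast
    define z0 where "z0 = t * k + l - h * l"
    have fib: "{y \<in> ?K. \<phi> y = c} = (\<lambda>i. E (z0 + int m * i) h) ` {0..<int ?q}"
    proof (intro equalityI subsetI)
      fix y assume "y \<in> {y \<in> ?K. \<phi> y = c}"
      then obtain z where z: "y = E z h" "\<phi> y = c" unfolding conj_class_E[OF hH] by blast
      then have "z mod int m = z0 mod int m" using y0(2) by (simp add: y0E \<phi>E z0_def)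
      then have "int m dvd z - z0" by (simp only: mod_eq_dvd_iff)
      then obtain w where w: "z - z0 = int m * w" ..
      have "int m * w mod (int m * int ?q) = int m * (w mod int ?q)" by (rule mult_mod_right[symmetric])
      then have "[int m * w = int m * (w mod int ?q)] (mod int n)"
        by (simp only: cong_def int_n mult.commute[of "int ?q"] mod_mod_trivial flip: mult_mod_right)
      then have "[z0 + int m * w = z0 + int m * (w mod int ?q)] (mod int n)" by (rule cong_add[OF cong_refl])
      then have "y = E (z0 + int m * (w mod int ?q)) h"
        unfolding z(1) using w by (intro E_cong[OF _ cong_refl]) (simp add: algebra_simps)
      moreover have "w mod int ?q \<in> {0..<int ?q}" using p0 by simp
      ultimately show "y \<in> (\<lambda>i. E (z0 + int m * i) h) ` {0..<int ?q}" by (rule image_eqI)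
    next
      fix y assume "y \<in> (\<lambda>i. E (z0 + int m * i) h) ` {0..<int ?q}"
      then obtain i where i: "y = E (z0 + int m * i) h" by blast
      \<comment> \<open>Conjugating by a further translation by - x i, where x inverts (h - 1) / m modulo \<open>p\<^sup>a\<close>, shifts
        the translation part by m i.\<close>
      have "int m dvd h - 1" using A_subset(2)[OF h(1)] by (simp only: cong_iff_dvd_diff)
      then obtain w where w: "h - 1 = int m * w" ..
      have "coprime w (int ?q)"
        by (rule coprime_divisors[OF _ dvd_refl A_minus_one[OF h]]) (simp add: w)
      then obtain x where x: "[w * x = 1] (mod int ?q)" using cong_solve_coprime_int by blast
      have "[w * x * (- i) = 1 * (- i)] (mod int ?q)" by (rule cong_mult[OF x cong_refl])
      then have "int ?q dvd w * x * (- i) + i" by (simp add: cong_iff_dvd_diff)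
      then have "int m * int ?q dvd int m * (w * x * (- i) + i)" by (rule mult_dvd_mono[OF dvd_refl])
      then have "int n dvd (h - 1) * (x * (- i)) + int m * i" unfolding w int_n by (simp add: algebra_simps)
      moreover have "(z0 + int m * i) - (t * k + (l + x * (- i)) - h * (l + x * (- i))) = (h - 1) * (x * (- i)) + int m * i"
        by (simp add: z0_def algebra_simps)
      ultimately have "[z0 + int m * i = t * k + (l + x * (- i)) - h * (l + x * (- i))] (mod int n)"
        by (simp only: cong_iff_dvd_diff)
      then have "y = E (t * k + (l + x * (- i)) - h * (l + x * (- i))) h" unfolding i by (rule E_cong[OF _ cong_refl])
      then have "y \<in> ?K" unfolding conj_class_E[OF hH] using t by blast
      moreover have "\<phi> y = c" unfolding i y0(2) y0E \<phi>E z0_def by simp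
      ultimately show "y \<in> {y \<in> ?K. \<phi> y = c}" by simp
    qed
    have inj: "inj_on (\<lambda>i. E (z0 + int m * i) h) {0..<int ?q}"
    proof (rule inj_onI)
      fix i j assume ij: "i \<in> {0..<int ?q}" "j \<in> {0..<int ?q}" and "E (z0 + int m * i) h = E (z0 + int m * j) h"
      then have "[z0 + int m * i = z0 + int m * j] (mod int ?q)" unfolding E_eq_iff cong_n_iff by blast
      then have "[int m * i = int m * j] (mod int ?q)" by (simp only: cong_add_lcancel)
      moreover have "coprime (int m) (int ?q)" using coprime_pm by (simp only: coprime_commute)
      ultimately have "[i = j] (mod int ?q)" by (simp only: cong_mult_lcancel)
      then show "i = j" using ij by (simp add: cong_def)
    qed
    have "(\<Sum>y | y \<in> ?K \<and> \<phi> y = c. \<theta> y) = (\<Sum>i\<in>{0..<int ?q}. \<theta> (E (z0 + int m * i) h))"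
      by (simp only: fib sum.reindex[OF inj] o_def)
    also have "\<dots> = (\<Sum>i\<in>{0..<int ?q}. \<theta> (E z0 h))"
    proof (rule sum.cong[OF refl])
      fix i
      have "int ?q dvd eps" using eps(2) by (simp only: cong_0_iff)
      then have "int n dvd eps * (int m * i)" unfolding int_n mult.assoc[symmetric] by (intro dvd_mult2 mult_dvd_mono) simp_all
      then have "[eps * (z0 + int m * i) = eps * z0] (mod int n)" by (simp add: cong_iff_dvd_diff algebra_simps)
      then show "\<theta> (E (z0 + int m * i) h) = \<theta> (E z0 h)"
        unfolding \<theta>E[of "z0 + int m * i"] \<theta>E[of z0] by (simp add: zeta_cong[OF n])
    qed
    also have "\<dots> = \<theta> (E z0 h) * of_nat ?q" by (simp add: mult.commute)
    also have "\<dots> \<in> M" by (rule M_props(4)[OF qM NA.lin_char_algebraic_int[OF Theta_D(1)[OF \<theta>]]])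
    finally show "(\<Sum>y | y \<in> ?K \<and> \<phi> y = c. \<theta> y) \<in> M" .
  qed
  finally show ?thesis .
qed

definition block :: "(nat \<Rightarrow> complex) set" where
  "block = {\<psi> \<in> Irr G. same_block p G \<chi> \<psi>}"

text \<open>If \<open>\<psi>\<close> lies over \<open>\<lambda>\<^sub>j\<close> with \<open>j\<close>
  not congruent modulo \<open>m\<close> to an element of \<open>H\<close>, then pairing the difference
  of the central characters of \<open>\<chi>\<close> and \<open>\<psi>\<close> with
  \<open>\<psi>\<^sub>0\<close> on the \<open>p'\<close>-elements gives \<open>m\<close>, which does not
  vanish modulo \<open>M\<close>; so \<open>\<psi>\<close> is not in the block. Conversely, the
  characters inducing the listed ones agree with \<open>\<lambda>\<^sub>1\<close> modulo
  \<open>M\<close> on \<open>C\<close>, and on classes outside \<open>C\<close> their sums vanish modulo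
  \<open>M\<close>.\<close>

lemma block_eq: "block = ind_C ` block_labels \<union> ind_A ` Theta"
proof (intro equalityI subsetI)
  fix \<psi> assume "\<psi> \<in> block"
  then have \<psi>: "\<psi> \<in> Irr G" "same_block p G \<chi> \<psi>" by (simp_all add: block_def)
  show "\<psi> \<in> ind_C ` block_labels \<union> ind_A ` Theta"
  proof (rule Irr_cases[OF \<psi>(1)])
    fix j assume j: "\<And>x. x \<in> above trivial_units \<Longrightarrow> central_character G \<psi> x = (\<Sum>y\<in>conj_class G x. lam j y)"
      and cls: "\<And>t. t \<in> H \<Longrightarrow> [j = t] (mod int m) \<Longrightarrow> \<psi> \<in> ind_C ` block_labels \<union> ind_A ` Theta"
    have "\<exists>t\<in>H. [j = t] (mod int m)"
    proof (rule ccontr)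
      assume no: "\<not> ?thesis"
      have "(\<Sum>x\<in>C_pprime. psi0_inv x * (lam 1 x - lam j x)) \<in> M"
      proof (rule sum_class_function[OF _ C_pprime_conj psi0_inv_class])
        show "C_pprime \<subseteq> carrier G" using C_pprime_carrier by blast
        fix x assume x: "x \<in> C_pprime"
        have "central_character G \<chi> x - central_character G \<psi> x \<in> M"
          using \<psi>(2) C_pprime_carrier[OF x] by (simp add: same_block_def)
        then have "(\<Sum>y\<in>conj_class G x. lam 1 y - lam j y) \<in> M"
          using C.central_character_induced[OF lam_lin_char C_pprime_carrier[OF x], of 1] j[OF C_pprime_C[OF x]]
          by (simp add: sum_subtractf)
        then show "psi0_inv x * (\<Sum>y\<in>conj_class G x. lam 1 y - lam j y) \<in> M"
          by (rule M_props(4)[OF _ psi0_inv_algebraic_int[OF C_pprime_carrier[OF x]]])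
      qed (simp_all add: M_props)
      moreover have "(\<Sum>x\<in>C_pprime. psi0_inv x * (lam 1 x - lam j x)) = of_nat m"
      proof -
        have "\<exists>t\<in>H. [1 = t] (mod int m)" by (rule bexI[OF cong_refl H_one])
        then show ?thesis using no sum_psi0_inv_lam[of 1] sum_psi0_inv_lam[of j] by (simp add: right_diff_distrib sum_subtractf)
      qed
      ultimately show False using m_notin_M by simp
    qed
    then show ?thesis using cls by blast
  qed
next
  fix \<psi> assume "\<psi> \<in> ind_C ` block_labels \<union> ind_A ` Theta"
  then show "\<psi> \<in> block"
  proof
    assume "\<psi> \<in> ind_C ` block_labels"
    then obtain j where j: "[j = 1] (mod int m)" "\<not> int (p ^ a) dvd j" "\<psi> = ind_C j" by (auto simp: block_labels_def)
    have "same_block p G \<chi> \<psi>"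
      unfolding same_block_def
    proof
      fix x assume x: "x \<in> carrier G"
      have "(\<Sum>y\<in>conj_class G x. lam 1 y - lam j y) \<in> M"
        by (intro max_ideal_sum[OF p] lam_diff_M cong_sym[OF j(1)])
      then show "central_character G \<chi> x - central_character G \<psi> x \<in> M"
        unfolding j(3) C.central_character_induced[OF lam_lin_char x] by (simp add: sum_subtractf)
    qed
    then show ?thesis using ind_C_Irr[OF stab_J[OF j(1,2)]] j(3) by (simp add: block_def)
  next
    assume "\<psi> \<in> ind_A ` Theta"
    then obtain \<theta> where \<theta>: "\<theta> \<in> Theta" "\<psi> = ind_A \<theta>" by blast
    have "same_block p G \<chi> \<psi>"
      unfolding same_block_def
    proof
      fix x assume x: "x \<in> carrier G"
      obtain k h where kh: "x = E k h" "h \<in> H" using x by (rule carrierE)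
      have form: "\<exists>z. y = E z h" if "y \<in> conj_class G x" for y
        using that unfolding kh(1) conj_class_E[OF kh(2)] by blast
      have "(\<Sum>y\<in>conj_class G x. lam 1 y - \<theta> y) \<in> M"
      proof (cases "h \<in> A \<and> \<not> [h = 1] (mod int n)")
        case True
        have "(\<Sum>y\<in>conj_class G x. lam 1 y - \<theta> y) = - (\<Sum>y\<in>conj_class G x. \<theta> y)"
        proof -
          have "lam 1 y = 0" if y: "y \<in> conj_class G x" for y
          proof -
            obtain z where "y = E z h" using form[OF y] by (elim exE)
            then show ?thesis using True by (simp add: lam_E)
          qed
          then have "(\<Sum>y\<in>conj_class G x. lam 1 y) = 0" by (intro sum.neutral ballI)
          then show ?thesis by (simp add: sum_subtractf)
        qed
        also have "\<dots> \<in> M" unfolding kh(1) using True by (intro max_ideal_uminus[OF p] theta_class_sum_in_M[OF \<theta>(1)]) simp_all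
        finally show ?thesis .
      next
        case False
        show ?thesis
        proof (rule max_ideal_sum[OF p])
          fix y assume "y \<in> conj_class G x"
          then obtain z where z: "y = E z h" using form by blast
          have "\<theta> y = lam eps y"
          proof (cases "h \<in> A")
            case True
            then have "y \<in> above trivial_units" using False by (simp add: z E_in_C)
            then show ?thesis by (rule Theta_D(2)[OF \<theta>(1)])
          next
            case hA: False
            then have "\<theta> y = 0" using lin_charD(3)[OF Theta_D(1)[OF \<theta>(1)]] by (simp add: z E_in_NA)
            moreover have "\<not> [h = 1] (mod int n)" using hA unit_subgroup_cong[OF A_subgroup, of h 1] A_one by blast
            ultimately show ?thesis by (simp add: z lam_E)
          qed
          then show "lam 1 y - \<theta> y \<in> M" using lam_diff_M[OF cong_sym[OF eps(1)]] by simp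
        qed
      qed
      then show "central_character G \<chi> x - central_character G \<psi> x \<in> M"
        unfolding \<theta>(2) C.central_character_induced[OF lam_lin_char x] NA.central_character_induced[OF Theta_D(1)[OF \<theta>(1)] x]
        by (simp add: sum_subtractf)
    qed
    then show ?thesis using ind_A_Irr[OF \<theta>(1)] \<theta>(2) by (simp add: block_def)
  qed
qed

lemma ind_C_one: "ind_C j \<one>\<^bsub>G\<^esub> = of_nat (card (residues H))"
  using C.induced_one[OF lam_lin_char, of j] n by (simp add: card_G card_C)

lemma ind_A_one: "\<theta> \<in> Theta \<Longrightarrow> ind_A \<theta> \<one>\<^bsub>G\<^esub> = of_nat (card (residues H)) / of_nat (card (residues A))"
  using NA.induced_one[OF Theta_D(1)] n by (simp add: card_G card_above[OF A_subgroup])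

lemma ind_C_pprime:
  assumes j: "[j = 1] (mod int m)" and x: "x \<in> C_pprime"
  shows "ind_C j (inv\<^bsub>G\<^esub> x) = of_nat (card (residues A)) * psi0_inv x"
proof -
  obtain i where i: "x = E (int (p ^ a) * i) 1" using x by (auto simp: C_pprime_def)
  let ?c = "int (p ^ a) * i"
  have "ind_C j (inv\<^bsub>G\<^esub> x) = (\<Sum>t\<in>residues H. zeta n (j * t * (- ?c)))"
    unfolding i inv_E1 by (simp only: induced_lam_E[OF H_one] cong_refl if_True)
  also have "\<dots> = (\<Sum>t\<in>residues H. zeta n (- (eps * t * ?c)))"
  proof (intro sum.cong refl zeta_cong[OF n])
    fix t
    have "int m dvd j - eps" using j eps(1) cong_sym cong_trans unfolding cong_iff_dvd_diff[symmetric] by blast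
    then have "int (p ^ a) * int m dvd int (p ^ a) * ((j - eps) * (- (t * i)))" by (intro mult_dvd_mono dvd_refl dvd_mult2)
    moreover have "int (p ^ a) * ((j - eps) * (- (t * i))) = j * t * (- ?c) - (- (eps * t * ?c))" by (simp add: algebra_simps)
    ultimately show "[j * t * (- ?c) = - (eps * t * ?c)] (mod int n)" by (simp only: cong_iff_dvd_diff int_n)
  qed
  also have "\<dots> = of_nat (card (residues A)) * psi0_inv x"
    unfolding i psi0_inv_E using card_residues_pos[OF A_subgroup] by simp
  finally show ?thesis .
qed

lemma ind_A_pprime:
  assumes \<theta>: "\<theta> \<in> Theta" and x: "x \<in> C_pprime"
  shows "ind_A \<theta> (inv\<^bsub>G\<^esub> x) = psi0_inv x"
proof -
  obtain c where c: "x = E c 1" using C_E[OF C_pprime_C[OF x]] by (elim exE)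
  have "\<theta> (E 0 1) = 1" using NA.lin_char_one[OF Theta_D(1)[OF \<theta>]] by (simp add: G_one)
  then show ?thesis unfolding c inv_E1 ind_A_E[OF \<theta> H_one] psi0_inv_E by simp
qed

lemma inj_ind_A: "inj_on ind_A Theta"
proof (rule inj_onI)
  fix \<theta> \<eta> assume \<theta>: "\<theta> \<in> Theta" and \<eta>: "\<eta> \<in> Theta" and eq: "ind_A \<theta> = ind_A \<eta>"
  have c0: "of_nat (card (residues H)) / of_nat (card (residues A)) \<noteq> (0 :: complex)"
    using card_residues_pos[OF A_subgroup] card_residues_pos[OF H_subgroup] by simp
  have e0: "\<theta> (E 0 h) = \<eta> (E 0 h)" if h: "h \<in> A" for h
    using arg_cong[OF eq, of "\<lambda>f. f (E 0 h)"] c0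
    unfolding ind_A_E[OF \<theta> A_subset(1)[OF h]] ind_A_E[OF \<eta> A_subset(1)[OF h]] by simp
  show "\<theta> = \<eta>"
  proof
    fix x
    show "\<theta> x = \<eta> x"
    proof (cases "x \<in> above A")
      case True
      obtain k h where "x = E k h" "h \<in> A" using above_A_E[OF True] by (elim exE conjE)
      then show ?thesis
        using e0 lin_char_above_E[OF A_subgroup Theta_D[OF \<theta>], of k h] lin_char_above_E[OF A_subgroup Theta_D[OF \<eta>], of k h] by simp
    next
      case False
      then show ?thesis using lin_charD(3)[OF Theta_D(1)[OF \<theta>]] lin_charD(3)[OF Theta_D(1)[OF \<eta>]] by simp
    qed
  qed
qed

lemma ind_C_trace: "ind_C j (E k 1) = (\<Sum>t\<in>residues H. zeta n (j * t * k))"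
  by (simp only: induced_lam_E[OF H_one] cong_refl if_True)

lemma families_disjoint: "ind_C ` block_labels \<inter> ind_A ` Theta = {}"
proof (rule ccontr)
  assume "\<not> ?thesis"
  then obtain j \<theta> where j: "j \<in> block_labels" and \<theta>: "\<theta> \<in> Theta" and eq: "ind_C j = ind_A \<theta>" by auto
  let ?A = "of_nat (card (residues A)) :: complex"
  have "\<theta> (E 0 1) = 1" using NA.lin_char_one[OF Theta_D(1)[OF \<theta>]] by (simp add: G_one)
  then have "(\<Sum>t\<in>residues H. zeta n (j * t * k)) = inverse ?A * (\<Sum>t\<in>residues H. zeta n (eps * t * k))" for k
    using arg_cong[OF eq, of "\<lambda>f. f (E k 1)"] unfolding ind_C_trace ind_A_E[OF \<theta> H_one] by (simp add: field_simps)
  moreover have "inverse ?A \<noteq> 0" using card_residues_pos[OF A_subgroup] by simp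
  ultimately show False
  proof (rule trace_orthogonality)
    fix t assume t: "t \<in> H" "[j * t = eps] (mod int n)"
    have "[j * t = eps] (mod int (p ^ a))" using t(2) unfolding cong_n_iff by blast
    then have "[j * t = 0] (mod int (p ^ a))" using eps(2) by (rule cong_trans)
    then have "int (p ^ a) dvd j * t" by (simp only: cong_0_iff)
    moreover have "coprime (int (p ^ a)) t"
      by (rule coprime_divisors[OF _ dvd_refl, of _ "int n"]) (use H_coprime[OF t(1)] in \<open>simp_all add: int_n coprime_commute\<close>)
    ultimately have "int (p ^ a) dvd j" by (simp only: coprime_dvd_mult_left_iff)
    then show False using j by (simp add: block_labels_def)
  qed
qed

text \<open>The characters \<open>\<lambda>\<^sub>i\<close> and \<open>\<lambda>\<^sub>j\<close> induce
  the same character iff \<open>i\<close> and \<open>j\<close> are conjugate under \<open>H\<close>,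
  hence under \<open>A\<close> as both are one modulo \<open>m\<close>; and \<open>A\<close> acts freely
  on the labels.\<close>

lemma card_fibre:
  assumes j: "j \<in> block_labels"
  shows "card {i \<in> block_labels. ind_C i = ind_C j} = card (residues A)"
proof -
  have jm: "[j = 1] (mod int m)" "\<not> int (p ^ a) dvd j" "j \<in> {0..<int n}" using j by (auto simp: block_labels_def)
  have "bij_betw (\<lambda>t. (j * t) mod int n) (residues A) {i \<in> block_labels. ind_C i = ind_C j}"
  proof -
    have inj: "inj_on (\<lambda>t. (j * t) mod int n) (residues A)"
    proof (rule inj_onI)
      fix t u assume t: "t \<in> residues A" and u: "u \<in> residues A" and eq: "(j * t) mod int n = (j * u) mod int n"
      have tH: "t \<in> H" and uH: "u \<in> H" using t u A_subset(1) by (auto simp: residues_def)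
      obtain w where w: "w \<in> H" "[u * w = 1] (mod int n)" using H_inverse[OF uH] by blast
      have "[j * t * w = j * u * w] (mod int n)" by (rule cong_mult[OF _ cong_refl]) (use eq in \<open>simp only: cong_def\<close>)
      moreover have "[j * (u * w) = j * 1] (mod int n)" by (rule cong_mult[OF cong_refl w(2)])
      ultimately have "[j * (t * w) = j] (mod int n)" by (simp only: mult.assoc mult_1_right) (rule cong_trans)
      then have "t * w \<in> trivial_units" by (rule stab_J[OF jm(1,2) H_mult[OF tH w(1)]])
      then have "[t * w = 1] (mod int n)" by (simp add: trivial_units_def)
      then have "[t * w = u * w] (mod int n)" using w(2) cong_sym cong_trans by blast
      then have "[t = u] (mod int n)" using H_coprime[OF w(1)] by (simp only: cong_mult_rcancel)
      then show "t = u" using t u by (simp add: residues_def cong_def)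
    qed
    have im: "(\<lambda>t. (j * t) mod int n) ` residues A = {i \<in> block_labels. ind_C i = ind_C j}"
    proof (intro equalityI subsetI)
      fix i assume "i \<in> (\<lambda>t. (j * t) mod int n) ` residues A"
      then obtain t where t: "t \<in> A" "i = (j * t) mod int n" by (auto simp: residues_def)
      note tH = A_subset(1)[OF t(1)]
      have ic: "[i = j * t] (mod int n)" by (simp add: t(2) cong_def)
      have "[i = j * t] (mod int m)" using ic unfolding cong_n_iff by blast
      moreover have "[j * t = 1 * 1] (mod int m)" by (rule cong_mult[OF jm(1) A_subset(2)[OF t(1)]])
      ultimately have im: "[i = 1] (mod int m)" by (simp only: mult_1_left) (rule cong_trans)
      have "\<not> int (p ^ a) dvd i"
      proof
        assume "int (p ^ a) dvd i"
        moreover have "[i = j * t] (mod int (p ^ a))" using ic unfolding cong_n_iff by blast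
        ultimately have "int (p ^ a) dvd j * t" by (simp only: cong_dvd_iff)
        moreover have "coprime (int (p ^ a)) t"
          by (rule coprime_divisors[OF _ dvd_refl, of _ "int n"]) (use H_coprime[OF tH] in \<open>simp_all add: int_n coprime_commute\<close>)
        ultimately show False using jm(2) by (simp only: coprime_dvd_mult_left_iff)
      qed
      then have "i \<in> block_labels" using im n t(2) by (simp add: block_labels_def)
      moreover have "ind_C i = ind_C j"
      proof
        fix x
        show "ind_C i x = ind_C j x"
        proof (cases "x \<in> carrier G")
          case True
          obtain k h where kh: "x = E k h" "h \<in> H" using True by (rule carrierE)
          have "(\<Sum>r\<in>residues H. zeta n (i * r * k)) = (\<Sum>r\<in>residues H. zeta n (j * t * r * k))"
            by (intro sum.cong refl zeta_cong[OF n] cong_mult[OF cong_mult[OF ic cong_refl] cong_refl])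
          also have "\<dots> = (\<Sum>r\<in>residues H. zeta n (j * r * k))" by (rule sum_residues_mult[OF tH])
          finally show ?thesis unfolding kh(1) induced_lam_E[OF kh(2)] by simp
        qed (simp add: induced_def)
      qed
      ultimately show "i \<in> {i \<in> block_labels. ind_C i = ind_C j}" by blast
    next
      fix i assume "i \<in> {i \<in> block_labels. ind_C i = ind_C j}"
      then have i: "[i = 1] (mod int m)" "i \<in> {0..<int n}" and eq: "ind_C i = ind_C j" by (auto simp: block_labels_def)
      have "(\<Sum>t\<in>residues H. zeta n (j * t * k)) = 1 * (\<Sum>t\<in>residues H. zeta n (i * t * k))" for k
        using arg_cong[OF eq, of "\<lambda>f. f (E k 1)"] unfolding ind_C_trace by simp
      then show "i \<in> (\<lambda>t. (j * t) mod int n) ` residues A"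
      proof (rule trace_orthogonality)
        fix t assume t: "t \<in> H" "[j * t = i] (mod int n)"
        have "[j * t = i] (mod int m)" using t(2) unfolding cong_n_iff by blast
        then have "[j * t = 1] (mod int m)" using i(1) by (rule cong_trans)
        moreover have "[j * t = 1 * t] (mod int m)" by (rule cong_mult[OF jm(1) cong_refl])
        ultimately have "[1 * t = 1] (mod int m)" using cong_sym cong_trans by blast
        then have "t \<in> A" using A_I[OF t(1)] by simp
        moreover have tc: "[t mod int n = t] (mod int n)" by (simp add: cong_def)
        ultimately have "t mod int n \<in> residues A" using unit_subgroup_cong[OF A_subgroup tc] n by (simp add: residues_def)
        moreover have "i = (j * (t mod int n)) mod int n"
        proof -
          have "(j * (t mod int n)) mod int n = (j * t) mod int n" by (rule mod_mult_right_eq)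
          also have "\<dots> = i mod int n" using t(2) by (simp only: cong_def)
          also have "\<dots> = i" using i(2) by simp
          finally show ?thesis by simp
        qed
        ultimately show ?thesis by (rule image_eqI[rotated])
      qed simp
    qed
    show ?thesis unfolding bij_betw_def using inj im by blast
  qed
  then show ?thesis by (rule bij_betw_same_card[symmetric])
qed

text \<open>There are \<open>p\<^sup>a\<close> labels that are one modulo \<open>m\<close>, and among
  them \<open>\<epsilon>\<close> is the only one divisible by \<open>p\<^sup>a\<close>.\<close>

lemma card_block_labels: "card block_labels = p ^ a - 1"
proof -
  let ?J = "{j \<in> {0..<int n}. [j = 1] (mod int m)}"
  have "bij_betw (\<lambda>i. (1 + int m * i) mod int n) {0..<int (p ^ a)} ?J"
  proof -
    have inj: "inj_on (\<lambda>i. (1 + int m * i) mod int n) {0..<int (p ^ a)}"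
    proof (rule inj_onI)
      fix i j assume ij: "i \<in> {0..<int (p ^ a)}" "j \<in> {0..<int (p ^ a)}" and "(1 + int m * i) mod int n = (1 + int m * j) mod int n"
      then have "[1 + int m * i = 1 + int m * j] (mod int n)" by (simp only: cong_def)
      then have "[1 + int m * i = 1 + int m * j] (mod int (p ^ a))" unfolding cong_n_iff by blast
      then have "[int m * i = int m * j] (mod int (p ^ a))" by (simp only: cong_add_lcancel)
      moreover have "coprime (int m) (int (p ^ a))" using coprime_pm by (simp only: coprime_commute)
      ultimately have "[i = j] (mod int (p ^ a))" by (simp only: cong_mult_lcancel)
      then show "i = j" using ij by (simp add: cong_def)
    qed
    have im: "(\<lambda>i. (1 + int m * i) mod int n) ` {0..<int (p ^ a)} = ?J"
    proof (intro equalityI subsetI)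
      fix j assume "j \<in> (\<lambda>i. (1 + int m * i) mod int n) ` {0..<int (p ^ a)}"
      then obtain i where i: "j = (1 + int m * i) mod int n" by blast
      then have "[j = 1 + int m * i] (mod int n)" by (simp add: cong_def)
      then have "[j = 1 + int m * i] (mod int m)" unfolding cong_n_iff by blast
      moreover have "[1 + int m * i = 1] (mod int m)" by (simp add: cong_iff_dvd_diff)
      ultimately have "[j = 1] (mod int m)" by (rule cong_trans)
      then show "j \<in> ?J" using i n by simp
    next
      fix j assume j: "j \<in> ?J"
      then have "int m dvd j - 1" by (simp add: cong_iff_dvd_diff)
      then obtain w where w: "j - 1 = int m * w" ..
      have "[int m * w = int m * (w mod int (p ^ a))] (mod int n)"
        by (simp only: cong_def int_n mult.commute[of "int (p ^ a)"] mod_mod_trivial flip: mult_mod_right)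
      then have "[1 + int m * w = 1 + int m * (w mod int (p ^ a))] (mod int n)" by (rule cong_add[OF cong_refl])
      moreover have "1 + int m * w = j" using w by simp
      ultimately have "[j = 1 + int m * (w mod int (p ^ a))] (mod int n)" by (simp only:)
      then have "j = (1 + int m * (w mod int (p ^ a))) mod int n" using j by (simp add: cong_def)
      moreover have "w mod int (p ^ a) \<in> {0..<int (p ^ a)}" using p0 by simp
      ultimately show "j \<in> (\<lambda>i. (1 + int m * i) mod int n) ` {0..<int (p ^ a)}" by (rule image_eqI)
    qed
    show ?thesis unfolding bij_betw_def using inj im by blast
  qed
  then have "card ?J = card {0..<int (p ^ a)}" by (rule bij_betw_same_card[symmetric])
  then have cJ: "card ?J = p ^ a" by (simp only: card_atLeastLessThan_int diff_zero nat_int)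
  have e: "[eps mod int n = eps] (mod int n)" by (simp add: cong_def)
  have em: "[eps mod int n = eps] (mod int m)" and ep: "[eps mod int n = eps] (mod int (p ^ a))"
    using e unfolding cong_n_iff by blast+
  have e1: "[eps mod int n = 1] (mod int m)" by (rule cong_trans[OF em eps(1)])
  have e2: "int (p ^ a) dvd eps mod int n"
    using cong_trans[OF ep eps(2)] by (simp only: cong_0_iff)
  have "block_labels = ?J - {eps mod int n}"
  proof (intro equalityI subsetI)
    fix j assume "j \<in> block_labels"
    then show "j \<in> ?J - {eps mod int n}" using e2 by (auto simp: block_labels_def)
  next
    fix j assume j: "j \<in> ?J - {eps mod int n}"
    have "\<not> int (p ^ a) dvd j"
    proof
      assume "int (p ^ a) dvd j"
      then have "[j = eps] (mod int n)" using eps_unique j by blast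
      then have "j = eps mod int n" using j by (simp add: cong_def)
      then show False using j by simp
    qed
    then show "j \<in> block_labels" using j by (simp add: block_labels_def)
  qed
  moreover have "eps mod int n \<in> ?J" using e1 n by simp
  ultimately show ?thesis using cJ by simp
qed

text \<open>At \<open>p'\<close>-elements, the \<open>(p\<^sup>a - 1) / |A|\<close> characters of degree
  \<open>|H|\<close> take \<open>|A|\<close> times the values of \<open>\<psi>\<^sub>0\<close>, and the
  \<open>|A|\<close> characters of degree \<open>|H| / |A|\<close> take the values of
  \<open>\<psi>\<^sub>0\<close>. Together they contribute \<open>p\<^sup>a |H|\<close> times
  \<open>\<psi>\<^sub>0(x\<^bsup>-1\<^esup>)\<close>, and \<open>|G| = p\<^sup>a m |H|\<close>.\<close>

lemma block_sum:
  assumes x: "x \<in> C_pprime"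
  shows "block_idempotent_coeff G block x = psi0_inv x / of_nat m"
proof -
  let ?A = "of_nat (card (residues A)) :: complex" and ?H = "of_nat (card (residues H)) :: complex"
  have A0: "?A \<noteq> 0" using card_residues_pos[OF A_subgroup] by simp
  have H0: "?H \<noteq> 0" using card_residues_pos[OF H_subgroup] by simp
  define T where "T \<psi> = \<psi> \<one>\<^bsub>G\<^esub> * \<psi> (inv\<^bsub>G\<^esub> x)" for \<psi> :: "nat \<Rightarrow> complex"
  have finJ: "finite block_labels" by (rule finite_subset[of _ "{0..<int n}"]) (auto simp: block_labels_def)
  have "(\<Sum>j\<in>block_labels. T (ind_C j)) = (\<Sum>\<psi>\<in>ind_C ` block_labels. \<Sum>j | j \<in> block_labels \<and> ind_C j = \<psi>. T (ind_C j))"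
    by (rule sum.image_gen[OF finJ])
  also have "\<dots> = (\<Sum>\<psi>\<in>ind_C ` block_labels. ?A * T \<psi>)"
  proof (rule sum.cong[OF refl])
    fix \<psi> assume "\<psi> \<in> ind_C ` block_labels"
    then obtain j where j: "j \<in> block_labels" "\<psi> = ind_C j" by blast
    have "(\<Sum>i | i \<in> block_labels \<and> ind_C i = \<psi>. T (ind_C i)) = (\<Sum>i | i \<in> block_labels \<and> ind_C i = \<psi>. T \<psi>)" by (rule sum.cong) simp_all
    also have "\<dots> = ?A * T \<psi>" using card_fibre[OF j(1)] by (simp add: j(2))
    finally show "(\<Sum>i | i \<in> block_labels \<and> ind_C i = \<psi>. T (ind_C i)) = ?A * T \<psi>" .
  qed
  finally have "?A * (\<Sum>\<psi>\<in>ind_C ` block_labels. T \<psi>) = (\<Sum>j\<in>block_labels. T (ind_C j))" by (simp add: sum_distrib_left)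
  also have "\<dots> = (\<Sum>j\<in>block_labels. ?H * (?A * psi0_inv x))"
    by (intro sum.cong refl) (simp add: T_def ind_C_one ind_C_pprime[OF _ x] block_labels_def)
  also have "\<dots> = ?A * (of_nat (p ^ a - 1) * ?H * psi0_inv x)" by (simp add: card_block_labels)
  finally have S1: "(\<Sum>\<psi>\<in>ind_C ` block_labels. T \<psi>) = of_nat (p ^ a - 1) * ?H * psi0_inv x" using A0 by simp
  have "(\<Sum>\<psi>\<in>ind_A ` Theta. T \<psi>) = (\<Sum>\<theta>\<in>Theta. T (ind_A \<theta>))" by (simp add: sum.reindex[OF inj_ind_A])
  also have "\<dots> = (\<Sum>\<theta>\<in>Theta. ?H / ?A * psi0_inv x)"
    by (intro sum.cong refl) (simp add: T_def ind_A_one ind_A_pprime[OF _ x])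
  also have "\<dots> = ?H * psi0_inv x" using A0 by (simp add: Theta_card(2))
  finally have S2: "(\<Sum>\<psi>\<in>ind_A ` Theta. T \<psi>) = ?H * psi0_inv x" .
  have "(\<Sum>\<psi>\<in>block. T \<psi>) = of_nat (p ^ a - 1) * ?H * psi0_inv x + ?H * psi0_inv x"
    unfolding block_eq S1[symmetric] S2[symmetric]
    by (rule sum.union_disjoint[OF _ _ families_disjoint]) (simp_all add: finJ Theta_card(1))
  also have "\<dots> = of_nat (p ^ a) * ?H * psi0_inv x"
  proof -
    obtain k where k: "p ^ a = Suc k" using q0 gr0_implies_Suc by blast
    have "of_nat (p ^ a - 1) = (of_nat (p ^ a) - 1 :: complex)"
      by (simp only: k diff_Suc_1 of_nat_Suc add_diff_cancel_left')
    then show ?thesis by (simp only: left_diff_distrib mult_1_left diff_add_cancel)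
  qed
  finally have "(\<Sum>\<psi>\<in>block. T \<psi>) = of_nat (p ^ a) * ?H * psi0_inv x" .
  moreover have "of_nat (card (carrier G)) = of_nat (p ^ a) * of_nat m * ?H"
    using arg_cong[OF nam, of "of_nat :: nat \<Rightarrow> complex"] by (simp only: card_G of_nat_mult)
  moreover have "of_nat (p ^ a) \<noteq> (0 :: complex)" using q0 by (simp only: of_nat_eq_0_iff)
  moreover have "of_nat m \<noteq> (0 :: complex)" using m0 by simp
  ultimately show ?thesis using H0 unfolding block_idempotent_coeff_def T_def[symmetric] by (simp only: divide_eq_eq mult_eq_0_iff) (simp add: mult_ac)
qed

text \<open>The \<open>p'\<close>-elements \<open>x\<close> contribute \<open>m\<close> in total to the
  sum of \<open>\<psi>\<^sub>0(x\<^bsup>-1\<^esup>) \<lambda>\<^sub>1(x)\<close>, so some class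
  contributes an element outside \<open>M\<close>. That contribution is
  \<open>\<psi>\<^sub>0(x\<^bsup>-1\<^esup>)\<close> times the central character of
  \<open>\<chi>\<close>.\<close>

lemma defect_element_exists:
  obtains x where "x \<in> C_pprime" "psi0_inv x \<notin> M" "central_character G \<chi> x \<notin> M"
proof -
  have "\<exists>x\<in>C_pprime. psi0_inv x * (\<Sum>y\<in>conj_class G x. lam 1 y) \<notin> M"
  proof (rule ccontr)
    assume "\<not> ?thesis"
    then have *: "psi0_inv x * (\<Sum>y\<in>conj_class G x. lam 1 y) \<in> M" if "x \<in> C_pprime" for x using that by blast
    have "(\<Sum>x\<in>C_pprime. psi0_inv x * lam 1 x) \<in> M"
    proof (rule sum_class_function[OF _ C_pprime_conj psi0_inv_class _ _ *])
      show "C_pprime \<subseteq> carrier G" using C_pprime_carrier by blast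
    qed (simp_all add: M_props)
    moreover have "(\<Sum>x\<in>C_pprime. psi0_inv x * lam 1 x) = of_nat m"
    proof -
      have "\<exists>t\<in>H. [1 = t] (mod int m)" by (rule bexI[OF cong_refl H_one])
      then show ?thesis by (simp add: sum_psi0_inv_lam)
    qed
    ultimately show False using m_notin_M by simp
  qed
  then obtain x where x: "x \<in> C_pprime" "psi0_inv x * (\<Sum>y\<in>conj_class G x. lam 1 y) \<notin> M" by blast
  have alg: "algebraic_int (\<Sum>y\<in>I. lam 1 y)" for I
    by (induction I rule: infinite_finite_induct) (simp_all add: algebraic_int_add_mult(1) C.lin_char_algebraic_int[OF lam_lin_char])
  have "psi0_inv x \<notin> M"
    using x(2) M_props(4)[OF _ alg, of "psi0_inv x" "conj_class G x"] by (metis mult.commute)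
  moreover have "(\<Sum>y\<in>conj_class G x. lam 1 y) \<notin> M"
    using x(2) M_props(4)[OF _ psi0_inv_algebraic_int[OF C_pprime_carrier[OF x(1)]]] by blast
  then have "central_character G \<chi> x \<notin> M"
    using C.central_character_induced[OF lam_lin_char C_pprime_carrier[OF x(1)], of 1] by simp
  ultimately show ?thesis using that x(1) by blast
qed

end

section \<open>Centralizers of translations and the defect group\<close>

context unit_group
begin

definition stab :: "int \<Rightarrow> int set" where
  "stab c = {h \<in> H. [h * c = c] (mod int n)}"

lemma stab_cancel:
  assumes "t \<in> H" "[t * c = t * d] (mod int n)"
  shows "[c = d] (mod int n)"
  using assms(2) H_coprime[OF assms(1)] by (simp only: cong_mult_lcancel)

lemma stab_subgroup: "unit_subgroup (stab c)"
  unfolding unit_subgroup_def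
proof (intro conjI ballI allI impI)
  show "stab c \<subseteq> H" by (auto simp: stab_def)
  show "1 \<in> stab c" by (simp add: stab_def H_one)
  show "h * k \<in> stab c" if h: "h \<in> stab c" and k: "k \<in> stab c" for h k
  proof -
    have "[h * (k * c) = h * c] (mod int n)" by (rule cong_mult[OF cong_refl]) (use k in \<open>simp add: stab_def\<close>)
    moreover have "[h * c = c] (mod int n)" using h by (simp add: stab_def)
    ultimately have "[h * (k * c) = c] (mod int n)" by (rule cong_trans)
    then show ?thesis using h k H_mult by (simp add: stab_def mult.assoc)
  qed
  show "k \<in> stab c" if hk: "[h = k] (mod int n)" and h: "h \<in> stab c" for h k
  proof -
    have "[k * c = h * c] (mod int n)" by (rule cong_mult[OF cong_sym[OF hk] cong_refl])
    moreover have "[h * c = c] (mod int n)" using h by (simp add: stab_def)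
    ultimately have "[k * c = c] (mod int n)" by (rule cong_trans)
    moreover have "k \<in> H" using H_cong[OF hk] h by (simp add: stab_def)
    ultimately show ?thesis by (simp add: stab_def)
  qed
  show "k \<in> stab c" if h: "h \<in> stab c" and k: "k \<in> H" and hk: "[h * k = 1] (mod int n)" for h k
  proof -
    have hH: "h \<in> H" "[h * c = c] (mod int n)" using h by (simp_all add: stab_def)
    have "[h * k * c = 1 * c] (mod int n)" by (rule cong_mult[OF hk cong_refl])
    then have "[h * (k * c) = c] (mod int n)" by (simp add: mult.assoc)
    then have "[h * (k * c) = h * c] (mod int n)" by (rule cong_trans[OF _ cong_sym[OF hH(2)]])
    then have "[k * c = c] (mod int n)" by (rule stab_cancel[OF hH(1)])
    then show ?thesis using k by (simp add: stab_def)
  qed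
qed

lemma centralizer_E: "centralizer G (E c 1) = above (stab c)"
proof -
  have *: "E k h \<otimes>\<^bsub>G\<^esub> E c 1 = E c 1 \<otimes>\<^bsub>G\<^esub> E k h \<longleftrightarrow> [h * c = c] (mod int n)" for k h
  proof -
    have "[k + h * c = c + k] (mod int n) \<longleftrightarrow> [k + h * c = k + c] (mod int n)" by (simp only: add.commute)
    then show ?thesis by (simp add: E_mult E_eq_iff cong_add_lcancel)
  qed
  show ?thesis
  proof (intro equalityI subsetI)
    fix x assume x: "x \<in> centralizer G (E c 1)"
    then have "x \<in> carrier G" by (simp add: centralizer_def)
    then obtain k h where kh: "x = E k h" "h \<in> H" by (rule carrierE)
    then have "h \<in> stab c" using x * by (simp add: centralizer_def stab_def)
    then show "x \<in> above (stab c)" unfolding kh(1) E_in_above[OF stab_subgroup] .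
  next
    fix x assume "x \<in> above (stab c)"
    then obtain k h where kh: "x = E k h" "h \<in> stab c" unfolding above_def by blast
    then show "x \<in> centralizer G (E c 1)" using * by (simp add: centralizer_def stab_def)
  qed
qed

text \<open>The summand depends only on the point \<open>t c\<close> of the orbit of \<open>c\<close>,
  and each point of the orbit is attained once for every element of the stabilizer.\<close>

lemma sum_orbit:
  "\<exists>y. algebraic_int y \<and> (\<Sum>t\<in>residues H. zeta n (j * t * c)) = of_nat (card (residues (stab c))) * y"
proof -
  let ?f = "\<lambda>t. (t * c) mod int n"
  have "(\<Sum>t\<in>residues H. zeta n (j * t * c)) = (\<Sum>v\<in>?f ` residues H. \<Sum>t | t \<in> residues H \<and> ?f t = v. zeta n (j * t * c))"
    by (rule sum.image_gen[OF finite_residues])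
  also have "\<dots> = (\<Sum>v\<in>?f ` residues H. of_nat (card (residues (stab c))) * zeta n (j * v))"
  proof (rule sum.cong[OF refl])
    fix v assume "v \<in> ?f ` residues H"
    then obtain r where r: "r \<in> H" "v = ?f r" by (auto simp: residues_def)
    have "{t \<in> residues H. ?f t = v} = {t \<in> residues H. \<exists>h\<in>stab c. [t = r * h] (mod int n)}"
    proof (intro Collect_cong conj_cong refl)
      fix t assume "t \<in> residues H"
      then have t: "t \<in> H" by (simp add: residues_def)
      show "?f t = v \<longleftrightarrow> (\<exists>h\<in>stab c. [t = r * h] (mod int n))"
      proof
        assume "?f t = v"
        then have tc: "[t * c = r * c] (mod int n)" by (simp only: r(2) cong_def)
        obtain u where u: "u \<in> H" "[r * u = 1] (mod int n)" using H_inverse[OF r(1)] by blast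
        have "[r * u * t = 1 * t] (mod int n)" by (rule cong_mult[OF u(2) cong_refl])
        then have rt: "[r * (u * t) = t] (mod int n)" by (simp add: mult.assoc)
        have "[r * (u * t) * c = t * c] (mod int n)" by (rule cong_mult[OF rt cong_refl])
        then have "[r * (u * t * c) = t * c] (mod int n)" by (simp only: mult.assoc)
        then have "[r * (u * t * c) = r * c] (mod int n)" using tc by (rule cong_trans)
        then have "[u * t * c = c] (mod int n)" by (rule stab_cancel[OF r(1)])
        then have "u * t \<in> stab c" using H_mult[OF u(1) t] by (simp add: stab_def)
        then show "\<exists>h\<in>stab c. [t = r * h] (mod int n)" using cong_sym[OF rt] by (rule bexI[rotated])
      next
        assume "\<exists>h\<in>stab c. [t = r * h] (mod int n)"
        then obtain h where h: "h \<in> stab c" "[t = r * h] (mod int n)" by (elim bexE)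
        have "[t * c = r * h * c] (mod int n)" by (rule cong_mult[OF h(2) cong_refl])
        moreover have "[r * (h * c) = r * c] (mod int n)"
          by (rule cong_mult[OF cong_refl]) (use h(1) in \<open>simp add: stab_def\<close>)
        ultimately have "[t * c = r * c] (mod int n)" by (simp only: mult.assoc) (rule cong_trans)
        then show "?f t = v" by (simp only: r(2) cong_def)
      qed
    qed
    then have card: "card {t \<in> residues H. ?f t = v} = card (residues (stab c))"
      using card_coset[OF stab_subgroup r(1)] by simp
    have "(\<Sum>t | t \<in> residues H \<and> ?f t = v. zeta n (j * t * c)) = (\<Sum>t | t \<in> residues H \<and> ?f t = v. zeta n (j * v))"
    proof (rule sum.cong[OF refl])
      fix t assume "t \<in> {t \<in> residues H. ?f t = v}"
      then have v: "v = ?f t" by simp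
      have "[t * c = v] (mod int n)" by (simp add: v cong_def)
      then have "[j * (t * c) = j * v] (mod int n)" by (rule cong_mult[OF cong_refl])
      then show "zeta n (j * t * c) = zeta n (j * v)" by (intro zeta_cong[OF n]) (simp only: mult.assoc)
    qed
    also have "\<dots> = of_nat (card (residues (stab c))) * zeta n (j * v)" by (simp add: card)
    finally show "(\<Sum>t | t \<in> residues H \<and> ?f t = v. zeta n (j * t * c)) = of_nat (card (residues (stab c))) * zeta n (j * v)" .
  qed
  finally have "(\<Sum>t\<in>residues H. zeta n (j * t * c)) = of_nat (card (residues (stab c))) * (\<Sum>v\<in>?f ` residues H. zeta n (j * v))"
    by (simp add: sum_distrib_left)
  moreover have "algebraic_int (\<Sum>v\<in>V. zeta n (j * v))" for V
    by (induction V rule: infinite_finite_induct) (simp_all add: algebraic_int_add_mult(1) zeta_algebraic_int[OF n])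
  ultimately show ?thesis by blast
qed

end

lemma p_part_mult_coprime:
  assumes p: "prime p" and k: "\<not> p dvd k" and l: "l \<noteq> 0"
  shows "p_part p (k * l) = p_part p l"
proof -
  have "k \<noteq> 0" using k by (intro notI) simp
  moreover have "prime_elem p" using p by simp
  ultimately have "multiplicity p (k * l) = multiplicity p k + multiplicity p l"
    using l by (intro prime_elem_multiplicity_mult_distrib)
  then show ?thesis using k by (simp add: p_part_def not_dvd_imp_multiplicity_0)
qed

context block_data
begin

text \<open>The Sylow \<open>p\<close>-subgroup of \<open>C\<close>.\<close>

definition sylow :: "nat set" where
  "sylow = (\<lambda>i. E (int m * i) 1) ` {0..<int (p ^ a)}"

lemma sylow_E: "E (int m * i) 1 \<in> sylow"
proof -
  have "[int m * i = int m * (i mod int (p ^ a))] (mod int n)"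
    by (simp only: cong_def int_n mult.commute[of "int (p ^ a)"] mod_mod_trivial flip: mult_mod_right)
  then have "E (int m * i) 1 = E (int m * (i mod int (p ^ a))) 1" by (rule E_cong[OF _ cong_refl])
  moreover have "i mod int (p ^ a) \<in> {0..<int (p ^ a)}" using q0 by (simp del: of_nat_power)
  ultimately show ?thesis unfolding sylow_def by (rule image_eqI)
qed

lemma sylow_cases: "x \<in> sylow \<Longrightarrow> \<exists>i. x = E (int m * i) 1"
  by (auto simp: sylow_def)

lemma sylow_subgroup_G: "subgroup sylow G"
proof (rule subgroupI)
  show "sylow \<subseteq> carrier G" by (auto simp: sylow_def H_one)
  show "sylow \<noteq> {}" using sylow_E by blast
  fix x assume "x \<in> sylow"
  then obtain i where x: "x = E (int m * i) 1" using sylow_cases by blast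
  show "inv\<^bsub>G\<^esub> x \<in> sylow" using sylow_E[of "- i"] by (simp add: x inv_E1)
  fix y assume "y \<in> sylow"
  then obtain j where y: "y = E (int m * j) 1" using sylow_cases by blast
  show "x \<otimes>\<^bsub>G\<^esub> y \<in> sylow" using sylow_E[of "i + j"] by (simp add: x y E_mult distrib_left)
qed

lemma card_sylow: "card sylow = p ^ a"
proof -
  have "inj_on (\<lambda>i. E (int m * i) 1) {0..<int (p ^ a)}"
  proof (rule inj_onI)
    fix i j assume ij: "i \<in> {0..<int (p ^ a)}" "j \<in> {0..<int (p ^ a)}" and "E (int m * i) 1 = E (int m * j) 1"
    then have "[int m * i = int m * j] (mod int (p ^ a))" unfolding E_eq_iff cong_n_iff by blast
    moreover have "coprime (int m) (int (p ^ a))" using coprime_pm by (simp only: coprime_commute)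
    ultimately have "[i = j] (mod int (p ^ a))" by (simp only: cong_mult_lcancel)
    then show "i = j" using ij by (simp add: cong_def)
  qed
  then have "card sylow = card {0..<int (p ^ a)}" unfolding sylow_def by (rule card_image)
  also have "\<dots> = p ^ a" by (simp only: card_atLeastLessThan_int diff_zero nat_int)
  finally show ?thesis .
qed

text \<open>The order of the stabilizer divides \<open>|A| \<psi>\<^sub>0(x\<^bsup>-1\<^esup>)\<close>
  in the ring of algebraic integers, and neither factor lies in the prime ideal
  \<open>M\<close>.\<close>

lemma stab_card_not_dvd:
  assumes "psi0_inv (E c 1) \<notin> M"
  shows "\<not> p dvd card (residues (stab c))"
proof
  assume "p dvd card (residues (stab c))"
  then have cM: "of_nat (card (residues (stab c))) \<in> M" using of_nat_in_max_ideal_iff[OF p] by blast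
  obtain y where y: "algebraic_int y"
    "(\<Sum>t\<in>residues H. zeta n (- eps * t * c)) = of_nat (card (residues (stab c))) * y" using sum_orbit by blast
  have A0: "of_nat (card (residues A)) \<noteq> (0::complex)" using card_residues_pos[OF A_subgroup] by simp
  have "of_nat (card (residues A)) * psi0_inv (E c 1) = y * of_nat (card (residues (stab c)))"
    using A0 y(2) by (simp add: psi0_inv_E mult.commute)
  also have "\<dots> \<in> M" by (rule M_props(4)[OF cM y(1)])
  finally have "of_nat (card (residues A)) \<in> M \<or> psi0_inv (E c 1) \<in> M"
    by (rule max_ideal_prime[OF p]) (simp_all add: psi0_inv_algebraic_int H_one)
  then show False using assms of_nat_in_max_ideal_iff[OF p] pA' by blast
qed

lemma n_mult: "n * k = m * k * p ^ a"
  by (subst nam) (simp only: mult_ac)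

lemma chi_Irr: "\<chi> \<in> Irr G"
  by (rule ind_C_Irr[OF stab_1])

text \<open>The centralizer of the translation \<open>x\<close> found above has order \<open>n\<close>
  times that of a \<open>p'\<close>-group, so \<open>sylow\<close> is its Sylow
  \<open>p\<close>-subgroup and a defect group.\<close>

lemma chi_height_zero: "has_p_height p G \<chi> 0"
proof -
  have chi: "\<chi> \<in> block" using chi_Irr by (simp add: block_def same_block_def M_props)
  obtain x where x: "x \<in> C_pprime" "psi0_inv x \<notin> M" "central_character G \<chi> x \<notin> M" by (rule defect_element_exists)
  obtain c where c: "x = E c 1" using C_E[OF C_pprime_C[OF x(1)]] by (elim exE)
  have "block_idempotent_coeff G block x \<notin> local_max_ideal p"
    unfolding block_sum[OF x(1)] using local_max_ideal_int[OF p _ psi0_inv_algebraic_int[OF C_pprime_carrier[OF x(1)]] pm] x(2) by blast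
  then have "in_defect_class p G block x"
    unfolding in_defect_class_def using C_pprime_carrier[OF x(1)] x(3) chi by blast
  moreover have "sylow_subgroup p G (centralizer G x) sylow"
    unfolding sylow_subgroup_def
  proof (intro conjI)
    show "subgroup sylow G" by (rule sylow_subgroup_G)
    show "sylow \<subseteq> centralizer G x"
      unfolding c centralizer_E using E_in_above[OF stab_subgroup] unit_subgroupD(2)[OF stab_subgroup]
      by (auto simp: sylow_def)
    have nd: "\<not> p dvd card (residues (stab c))" using stab_card_not_dvd x(2) unfolding c by blast
    have "card (centralizer G x) = m * card (residues (stab c)) * p ^ a"
      unfolding c centralizer_E card_above[OF stab_subgroup] by (rule n_mult)
    then have "p_part p (card (centralizer G x)) = p_part p (m * card (residues (stab c)) * p ^ a)" by (simp only:)
    also have "\<dots> = p_part p (p ^ a)"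
    proof (rule p_part_mult_coprime[OF p])
      show "\<not> p dvd m * card (residues (stab c))" using pm nd by (simp add: prime_dvd_mult_iff[OF p])
    qed (use q0 in simp)
    also have "\<dots> = p ^ a" using p by (simp add: p_part_def)
    finally show "card sylow = p_part p (card (centralizer G x))" by (simp add: card_sylow)
  qed
  ultimately have def: "sylow \<in> defect_groups p G block" unfolding defect_groups_def by blast
  have "card (rcosets\<^bsub>G\<^esub> sylow) * card sylow = Coset.order G"
    by (rule lagrange_finite[OF _ sylow_subgroup_G]) (rule finite_carrier)
  then have "card (rcosets\<^bsub>G\<^esub> sylow) * p ^ a = m * card (residues H) * p ^ a"
    by (simp only: card_sylow Coset.order_def card_G n_mult)
  then have idx: "card (rcosets\<^bsub>G\<^esub> sylow) = m * card (residues H)" 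
    using q0 mult_right_cancel[of "p ^ a" "card (rcosets\<^bsub>G\<^esub> sylow)" "m * card (residues H)"] by linarith
  have "p_part p (card (residues H)) = p_part p (card (rcosets\<^bsub>G\<^esub> sylow)) * p ^ 0"
    unfolding idx using p_part_mult_coprime[OF p pm, of "card (residues H)"] card_residues_pos[OF H_subgroup] by simp
  moreover have "block \<in> blocks p G" unfolding blocks_def block_def using chi_Irr by blast
  ultimately show ?thesis
    unfolding has_p_height_def using chi def ind_C_one[of 1] by blast
qed

end

section \<open>The field of values\<close>

lemma (in unit_group) field_of_values_induced_lam:
  "field_of_values G (induced G (above trivial_units) (lam 1)) =
    generated_subfield (range (\<lambda>k. \<Sum>h\<in>H \<inter> {0..<int n}. zeta n (h * k)))" (is "_ = generated_subfield ?T")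
proof -
  let ?S = "induced G (above trivial_units) (lam 1) ` carrier G"
  have T: "?T \<subseteq> ?S"
  proof
    fix x assume "x \<in> ?T"
    then obtain k where "x = (\<Sum>h\<in>H \<inter> {0..<int n}. zeta n (h * k))" by blast
    then have "x = induced G (above trivial_units) (lam 1) (E k 1)" by (simp add: induced_lam_E[OF H_one] residues_def)
    moreover have "E k 1 \<in> carrier G" by (simp add: H_one)
    ultimately show "x \<in> ?S" by (rule image_eqI)
  qed
  have S: "?S \<subseteq> generated_subfield ?T"
  proof
    fix x assume "x \<in> ?S"
    then obtain g where g: "g \<in> carrier G" "x = induced G (above trivial_units) (lam 1) g" by blast
    obtain k h where kh: "g = E k h" "h \<in> H" using g(1) by (rule carrierE)
    have "(\<Sum>h\<in>H \<inter> {0..<int n}. zeta n (h * k)) \<in> generated_subfield ?T"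
      by (rule subsetD[OF generated_subfield_incl rangeI])
    moreover have "0 \<in> generated_subfield ?T" by (rule subfield_closed(1)[OF generated_subfield_is_subfield])
    ultimately show "x \<in> generated_subfield ?T" unfolding g(2) kh(1) induced_lam_E[OF kh(2)] by (simp add: residues_def)
  qed
  show ?thesis
    unfolding field_of_values_def
  proof
    show "generated_subfield ?S \<subseteq> generated_subfield ?T"
      by (rule generated_subfield_least[OF generated_subfield_is_subfield S])
    show "generated_subfield ?T \<subseteq> generated_subfield ?S"
      by (rule generated_subfield_least[OF generated_subfield_is_subfield]) (rule order_trans[OF T generated_subfield_incl])
  qed
qed

theorem theorem5p1:
  fixes p n a m :: nat and F :: "complex set"
  assumes "prime p"
    and "0 < n"
    and "subfield F class_ring"
    and "\<rat> \<subseteq> F"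
    and "F \<subseteq> cyclotomic_field n"
    and "n = conductor F"
    and "n = p ^ a * m"
    and "\<not> p dvd m"
    and "\<not> p dvd extension_degree (cyclotomic_field n) (generated_subfield (F \<union> cyclotomic_field m))"
  shows "\<exists>(G :: nat monoid) \<chi>. group G \<and> finite (carrier G) \<and> solvable G \<and>
           \<chi> \<in> Irr G \<and> has_p_height p G \<chi> 0 \<and> field_of_values G \<chi> = F"
proof -
  let ?H = "galois_exponents n F"
  note n = assms(2) and F = assms(3) and Fn = assms(5) and nam = assms(7)
  have "?H \<inter> {h. [h = 1] (mod int m)} = galois_exponents n (generated_subfield (F \<union> cyclotomic_field m))"
    unfolding galois_exponents_compositum[OF n F Fn nam] by blast
  then have "card (?H \<inter> {h. [h = 1] (mod int m)} \<inter> {0..<int n})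
      = extension_degree (cyclotomic_field n) (generated_subfield (F \<union> cyclotomic_field m))"
    using extension_degree_cyclotomic[OF n generated_subfield_is_subfield compositum_subset_cyclotomic[OF n Fn nam]]
    by simp
  then have "\<not> p dvd card (?H \<inter> {h. [h = 1] (mod int m)} \<inter> {0..<int n})" using assms(9) by simp
  then interpret block_data n ?H p a m
  proof unfold_locales
    show "\<exists>k\<in>?H. [h * k = 1] (mod int n)" if "h \<in> ?H" for h
      using galois_exponents_inverse[OF n F that] by metis
  qed (use n galois_exponents_one galois_exponents_mult[OF n F] galois_exponents_cong[OF n]
      galois_exponents_coprime[OF n F] assms(1,8) nam in simp_all)
  have "field_of_values G \<chi> = F"
    unfolding field_of_values_induced_lam by (rule galois_traces_generate[OF n F Fn])
  then show ?thesis
    using group_G finite_carrier solvable_G chi_Irr chi_height_zero by blast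
qed

end
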